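(* In neutral constructive geometry (with intuitionistic logic), Euclid 5 implies the strong parallel postulate.
   Context: Logic is intuitionistic. Neutral constructive geometry means constructive plane geometry without any parallel postulate. Primitives: points, strict betweenness $B(a,b,c)$, segment congruence $ab=cd$; $T(a,b,c)$ abbreviates $\neg(a\neq b\wedge b\neq c\wedge\neg B(a,b,c))$. For $a\neq b$, a point $x$ lies on $\mathrm{Line}(a,b)$ iff $\neg\neg(B(a,b,x)\vee B(b,x,a)\vee B(x,a,b)\vee x=a\vee x=b)$; every line is given by two distinct points. Points are collinear if they lie on a common line. A circle is given by a center and a radius segment (possibly null). $ab\le cd$ means $\exists e\,(T(c,e,d)\wedge ab=ce)$. No particular axiomatization is prescribed; the principles used are: (1) Stability: $\neg\neg A\to A$ for $A$ an equality, betweenness or congruence. (2) $ab=ba$; $ab=pq\wedge ab=rs\to pq=rs$; $ab=cc\to a=b$. (3) Extension: if $a\neq b$ then for all $c,d$ there is $x$ with $T(a,b,x)$ and $bx=cd$. (4) Five-segment axiom: if $a\neq b$, $T(a,b,c)$, $T(a',b',c')$, $ab=a'b'$, $bc=b'c'$, $ad=a'd'$, $bd=b'd'$ then $cd=c'd'$. (5) $B(a,b,c)$ implies $B(c,b,a)$, $a\ne b$, $b\neq c$; $\neg B(a,b,a)$; $T(a,b,d)\wedge T(b,c,d)\to T(a,b,c)\wedge T(a,c,d)$; $T(a,b,c)\wedge T(b,c,d)\wedge b\neq c\to T(a,c,d)\wedge T(a,b,d)$; $B(a,b,c)\wedge B(a,b,d)\wedge\neg T(a,c,d)\to T(a,d,c)$.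 (6) Inner Pasch: if $a,b,c$ are not collinear, $B(a,p,c)$ and $B(b,q,c)$, there is $x$ with $B(p,x,b)$ and $B(q,x,a)$. (7) There are three non-collinear points; any three points each equidistant from two given distinct points are collinear. (8) Line-circle continuity: if $a\ne b$, $a$ is non-strictly inside a circle and $b$ non-strictly outside it, then the circle contains a point $x$ with $T(a,x,b)$. Circle-circle continuity: if two circles have distinct centers and the first has a point non-strictly inside and a point non-strictly outside the second, they have a common point. Euclid 5: for all points $p,q,r,s,t,a$, if $B(q,a,r)$, $B(p,t,q)$, $B(s,t,r)$, $pt=qt$, $rt=st$, $p\neq r$, and $p$ is not on $\mathrm{Line}(s,q)$, then there is a point $x$ on both $\mathrm{Line}(s,q)$ and $\mathrm{Line}(p,a)$ with $B(p,a,x)$ and $B(s,q,x)$. Strong parallel postulate: for all points $p,q,r,s,t,a$, if $B(p,t,q)$, $B(s,t,r)$, $pt=qt$, $rt=st$, $p\neq r$, $p$ is not on $\mathrm{Line}(s,q)$, and $a$ is not on $\mathrm{Line}(p,r)$, then there is a point on both $\mathrm{Line}(s,q)$ and $\mathrm{Line}(p,a)$. *)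

theory Defs
  imports Main
begin

text \<open>
  Isabelle/HOL is classical, so the claim is stated as derivability in first-order intuitionistic
  logic with equality, over the language with one sort (points), betweenness and congruence, and
  no function symbols.  Variables are de Bruijn indices; the only terms are variables.
\<close>

datatype fm =
    Eq nat nat          (infix "\<^bold>=" 55)
  | Bet nat nat nat
  | Cong nat nat nat nat
  | Falsum              ("\<^bold>\<bottom>")
  | Con fm fm           (infixr "\<^bold>\<and>" 45)
  | Dis fm fm           (infixr "\<^bold>\<or>" 40)
  | Imp fm fm           (infixr "\<^bold>\<longrightarrow>" 35)
  | Forall fm
  | Exists fm

abbreviation Neg :: "fm \<Rightarrow> fm" ("\<^bold>\<not> _" [50] 50) where
  "\<^bold>\<not> A \<equiv> A \<^bold>\<longrightarrow> \<^bold>\<bottom>"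

abbreviation Neq :: "nat \<Rightarrow> nat \<Rightarrow> fm" (infix "\<^bold>\<noteq>" 55) where
  "x \<^bold>\<noteq> y \<equiv> \<^bold>\<not> (x \<^bold>= y)"

text \<open>Capture-avoiding renaming: under a binder, index 0 is left alone.\<close>

primrec ren :: "(nat \<Rightarrow> nat) \<Rightarrow> fm \<Rightarrow> fm" where
  "ren f (x \<^bold>= y) = (f x \<^bold>= f y)"
| "ren f (Bet x y z) = Bet (f x) (f y) (f z)"
| "ren f (Cong x y z w) = Cong (f x) (f y) (f z) (f w)"
| "ren f \<^bold>\<bottom> = \<^bold>\<bottom>"
| "ren f (A \<^bold>\<and> B) = (ren f A \<^bold>\<and> ren f B)"
| "ren f (A \<^bold>\<or> B) = (ren f A \<^bold>\<or> ren f B)"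
| "ren f (A \<^bold>\<longrightarrow> B) = (ren f A \<^bold>\<longrightarrow> ren f B)"
| "ren f (Forall A) = Forall (ren (case_nat 0 (\<lambda>n. Suc (f n))) A)"
| "ren f (Exists A) = Exists (ren (case_nat 0 (\<lambda>n. Suc (f n))) A)"

abbreviation shift :: "fm \<Rightarrow> fm" where
  "shift \<equiv> ren Suc"

text \<open>\<open>inst x A\<close> is the body \<open>A\<close> of a quantifier with the bound variable replaced by \<open>x\<close>.\<close>

abbreviation inst :: "nat \<Rightarrow> fm \<Rightarrow> fm" where
  "inst x \<equiv> ren (case_nat x (\<lambda>n. n))"

text \<open>
  Natural deduction for intuitionistic logic.  Shifting the assumptions (and, in \<open>ExistsE\<close>, the
  conclusion) makes index 0 a fresh eigenvariable.
\<close>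

inductive deriv :: "fm set \<Rightarrow> fm \<Rightarrow> bool" (infix "\<turnstile>" 30) where
  Assm: "A \<in> \<Gamma> \<Longrightarrow> \<Gamma> \<turnstile> A"
| FalsumE: "\<Gamma> \<turnstile> \<^bold>\<bottom> \<Longrightarrow> \<Gamma> \<turnstile> A"
| ConI: "\<Gamma> \<turnstile> A \<Longrightarrow> \<Gamma> \<turnstile> B \<Longrightarrow> \<Gamma> \<turnstile> A \<^bold>\<and> B"
| ConE1: "\<Gamma> \<turnstile> A \<^bold>\<and> B \<Longrightarrow> \<Gamma> \<turnstile> A"
| ConE2: "\<Gamma> \<turnstile> A \<^bold>\<and> B \<Longrightarrow> \<Gamma> \<turnstile> B"
| DisI1: "\<Gamma> \<turnstile> A \<Longrightarrow> \<Gamma> \<turnstile> A \<^bold>\<or> B"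
| DisI2: "\<Gamma> \<turnstile> B \<Longrightarrow> \<Gamma> \<turnstile> A \<^bold>\<or> B"
| DisE: "\<Gamma> \<turnstile> A \<^bold>\<or> B \<Longrightarrow> insert A \<Gamma> \<turnstile> C \<Longrightarrow> insert B \<Gamma> \<turnstile> C \<Longrightarrow> \<Gamma> \<turnstile> C"
| ImpI: "insert A \<Gamma> \<turnstile> B \<Longrightarrow> \<Gamma> \<turnstile> A \<^bold>\<longrightarrow> B"
| ImpE: "\<Gamma> \<turnstile> A \<^bold>\<longrightarrow> B \<Longrightarrow> \<Gamma> \<turnstile> A \<Longrightarrow> \<Gamma> \<turnstile> B"
| ForallI: "shift ` \<Gamma> \<turnstile> A \<Longrightarrow> \<Gamma> \<turnstile> Forall A"
| ForallE: "\<Gamma> \<turnstile> Forall A \<Longrightarrow> \<Gamma> \<turnstile> inst x A"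
| ExistsI: "\<Gamma> \<turnstile> inst x A \<Longrightarrow> \<Gamma> \<turnstile> Exists A"
| ExistsE: "\<Gamma> \<turnstile> Exists A \<Longrightarrow> insert A (shift ` \<Gamma>) \<turnstile> shift C \<Longrightarrow> \<Gamma> \<turnstile> C"
| EqI: "\<Gamma> \<turnstile> x \<^bold>= x"
| EqE: "\<Gamma> \<turnstile> x \<^bold>= y \<Longrightarrow> \<Gamma> \<turnstile> inst x A \<Longrightarrow> \<Gamma> \<turnstile> inst y A"

text \<open>
  Below, geometric notions are formulas depending on variables \<open>a, b, \<dots>\<close>.  Under \<open>Exists\<close> the bound
  point is \<open>0\<close> and an outer variable \<open>a\<close> becomes \<open>Suc a\<close>.
\<close>

definition T :: "nat \<Rightarrow> nat \<Rightarrow> nat \<Rightarrow> fm" where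
  "T a b c = (\<^bold>\<not> (a \<^bold>\<noteq> b \<^bold>\<and> b \<^bold>\<noteq> c \<^bold>\<and> \<^bold>\<not> Bet a b c))"

text \<open>
  \<open>on_line a b x\<close>: the point \<open>x\<close> lies on Line(a,b).  This is meant for distinct \<open>a\<close> and \<open>b\<close>, which
  is required explicitly in \<open>collinear\<close>; in the two parallel postulates the hypotheses force the
  points spanning each line to be distinct.
\<close>

definition on_line :: "nat \<Rightarrow> nat \<Rightarrow> nat \<Rightarrow> fm" where
  "on_line a b x =
     (\<^bold>\<not> \<^bold>\<not> (Bet a b x \<^bold>\<or> Bet b x a \<^bold>\<or> Bet x a b \<^bold>\<or> x \<^bold>= a \<^bold>\<or> x \<^bold>= b))"

text \<open>Here the common line is spanned by the bound points \<open>1\<close> and \<open>0\<close>.\<close>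

definition collinear :: "nat \<Rightarrow> nat \<Rightarrow> nat \<Rightarrow> fm" where
  "collinear a b c =
     Exists (Exists (1 \<^bold>\<noteq> 0 \<^bold>\<and> on_line 1 0 (Suc (Suc a)) \<^bold>\<and> on_line 1 0 (Suc (Suc b))
       \<^bold>\<and> on_line 1 0 (Suc (Suc c))))"

definition seg_le :: "nat \<Rightarrow> nat \<Rightarrow> nat \<Rightarrow> nat \<Rightarrow> fm" where
  "seg_le a b c d = Exists (T (Suc c) 0 (Suc d) \<^bold>\<and> Cong (Suc a) (Suc b) (Suc c) 0)"

definition extension :: "nat \<Rightarrow> nat \<Rightarrow> nat \<Rightarrow> nat \<Rightarrow> fm" where
  "extension a b c d =
     (a \<^bold>\<noteq> b \<^bold>\<longrightarrow> Exists (T (Suc a) (Suc b) 0 \<^bold>\<and> Cong (Suc b) 0 (Suc c) (Suc d)))"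

definition five_segment ::
    "nat \<Rightarrow> nat \<Rightarrow> nat \<Rightarrow> nat \<Rightarrow> nat \<Rightarrow> nat \<Rightarrow> nat \<Rightarrow> nat \<Rightarrow> fm" where
  "five_segment a b c d a' b' c' d' =
     (a \<^bold>\<noteq> b \<^bold>\<and> T a b c \<^bold>\<and> T a' b' c' \<^bold>\<and> Cong a b a' b' \<^bold>\<and> Cong b c b' c'
       \<^bold>\<and> Cong a d a' d' \<^bold>\<and> Cong b d b' d' \<^bold>\<longrightarrow> Cong c d c' d')"

definition inner_pasch :: "nat \<Rightarrow> nat \<Rightarrow> nat \<Rightarrow> nat \<Rightarrow> nat \<Rightarrow> fm" where
  "inner_pasch a b c p q =
     (\<^bold>\<not> collinear a b c \<^bold>\<and> Bet a p c \<^bold>\<and> Bet b q c \<^bold>\<longrightarrow>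
       Exists (Bet (Suc p) 0 (Suc b) \<^bold>\<and> Bet (Suc q) 0 (Suc a)))"

definition upper_dim :: "nat \<Rightarrow> nat \<Rightarrow> nat \<Rightarrow> nat \<Rightarrow> nat \<Rightarrow> fm" where
  "upper_dim p q a b c =
     (p \<^bold>\<noteq> q \<^bold>\<and> Cong a p a q \<^bold>\<and> Cong b p b q \<^bold>\<and> Cong c p c q \<^bold>\<longrightarrow> collinear a b c)"

text \<open>The circle has center \<open>c\<close> and radius segment \<open>uv\<close>.\<close>

definition line_circle :: "nat \<Rightarrow> nat \<Rightarrow> nat \<Rightarrow> nat \<Rightarrow> nat \<Rightarrow> fm" where
  "line_circle a b c u v =
     (a \<^bold>\<noteq> b \<^bold>\<and> seg_le c a u v \<^bold>\<and> seg_le u v c b \<^bold>\<longrightarrow>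
       Exists (Cong (Suc c) 0 (Suc u) (Suc v) \<^bold>\<and> T (Suc a) 0 (Suc b)))"

text \<open>
  The circles have centers \<open>c\<close>, \<open>d\<close> and radius segments \<open>uv\<close>, \<open>wz\<close>; the points \<open>i\<close> and \<open>e\<close> of the
  first circle are inside and outside the second one, respectively.
\<close>

definition circle_circle ::
    "nat \<Rightarrow> nat \<Rightarrow> nat \<Rightarrow> nat \<Rightarrow> nat \<Rightarrow> nat \<Rightarrow> nat \<Rightarrow> nat \<Rightarrow> fm" where
  "circle_circle c u v d w z i e =
     (c \<^bold>\<noteq> d \<^bold>\<and> Cong c i u v \<^bold>\<and> seg_le d i w z \<^bold>\<and> Cong c e u v \<^bold>\<and> seg_le w z d e \<^bold>\<longrightarrow>
       Exists (Cong (Suc c) 0 (Suc u) (Suc v) \<^bold>\<and> Cong (Suc d) 0 (Suc w) (Suc z)))"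

text \<open>
  \<open>univ_closure n A\<close> is the universal closure of a formula whose free variables are below \<open>n\<close>.
\<close>

definition univ_closure :: "nat \<Rightarrow> fm \<Rightarrow> fm" where
  "univ_closure n A = (Forall ^^ n) A"

definition stability_axioms :: "fm set" where
  "stability_axioms =
     {univ_closure 2 (\<^bold>\<not> \<^bold>\<not> (1 \<^bold>= 0) \<^bold>\<longrightarrow> 1 \<^bold>= 0),
      univ_closure 3 (\<^bold>\<not> \<^bold>\<not> Bet 2 1 0 \<^bold>\<longrightarrow> Bet 2 1 0),
      univ_closure 4 (\<^bold>\<not> \<^bold>\<not> Cong 3 2 1 0 \<^bold>\<longrightarrow> Cong 3 2 1 0)}"

definition congruence_axioms :: "fm set" where
  "congruence_axioms =
     {univ_closure 2 ((\<lambda>a b. Cong a b b a) 1 0),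
      univ_closure 6 ((\<lambda>a b p q r s. Cong a b p q \<^bold>\<and> Cong a b r s \<^bold>\<longrightarrow> Cong p q r s) 5 4 3 2 1 0),
      univ_closure 3 ((\<lambda>a b c. Cong a b c c \<^bold>\<longrightarrow> a \<^bold>= b) 2 1 0),
      univ_closure 4 (extension 3 2 1 0),
      univ_closure 8 (five_segment 7 6 5 4 3 2 1 0)}"

definition betweenness_axioms :: "fm set" where
  "betweenness_axioms =
     {univ_closure 3 ((\<lambda>a b c. Bet a b c \<^bold>\<longrightarrow> Bet c b a \<^bold>\<and> a \<^bold>\<noteq> b \<^bold>\<and> b \<^bold>\<noteq> c) 2 1 0),
      univ_closure 2 ((\<lambda>a b. \<^bold>\<not> Bet a b a) 1 0),
      univ_closure 4 ((\<lambda>a b c d. T a b d \<^bold>\<and> T b c d \<^bold>\<longrightarrow> T a b c \<^bold>\<and> T a c d) 3 2 1 0),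
      univ_closure 4 ((\<lambda>a b c d. T a b c \<^bold>\<and> T b c d \<^bold>\<and> b \<^bold>\<noteq> c \<^bold>\<longrightarrow> T a c d \<^bold>\<and> T a b d) 3 2 1 0),
      univ_closure 4 ((\<lambda>a b c d. Bet a b c \<^bold>\<and> Bet a b d \<^bold>\<and> \<^bold>\<not> T a c d \<^bold>\<longrightarrow> T a d c) 3 2 1 0),
      univ_closure 5 (inner_pasch 4 3 2 1 0)}"

definition dimension_axioms :: "fm set" where
  "dimension_axioms =
     {Exists (Exists (Exists (\<^bold>\<not> collinear 2 1 0))),
      univ_closure 5 (upper_dim 4 3 2 1 0)}"

definition continuity_axioms :: "fm set" where
  "continuity_axioms =
     {univ_closure 5 (line_circle 4 3 2 1 0),
      univ_closure 8 (circle_circle 7 6 5 4 3 2 1 0)}"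

definition neutral_geometry :: "fm set" where
  "neutral_geometry =
     stability_axioms \<union> congruence_axioms \<union> betweenness_axioms \<union> dimension_axioms
       \<union> continuity_axioms"

definition euclid5 :: fm where
  "euclid5 = univ_closure 6 ((\<lambda>p q r s t a.
     Bet q a r \<^bold>\<and> Bet p t q \<^bold>\<and> Bet s t r \<^bold>\<and> Cong p t q t \<^bold>\<and> Cong r t s t \<^bold>\<and> p \<^bold>\<noteq> r
       \<^bold>\<and> \<^bold>\<not> on_line s q p \<^bold>\<longrightarrow>
     Exists (on_line (Suc s) (Suc q) 0 \<^bold>\<and> on_line (Suc p) (Suc a) 0
       \<^bold>\<and> Bet (Suc p) (Suc a) 0 \<^bold>\<and> Bet (Suc s) (Suc q) 0)) 5 4 3 2 1 0)"

definition strong_parallel_postulate :: fm where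
  "strong_parallel_postulate = univ_closure 6 ((\<lambda>p q r s t a.
     Bet p t q \<^bold>\<and> Bet s t r \<^bold>\<and> Cong p t q t \<^bold>\<and> Cong r t s t \<^bold>\<and> p \<^bold>\<noteq> r
       \<^bold>\<and> \<^bold>\<not> on_line s q p \<^bold>\<and> \<^bold>\<not> on_line p r a \<^bold>\<longrightarrow>
     Exists (on_line (Suc s) (Suc q) 0 \<^bold>\<and> on_line (Suc p) (Suc a) 0)) 5 4 3 2 1 0)"

end

theory Submission
  imports Defs "HOL-Library.Countable" "HOL-Library.Infinite_Set"
begin

text \<open>
  The strong parallel postulate is Euclid 5 without the information on which side of the line
  \<open>pr\<close> the point \<open>a\<close> lies.  Intuitionistically this side cannot be decided, so the point in which
  the line \<open>pa\<close> meets the line \<open>L = sq\<close> has to be constructed in the same way on both sides.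

  The construction replaces \<open>a\<close> by a point of the line \<open>pa\<close> whose side is known.  Let \<open>c\<close> be the foot
  of the perpendicular from \<open>p\<close> to \<open>L\<close>, let \<open>c0\<close> be the midpoint of \<open>pc\<close>, and let \<open>f\<close> be the foot of
  the perpendicular from \<open>c0\<close> to the line \<open>pa\<close>.  All such feet lie on the circle with diameter
  \<open>p c0\<close>, which touches \<open>pr\<close> in \<open>p\<close> and otherwise runs strictly between \<open>pr\<close> and \<open>L\<close>; and \<open>f\<close> is not
  \<open>p\<close>, because \<open>a\<close> is not on \<open>pr\<close>.  So \<open>f\<close> lies strictly between the parallels, on the side of \<open>L\<close>
  whatever the side of \<open>a\<close>.  In terms of slopes this is the passage from \<open>1/x\<close> to \<open>x/x^2\<close>, which
  turns a divisor of unknown sign into a positive one.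

  Two applications of Euclid 5 finish the construction.  Let \<open>m1\<close> be the foot of \<open>f\<close> on \<open>pr\<close> and \<open>m2\<close>
  the foot of \<open>m1\<close> on \<open>L\<close>; then \<open>f\<close> is between \<open>m1\<close> and \<open>m2\<close> (\<open>crossing_point_in_strip\<close>).  For any
  point \<open>w\<close> of \<open>pr\<close> other than \<open>p\<close> and \<open>m1\<close>, Euclid 5 with the segment \<open>m2 m1\<close> through \<open>f\<close> gives a
  point \<open>q1\<close> of \<open>L\<close> with \<open>f\<close> between \<open>w\<close> and \<open>q1\<close>.  Euclid 5 with the segment \<open>q1 w\<close> through \<open>f\<close>
  then gives a point of \<open>L\<close> on the line \<open>pf\<close>, which is the line \<open>pa\<close> (\<open>intersection_constructed\<close>).

  The point \<open>c0\<close> may lie on \<open>pa\<close>, so feet must be dropped without knowing whether the given point is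
  on the line.  A circle around the point whose radius exceeds its distance from some point of the line
  cuts the line twice, and the foot is the midpoint of the two intersections (\<open>foot_step\<close>).

  Only the existence of the successive points needs an intuitionistic argument.  What has to be
  verified about them are stable formulas, which follow from their double negations.  By a completeness
  theorem of Henkin's kind, a stable formula is derivable as soon as it holds in all classical models
  of the theory (\<open>provable\<close>).  The construction is therefore a chain of rules, one for each
  application of an existence axiom, whose side conditions are theorems of classical plane geometry.
  These are proved first, in the style of Tarski, in a locale whose assumptions are the axioms.
\<close>

section \<open>Classical reading of the axioms\<close>

locale geometry =
  fixes bet :: "'p \<Rightarrow> 'p \<Rightarrow> 'p \<Rightarrow> bool"
    and cong :: "'p \<Rightarrow> 'p \<Rightarrow> 'p \<Rightarrow> 'p \<Rightarrow> bool"
begin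

definition bt :: "'p \<Rightarrow> 'p \<Rightarrow> 'p \<Rightarrow> bool" where
  "bt a b c \<longleftrightarrow> a = b \<or> b = c \<or> bet a b c"

definition onl :: "'p \<Rightarrow> 'p \<Rightarrow> 'p \<Rightarrow> bool" where
  "onl a b x \<longleftrightarrow> bet a b x \<or> bet b x a \<or> bet x a b \<or> x = a \<or> x = b"

definition le :: "'p \<Rightarrow> 'p \<Rightarrow> 'p \<Rightarrow> 'p \<Rightarrow> bool" where
  "le a b c d \<longleftrightarrow> (\<exists>e. bt c e d \<and> cong a b c e)"

end

text \<open>
  A set with one point satisfies all axioms of neutral geometry: there is no line, so that three
  equal points count as non-collinear.  So \<open>two_points\<close> is an assumption of its own; in the postulate
  it is provided by \<open>p \<noteq> r\<close>.  With two points, equilateral triangles give a third one off their line.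
\<close>

locale euclidean_plane = geometry bet cong
  for bet :: "'p \<Rightarrow> 'p \<Rightarrow> 'p \<Rightarrow> bool"
      and cong :: "'p \<Rightarrow> 'p \<Rightarrow> 'p \<Rightarrow> 'p \<Rightarrow> bool" +
  assumes cong_rev: "cong a b b a"
    and cong_inner: "cong a b p q \<Longrightarrow> cong a b r s \<Longrightarrow> cong p q r s"
    and cong_null: "cong a b c c \<Longrightarrow> a = b"
    and extend: "a \<noteq> b \<Longrightarrow> \<exists>x. bt a b x \<and> cong b x c d"
    and five_seg: "\<lbrakk>a \<noteq> b; bt a b c; bt a' b' c'; cong a b a' b'; cong b c b' c'; cong a d a' d';
                    cong b d b' d'\<rbrakk> \<Longrightarrow> cong c d c' d'"
    and bet_sym: "bet a b c \<Longrightarrow> bet c b a"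
    and bet_neq1: "bet a b c \<Longrightarrow> a \<noteq> b"
    and bet_irrefl: "\<not> bet a b a"
    and bt_inner_axiom: "bt a b d \<Longrightarrow> bt b c d \<Longrightarrow> bt a b c \<and> bt a c d"
    and bt_outer_axiom: "bt a b c \<Longrightarrow> bt b c d \<Longrightarrow> b \<noteq> c
        \<Longrightarrow> bt a c d \<and> bt a b d"
    and bet_conn_axiom: "bet a b c \<Longrightarrow> bet a b d \<Longrightarrow> \<not> bt a c d
        \<Longrightarrow> bt a d c"
    and pasch_axiom: "\<nexists>x y. x \<noteq> y \<and> onl x y a \<and> onl x y b \<and> onl x y c
        \<Longrightarrow> bet a p c \<Longrightarrow> bet b q c
           \<Longrightarrow> \<exists>x. bet p x b \<and> bet q x a"
    and two_points: "\<exists>a b :: 'p. a \<noteq> b"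
    and upper_dim_axiom: "p \<noteq> q \<Longrightarrow> cong a p a q \<Longrightarrow> cong b p b q
        \<Longrightarrow> cong c p c q
           \<Longrightarrow> \<exists>x y. x \<noteq> y \<and> onl x y a \<and> onl x y b \<and> onl x y c"
    and line_circle: "a \<noteq> b \<Longrightarrow> le c a u v \<Longrightarrow> le u v c b
        \<Longrightarrow> \<exists>x. cong c x u v \<and> bt a x b"
    and circle_circle: "c \<noteq> d \<Longrightarrow> cong c i u v \<Longrightarrow> le d i w z
        \<Longrightarrow> cong c e u v \<Longrightarrow> le w z d e
           \<Longrightarrow> \<exists>x. cong c x u v \<and> cong d x w z"
    and euclid5: "\<lbrakk>bet q a r; bet p t q; bet s t r; cong p t q t; cong r t s t; p \<noteq> r; \<not> onl s q p\<rbrakk>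
           \<Longrightarrow> \<exists>x. onl s q x \<and> onl p a x \<and> bet p a x \<and> bet s q x"
begin

lemma bet_neq2: "bet a b c \<Longrightarrow> b \<noteq> c" using bet_sym bet_neq1 by blast
lemma bet_neq3: "bet a b c \<Longrightarrow> a \<noteq> c" using bet_irrefl by blast

lemma bt_triv[simp]: "bt a a b" "bt a b b" by (auto simp: bt_def)
lemma bt_sym: "bt a b c \<Longrightarrow> bt c b a" using bet_sym by (auto simp: bt_def)
lemma bt_id: "bt a b a \<Longrightarrow> a = b" using bet_irrefl by (auto simp: bt_def)
lemma bet_iff: "bet a b c \<longleftrightarrow> bt a b c \<and> a \<noteq> b \<and> b \<noteq> c"
  unfolding bt_def using bet_neq1 bet_neq2 by blast

lemma bet_bt: "bet a b c \<Longrightarrow> bt a b c" by (simp add: bet_iff)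

lemma bt_in1: "bt a b d \<Longrightarrow> bt b c d \<Longrightarrow> bt a b c" using bt_inner_axiom by blast
lemma bt_in2: "bt a b d \<Longrightarrow> bt b c d \<Longrightarrow> bt a c d" using bt_inner_axiom by blast
lemma bt_in3: "bt a c d \<Longrightarrow> bt a b c \<Longrightarrow> bt b c d" using bt_inner_axiom bt_sym
    by blast
lemma bt_in4: "bt a c d \<Longrightarrow> bt a b c \<Longrightarrow> bt a b d" using bt_inner_axiom bt_sym
    by blast
lemma bt_out2: "bt a b c \<Longrightarrow> bt b c d \<Longrightarrow> b \<noteq> c
    \<Longrightarrow> bt a b d" using bt_outer_axiom by blast
lemma bt_antisym: "bt a b c \<Longrightarrow> bt b a c \<Longrightarrow> a = b"
  using bt_in1 bt_id by blast

lemma cong_refl[simp]: "cong a b a b" using cong_rev cong_inner by blast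
lemma cong_sym: "cong a b c d \<Longrightarrow> cong c d a b" using cong_inner cong_refl by blast
lemma cong_trans: "cong a b c d \<Longrightarrow> cong c d e f \<Longrightarrow> cong a b e f"
    using cong_inner cong_sym by blast
lemma cong_l: "cong a b c d \<Longrightarrow> cong b a c d" using cong_rev cong_inner by blast
lemma cong_r: "cong a b c d \<Longrightarrow> cong a b d c" using cong_l cong_sym by blast
lemma cong_lr: "cong a b c d \<Longrightarrow> cong b a d c" using cong_l cong_r by blast
lemmas [simp] = cong_rev

text \<open>
  With congruence as equality of lengths, chains of congruences become equational reasoning.
\<close>

definition len where "len a b = {(x, y). cong a b x y}"
lemma cong_len: "cong a b c d \<longleftrightarrow> len a b = len c d"
  unfolding len_def using cong_trans cong_sym cong_refl by blast
lemma len_commute: "len a b = len b a"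
  using cong_rev cong_len by blast
lemmas len_laws = cong_len len_commute

lemma ex_neq: "\<exists>b::'p. a \<noteq> b" using two_points by metis

lemma cong_triv[simp]: "cong a a b b"
  by (metis cong_null extend ex_neq)

lemma cong_null': "cong c c a b \<Longrightarrow> a = b" using cong_null cong_sym by blast
lemma extend_segment: "\<exists>x. bt a b x \<and> cong b x c d"
proof (cases "a = b")
  case True
  obtain e where "e \<noteq> b" using ex_neq by metis
  then show ?thesis using True extend[of e b c d] by (auto)
qed (use extend in blast)

lemma extend_proper: "\<exists>x. bt a b x \<and> b \<noteq> x"
proof -
  obtain c d where "(c::'p) \<noteq> d" using two_points by blast
  then show ?thesis using extend_segment[of a b c d] cong_null' by blast
qed

lemma five: "\<lbrakk>bt a b c; bt a' b' c'; cong a b a' b'; cong b c b' c'; cong a d a' d';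
                    cong b d b' d'; a \<noteq> b\<rbrakk> \<Longrightarrow> cong c d c' d'"
  using five_seg by blast

lemma add_seg: "\<lbrakk>bt a b c; bt a' b' c'; cong a b a' b'; cong b c b' c'\<rbrakk>
    \<Longrightarrow> cong a c a' c'"
proof (cases "a = b")
  case True
  assume h: "bt a b c" "bt a' b' c'" "cong a b a' b'" "cong b c b' c'"
  then have "a' = b'" using True cong_null' by blast
  then show ?thesis using h True by blast
next
  case False
  assume h: "bt a b c" "bt a' b' c'" "cong a b a' b'" "cong b c b' c'"
  show ?thesis using five[OF h cong_triv cong_lr[OF h(3)] False] cong_lr by blast
qed

lemma extension_unique:
  assumes h: "a \<noteq> b" "bt a b x" "cong b x c d" "bt a b y" "cong b y c d"
  shows "x = y"
proof -
  have 1: "cong b x b y" using h cong_trans cong_sym by blast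
  have "cong a x a y" using add_seg[OF h(2,4) cong_refl 1] .
  then have "cong x x x y" using five[OF h(2,2) cong_refl cong_refl _ 1 h(1)] by blast
  then show "x = y" by (rule cong_null')
qed

text \<open>
  Beyond \<open>c\<close> there is a further point \<open>e\<close>; the outer five-segment axiom carries the distance to \<open>d\<close>
  first from \<open>a, c\<close> to \<open>e\<close> and then from \<open>e, c\<close> back to \<open>b\<close>.
\<close>

lemma inner_five: "\<lbrakk>bt a b c; bt a' b' c'; cong a c a' c'; cong b c b' c'; cong a d a' d'; cong c d c' d'\<rbrakk>
   \<Longrightarrow> cong b d b' d'"
proof (cases "a = c")
  case True then show "\<lbrakk>bt a b c; bt a' b' c'; cong a c a' c'; cong b c b' c'; cong a d a' d'; cong c d c' d'\<rbrakk>
   \<Longrightarrow> cong b d b' d'" by (metis bt_id cong_null')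
next
  case False
  assume h: "bt a b c" "bt a' b' c'" "cong a c a' c'" "cong b c b' c'" "cong a d a' d'" "cong c d c' d'"
  obtain e where e: "bt a c e" "c \<noteq> e" using extend_proper by blast
  obtain e' where e': "bt a' c' e'" "cong c' e' c e" using extend_segment by blast
  have ed: "cong e d e' d'" using five[OF e(1) e'(1) h(3) _ h(5,6) False] e' cong_sym by blast
  have "bt e c b" "bt e' c' b'" using bt_sym e(1) h(1) e'(1) h(2) bt_in3 by blast+
  then show ?thesis using five[of e c b e' c' b' d d'] e e' ed h cong_sym cong_lr by blast
qed

lemma sub_seg: "\<lbrakk>bt a b c; bt a' b' c'; cong a c a' c'; cong b c b' c'\<rbrakk>
    \<Longrightarrow> cong a b a' b'"
  using inner_five[of a b c a' b' c' a a'] cong_lr cong_triv by blast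

lemma sub_seg2: "\<lbrakk>bt a b c; bt a' b' c'; cong a c a' c'; cong a b a' b'\<rbrakk>
    \<Longrightarrow> cong b c b' c'"
  using sub_seg[of c b a c' b' a'] cong_lr bt_sym by blast

definition cong3 where "cong3 a b c a' b' c' \<longleftrightarrow> cong a b a' b' \<and> cong a c a' c'
    \<and> cong b c b' c'"

text \<open>
  Extend \<open>c' a'\<close> backwards and lay off \<open>ab\<close> and \<open>bc\<close> from \<open>a'\<close> on; uniqueness of extension shows that the
  second segment ends in \<open>c'\<close>.
\<close>

lemma between_transfer:
  assumes h: "bt a b c" "cong a c a' c'"
  shows "\<exists>b'. bt a' b' c' \<and> cong3 a b c a' b' c'"
proof -
  show ?thesis
  proof (cases "a' = c'")
    case True then show ?thesis using h cong_null bt_id unfolding cong3_def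
        by (metis bt_triv(1) cong_triv cong_null)
  next
    case False
    obtain d' where d: "bt c' a' d'" "a' \<noteq> d'" using extend_proper by blast
    obtain b' where b: "bt d' a' b'" "cong a' b' a b" using extend_segment by blast
    obtain c'' where c: "bt d' b' c''" "cong b' c'' b c" using extend_segment by blast
    have 1: "bt a' b' c''" using b c bt_in3 by blast
    have 2: "cong a' c'' a c" using add_seg[OF 1 h(1)] b c by blast
    have 3: "bt d' a' c''" using b c bt_in4 by blast
    have "c'' = c'" using extension_unique[of d' a' c'' a c c'] d bt_sym 2 3 h cong_sym by metis
    then show ?thesis using 1 b c h unfolding cong3_def by (metis cong_sym)
  qed
qed

text \<open>
  The point between \<open>a'\<close> and \<open>c'\<close> that \<open>between_transfer\<close> provides has distance \<open>0\<close> from \<open>b'\<close>, by the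
  inner five-segment property.
\<close>

lemma cong3_between:
  assumes h: "bt a b c" "cong3 a b c a' b' c'"
  shows "bt a' b' c'"
proof -
  obtain b2 where b: "bt a' b2 c'" "cong3 a b c a' b2 c'" using between_transfer h unfolding cong3_def by blast
  have "cong b2 b2 b2 b'"
    using inner_five[of a' b2 c' a' b2 c' b2 b'] b h unfolding cong3_def
    by (meson cong_refl cong_inner cong_lr cong_sym)
  then show ?thesis using cong_null' b by blast
qed

lemma between_total: "\<lbrakk>a \<noteq> b; bt a b c; bt a b d\<rbrakk> \<Longrightarrow> bt a c d
    \<or> bt a d c"
  using bet_conn_axiom[of a b c d] unfolding bt_def by blast

lemma between_total_beyond: "\<lbrakk>a \<noteq> b; bt a b c; bt a b d\<rbrakk> \<Longrightarrow> bt b c d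
    \<or> bt b d c"
  using between_total bt_in3 by blast

lemma between_total_below:
  assumes h: "bt a b d" "bt a c d"
  shows "bt a b c \<or> bt a c b"
proof -
  obtain e where e: "bt d a e" "a \<noteq> e" using extend_proper by blast
  have "bt e a b" "bt e a c" using e h bt_sym bt_in1 by blast+
  then show ?thesis using between_total_beyond[of e a b c] e by blast
qed

definition col :: "'p \<Rightarrow> 'p \<Rightarrow> 'p \<Rightarrow> bool" where
  "col a b c \<longleftrightarrow> bt a b c \<or> bt b c a \<or> bt c a b"

lemma col_perm: "col a b c \<Longrightarrow> col b a c" "col a b c \<Longrightarrow> col a c b"
    "col a b c \<Longrightarrow> col c b a"
  "col a b c \<Longrightarrow> col b c a" "col a b c \<Longrightarrow> col c a b"
  unfolding col_def using bt_sym by blast+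

lemma col_triv[simp]: "col a a b" "col a b b" "col a b a" unfolding col_def by auto
lemma bt_col: "bt a b c \<Longrightarrow> col a b c" by (simp add: col_def)

lemma onl_imp_col: "onl a b x \<Longrightarrow> col a b x"
  unfolding onl_def col_def bt_def by blast

lemma onl_iff_col: "a \<noteq> b \<Longrightarrow> onl a b x \<longleftrightarrow> col a b x"
  unfolding onl_def col_def bt_def by blast

text \<open>
  Each hypothesis places a point in one of three segments or rays of the line \<open>ab\<close>, and the nine cases
  are settled by the order axioms.
\<close>

lemma col_trans:
  assumes h: "a \<noteq> b" "col a b c" "col a b d"
  shows "col a c d"
proof -
  consider "bt a b c" | "bt a c b" | "bt c a b" using h bt_sym unfolding col_def by blast
  then show ?thesis
  proof cases
    case 1
    consider "bt a b d" | "bt a d b" | "bt d a b" using h bt_sym unfolding col_def by blast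
    then show ?thesis
    proof cases
      case 1 then show ?thesis using \<open>bt a b c\<close> between_total h bt_col col_perm by blast
    next
      case 2 then show ?thesis using \<open>bt a b c\<close> bt_in4 bt_col col_perm by blast
    next
      case 3 then show ?thesis using \<open>bt a b c\<close> bt_out2 h bt_col col_perm by blast
    qed
  next
    case 2
    consider "bt a b d" | "bt a d b" | "bt d a b" using h bt_sym unfolding col_def by blast
    then show ?thesis
    proof cases
      case 1 then show ?thesis using 2 bt_in4 bt_col by blast
    next
      case 2 then show ?thesis using \<open>bt a c b\<close> between_total_below bt_col col_perm by blast
    next
      case 3 then show ?thesis using 2 bt_in1 bt_col col_perm by blast
    qed
  next
    case 3
    consider "bt a b d" | "bt a d b" | "bt d a b" using h bt_sym unfolding col_def by blast
    then show ?thesis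
    proof cases
      case 1 then show ?thesis using 3 bt_out2 h bt_col col_perm by blast
    next
      case 2 then show ?thesis using 3 bt_in1 bt_col col_perm by blast
    next
      case 3
      then have "bt b a c" "bt b a d" using \<open>bt c a b\<close> bt_sym by blast+
      then show ?thesis using between_total_beyond h bt_col col_perm by metis
    qed
  qed
qed

lemma col_ac: "col a b c = col b a c" "col a b c = col a c b" using col_perm by blast+

lemma col_line: "\<lbrakk>x \<noteq> y; col x y a; col x y b; col x y c\<rbrakk> \<Longrightarrow> col a b c"
proof (cases "x = a")
  assume h: "x \<noteq> y" "col x y a" "col x y b" "col x y c"
  case True
  show ?thesis using col_trans[OF h(1,3,4)] True by simp
next
  assume h: "x \<noteq> y" "col x y a" "col x y b" "col x y c"
  case False
  have "col x a b" "col x a c" using col_trans[OF h(1,2)] h(3,4) by blast+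
  then have "col a x b" "col a x c" using col_perm by blast+
  then show ?thesis using col_trans[of a x b c] False by blast
qed

lemma line_unique: "\<lbrakk>\<not> col a b c; c \<noteq> d; col a b x; col a b y; col c d x; col c d y\<rbrakk> \<Longrightarrow> x = y"
proof (rule ccontr)
  assume h: "\<not> col a b c" "c \<noteq> d" "col a b x" "col a b y" "col c d x" "col c d y" "x \<noteq> y"
  have ab: "a \<noteq> b" using h(1) by auto
  have "col x y a" "col x y b" "col x y c"
    using col_line[OF ab h(3,4)] col_line[OF h(2,5,6)] by simp_all
  then show False using col_line[OF h(7)] h(1) by blast
qed

lemma pasch: "\<lbrakk>\<not> col a b c; bet a p c; bet b q c\<rbrakk>
    \<Longrightarrow> \<exists>x. bet p x b \<and> bet q x a"
  using pasch_axiom[of a b c p q] onl_imp_col col_line by blast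

lemma upper_dim: "\<lbrakk>p \<noteq> q; cong a p a q; cong b p b q; cong c p c q\<rbrakk>
    \<Longrightarrow> col a b c"
  using upper_dim_axiom[of p q a b c] onl_imp_col col_line by blast

lemma five_col:
  assumes h: "a \<noteq> b" "col a b c" "cong3 a b c a' b' c'" "cong a d a' d'" "cong b d b' d'"
  shows "cong c d c' d'"
proof -
  consider "bt a b c" | "bt b a c" | "bt a c b" using h(2) bt_sym unfolding col_def by blast
  then show ?thesis
  proof cases
    case 1
    then have "bt a' b' c'" using h(3) cong3_between by blast
    then show ?thesis using five[OF 1 _ _ _ h(4,5,1)] h(3) cong3_def by blast
  next
    case 2
    have "cong3 b a c b' a' c'" using h(3) cong_lr cong3_def by blast
    then show ?thesis using five[of b a c b' a' c' d d'] 2 h cong3_between cong3_def by blast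
  next
    case 3
    have "cong3 a c b a' c' b'" using h(3) cong_lr cong3_def by blast
    then show ?thesis using inner_five[of a c b a' c' b' d d'] 3 h cong3_between cong3_def by blast
  qed
qed

lemma equidist_col: "\<lbrakk>a \<noteq> b; col a b c; cong a p a q; cong b p b q\<rbrakk>
    \<Longrightarrow> cong c p c q"
  using five_col[of a b c a b c p q] unfolding cong3_def by simp

section \<open>Midpoints and half-turns\<close>

definition mid where "mid a m b \<longleftrightarrow> bt a m b \<and> cong a m m b"

lemma mid_sym: "mid a m b \<Longrightarrow> mid b m a" unfolding mid_def using bt_sym cong_lr cong_sym by blast
lemma mid_triv[simp]: "mid a a a" unfolding mid_def by simp
lemma mid_ex: "\<exists>b. mid a m b" unfolding mid_def using extend_segment[of a m a m] cong_sym by blast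
lemma mid_null: "mid a m a \<Longrightarrow> a = m" unfolding mid_def using bt_id by blast
lemma mid_null1: "mid a a b \<Longrightarrow> b = a" unfolding mid_def using cong_null' by blast
lemma mid_null2: "mid a b b \<Longrightarrow> b = a" unfolding mid_def using cong_null by blast
lemma mid_end: "mid a m b \<Longrightarrow> mid a m c \<Longrightarrow> b = c"
proof (cases "a = m")
  case True then show "mid a m b \<Longrightarrow> mid a m c \<Longrightarrow> b = c" using mid_null1 by blast
next
  case False then show "mid a m b \<Longrightarrow> mid a m c \<Longrightarrow> b = c"
    unfolding mid_def using extension_unique[of a m b a m c] cong_sym by blast
qed
lemma mid_end2: "mid a m b \<Longrightarrow> mid c m b \<Longrightarrow> a = c" using mid_end mid_sym by blast
lemma mid_col: "mid a m b \<Longrightarrow> col a m b" unfolding mid_def using bt_col by blast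
lemma mid_cong: "mid a m b \<Longrightarrow> cong m a m b" unfolding mid_def using cong_l by blast
lemma mid_bet: "mid a m b \<Longrightarrow> a \<noteq> b \<Longrightarrow> bet a m b"
proof -
  assume h: "mid a m b" "a \<noteq> b"
  have "a \<noteq> m" using mid_null1 h by blast
  moreover have "m \<noteq> b" using mid_null2 h by blast
  ultimately show ?thesis using h(1) by (simp add: bet_iff mid_def)
qed
text \<open>
  A half-turn is an isometry.  Lengthening \<open>pm\<close> by the length of \<open>qm\<close> and \<open>qm\<close> by the length of \<open>pm\<close>, on
  both sides of \<open>m\<close>, gives two chords through \<open>m\<close> with four congruent halves, for which the
  five-segment axiom applies; the points \<open>p\<close> and \<open>q\<close> are inner points of these chords.
\<close>

lemma half_turn:
  assumes h: "mid p m p'" "mid q m q'"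
  shows "cong p q p' q'"
proof -
  show ?thesis
  proof (cases "p = m")
    case True then show ?thesis using h mid_null1 mid_cong by blast
  next
    case pm: False
    obtain x where x: "bt p' p x" "cong p x q m" using extend_segment by blast
    obtain x' where x': "bt x p' x'" "cong p' x' q m" using extend_segment by blast
    obtain y where y: "bt q' q y" "cong q y p m" using extend_segment by blast
    obtain y' where y': "bt y q' y'" "cong q' y' p m" using extend_segment by blast
    have b: "bt p m p'" "bt q m q'" "cong p m p' m" "cong q m q' m" using h unfolding mid_def using cong_r
        by blast+
    have 1: "bt x p m" using x b bt_in1 bt_sym bt_in3 by blast
    have 2: "bt y q m" using y b bt_in1 bt_sym bt_in3 by blast
    have x3: "bt x m p'" using b(1) bt_sym[OF x(1)] bt_in2 by blast
    have y3: "bt y m q'" using b(2) bt_sym[OF y(1)] bt_in2 by blast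
    have 3: "bt x' p' m" using x' x3 bt_in3 bt_sym by blast
    have 4: "bt y' q' m" using y' y3 bt_in3 bt_sym by blast
    have 5: "bt x m x'" using x' x3 bt_in4 by blast
    have 6: "bt y m y'" using y' y3 bt_in4 by blast
    have c1: "cong x p q m" "cong x' p' q' m" "cong y q p m" "cong y' q' p' m"
      using x x' y y' b cong_l cong_trans by blast+
    have xm: "cong x m x' m" using add_seg[OF 1 3] c1 b cong_trans cong_sym by blast
    have ym: "cong y m y' m" using add_seg[OF 2 4] c1 b cong_trans cong_sym by blast
    have xy: "cong x m y m"
      using add_seg[OF 1 bt_sym[OF 2]] c1 cong_trans cong_sym cong_l cong_r by meson
    have xne: "x \<noteq> m" using 1 pm bt_id by blast
    have d1: "cong x m y' m" using xy ym cong_trans by blast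
    have d2: "cong m x' m y" using xm xy cong_sym cong_trans cong_lr by blast
    have d3: "cong m y' m x" using d1 cong_sym cong_lr by blast
    have "cong x' y' y x" using five[OF 5 bt_sym[OF 6] d1 d2 cong_rev d3 xne] .
    then have xy': "cong y x y' x'" using cong_sym cong_r cong_l by blast
    have qx: "cong q x q' x'"
      using inner_five[OF 2 4 ym b(4) xy' ] xm cong_lr by blast
    show ?thesis
      using inner_five[OF 1 3 xm b(3)] qx b(4) cong_lr by blast
  qed
qed

lemma half_turn_bt: "\<lbrakk>bt a b c; mid a m a'; mid b m b'; mid c m c'\<rbrakk>
    \<Longrightarrow> bt a' b' c'"
  using cong3_between[of a b c a' b' c'] half_turn[of a m a' b b'] half_turn[of a m a' c c'] half_turn[of b m b' c c'] unfolding cong3_def by argo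

lemma half_turn_col: "\<lbrakk>col a b c; mid a m a'; mid b m b'; mid c m c'\<rbrakk>
    \<Longrightarrow> col a' b' c'"
  unfolding col_def using half_turn_bt by blast

lemma half_turn_mid: "\<lbrakk>mid a b c; mid a m a'; mid b m b'; mid c m c'\<rbrakk>
    \<Longrightarrow> mid a' b' c'"
  using half_turn_bt[of a b c m a' b' c'] half_turn[of a m a' b b'] half_turn[of b m b' c c']
  unfolding mid_def by (metis cong_len)

lemma mid_unique: "\<lbrakk>mid a m b; mid a n b\<rbrakk> \<Longrightarrow> m = n"
proof -
  have *: "m = n" if h: "mid a m b" "mid a n b" and o: "bt a m n" for m n
  proof -
    have "cong3 a m n b m n" using h unfolding cong3_def mid_def using cong_r by simp
    then have "bt b m n" using cong3_between o by blast
    moreover have "bt m n b" using h o bt_in3 unfolding mid_def by blast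
    ultimately show ?thesis using bt_antisym bt_sym by blast
  qed
  assume h: "mid a m b" "mid a n b"
  then have "bt a m n \<or> bt a n m" using between_total_below unfolding mid_def by blast
  then show ?thesis using * h by blast
qed

lemma mid_of_col: "\<lbrakk>col a m b; cong m a m b\<rbrakk> \<Longrightarrow> a = b \<or> mid a m b"
proof -
  have *: "a = b" if "bt m b a" "cong m a m b" for a b
    using sub_seg2[of m b a m b b] that cong_null by auto
  assume h: "col a m b" "cong m a m b"
  then show ?thesis using * cong_sym cong_l bt_sym unfolding col_def mid_def by metis
qed

text \<open>
  The points \<open>u', v'\<close> prolong the legs of an isosceles triangle, \<open>i\<close> is the intersection of the diagonals
  and \<open>x\<close> the point of the line \<open>wi\<close> on the base.  By symmetry \<open>i\<close> is equidistant from \<open>u\<close> and \<open>v\<close>: the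
  point \<open>k\<close> that corresponds to it under the exchange of the legs lies on both diagonals.
\<close>

lemma isosceles_mid:
  assumes nc: "\<not> col u v w" and wu: "cong w u w v" and u': "bt w u u'" and v': "bt w v v'"
    and uv': "cong u u' v v'" and i: "bt u i v'" "bt v i u'" and x: "bt i x w" "bt v x u"
    and ne: "v \<noteq> v'" "i \<noteq> w"
  shows "mid u x v"
proof -
  have wn: "w \<noteq> u" "u \<noteq> v" "w \<noteq> v" using nc by auto
  have 1: "cong v' u u' v" using five[OF v' u' _ _ wu _ wn(3)] wu uv' cong_sym cong_rev by blast
  then have 1: "cong u v' v u'" using cong_lr by blast
  obtain k where k: "bt v k u'" "cong3 u i v' v k u'" using between_transfer[OF i(1) 1] by blast
  have 2: "cong i v' k u'" "cong u i v k" using k(2) unfolding cong3_def by blast+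
  have 4: "cong i v k u" using inner_five[OF i(1) k(1) 1 2(1) cong_rev] uv' by (metis len_laws)
  have 5: "cong i u' k v'" using inner_five[OF i(1) k(1) 1 2(1) uv' cong_rev] .
  have "cong3 v i u' u k v'" using 4 5 1 unfolding cong3_def by (metis len_laws)
  then have 6: "bt u k v'" using cong3_between i(2) by blast
  have cv: "col v w v'" using bt_col[OF v'] by (simp add: col_ac)
  have "\<not> col u v' v"
  proof
    assume "col u v' v"
    then have "col v v' u" "col v v' w" using cv by (simp_all add: col_ac)
    then show False using col_trans[OF ne(1)] nc col_ac by metis
  qed
  moreover have "v \<noteq> u'" using nc bt_col[OF u'] by (auto simp: col_ac)
  ultimately have "i = k" using line_unique[of u v' v u' i k] bt_col[OF i(1)] bt_col[OF i(2)] bt_col[OF k(1)] bt_col[OF 6]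
    by (simp add: col_ac)
  then have "cong i u i v" using 4 by (metis len_laws)
  then have "cong x u x v" using equidist_col[of i w x u v] ne(2) wu bt_col[OF x(1)] by (simp add: col_ac)
  then show ?thesis using x(2) bt_sym cong_l unfolding mid_def by blast
qed

lemma equilateral:
  assumes h: "u \<noteq> v"
  shows "\<exists>w. cong u w u v \<and> cong v w u v"
proof -
  obtain e where e: "bt v u e" "cong u e u v" using extend_segment by blast
  have "le v v u v" unfolding le_def using bt_triv(1) cong_triv by blast
  moreover have "le u v v e" unfolding le_def using e by (metis cong_rev)
  ultimately show ?thesis using circle_circle[OF h cong_refl, of v u v e] e by blast
qed

lemma equilateral_noncol: "\<lbrakk>u \<noteq> v; cong u w u v; cong v w u v\<rbrakk>
    \<Longrightarrow> \<not> col u v w"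
proof
  assume h: "u \<noteq> v" "cong u w u v" "cong v w u v" "col u v w"
  have "w \<noteq> v" "w \<noteq> u" using h cong_null' by blast+
  then have "mid w u v" "mid w v u"
    using mid_of_col[of w u v] mid_of_col[of w v u] h(2-4) by (auto simp: col_ac len_laws)
  then show False unfolding mid_def using bt_antisym bt_sym h(1) by blast
qed

text \<open>
  This collects the side conditions of the construction of a midpoint: an equilateral triangle over
  \<open>uv\<close>, its legs prolonged, and two applications of Pasch's axiom.  It is used both for the existence of
  midpoints here and for their intuitionistic construction in \<open>midpoint_step\<close>.
\<close>

lemma midpoint_config:
  assumes uv: "u \<noteq> v" and w: "cong u w u v" "cong v w u v"
    and u': "bt w u u'" "cong u u' u v" and v': "bt w v v'" "cong v v' u v"
  shows "w \<noteq> u" "w \<noteq> v" "bet u' u w" "bet v' v w" "\<not> col u' v' w" "\<not> col u w v'"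
    "\<lbrakk>bet u i v'; bet v i u'; bet i x w; bet v x u\<rbrakk> \<Longrightarrow> mid u x v"
proof -
  have nc: "\<not> col u v w" using equilateral_noncol uv w by blast
  show wn: "w \<noteq> u" "w \<noteq> v" using nc by auto
  have n': "u \<noteq> u'" "v \<noteq> v'" using cong_null' uv u' v' by auto
  show b: "bet u' u w" "bet v' v w" using u' v' wn n' bt_sym by (simp_all add: bet_iff)
  show nc1: "\<not> col u' v' w"
  proof
    assume a: "col u' v' w"
    have n: "w \<noteq> u'" "w \<noteq> v'" using b bet_neq3 by blast+
    have c: "col w u' u" "col w v' v" using bt_col[OF u'(1)] bt_col[OF v'(1)] by (simp_all add: col_ac)
    have "col w u' v'" using a by (simp add: col_ac)
    then have "col w v' u" using col_trans[OF n(1)] c(1) by blast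
    then have "col w v u" using col_trans[OF n(2)] c(2) by blast
    then show False using nc by (simp add: col_ac)
  qed
  show nc2: "\<not> col u w v'"
  proof
    assume a: "col u w v'"
    have n: "w \<noteq> v'" using b bet_neq3 by blast
    have "col w v' u" "col w v' v" using a bt_col[OF v'(1)] by (simp_all add: col_ac)
    then show False using nc col_trans[OF n] by (metis col_ac)
  qed
  have cc: "cong w u w v" "cong u u' v v'" using w u' v' by (metis len_laws)+
  show "mid u x v" if "bet u i v'" "bet v i u'" "bet i x w" "bet v x u"
    using isosceles_mid[OF nc cc(1) u'(1) v'(1) cc(2) that[THEN bet_bt] n'(2) bet_neq3[OF that(3)]] .
qed

lemma mid_exists: "\<exists>m. mid u m v"
proof (cases "u = v")
  case True then show ?thesis using mid_triv by blast
next
  case False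
  obtain w where w: "cong u w u v" "cong v w u v" using equilateral False by blast
  obtain u' where u': "bt w u u'" "cong u u' u v" using extend_segment by blast
  obtain v' where v': "bt w v v'" "cong v v' u v" using extend_segment by blast
  note config = midpoint_config[OF False w u' v']
  obtain i where i: "bet u i v'" "bet v i u'" using pasch[OF config(5,3,4)] by blast
  obtain x where x: "bet i x w" "bet v x u" using pasch[OF config(6) i(1) bet_sym[OF config(4)]] by blast
  show ?thesis using config(7)[OF i x] by blast
qed

text \<open>
  Pasch's axiom with weak betweenness also holds when points coincide or are collinear: the required point
  is then one of the given points.
\<close>

lemma weak_pasch:
  assumes h: "bt a p c" "bt b q c"
  shows "\<exists>x. bt p x b \<and> bt q x a"
proof -
  consider "a = p \<or> p = c \<or> b = q \<or> q = c" | "bet a p c" "bet b q c" "col a b c" | "bet a p c"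
      "bet b q c" "\<not> col a b c"
    using h bet_iff[of a p c] bet_iff[of b q c] by argo
  then show ?thesis
  proof cases
    case 1
    then consider "a = p" | "p = c" | "b = q" | "q = c" by blast
    then show ?thesis
    proof cases
      case 1 then show ?thesis using bt_triv by blast
    next
      case 2 then show ?thesis using bt_triv h bt_sym by blast
    next
      case 3 then show ?thesis using bt_triv by blast
    next
      case 4 then show ?thesis using bt_triv h bt_sym by blast
    qed
  next
    case 2
    consider "bt a c b" | "bt c a b" | "bt c b a" using 2(3) bt_sym unfolding col_def by blast
    then show ?thesis
    proof cases
      case 1
      have "bt p c b" using 1 h bt_in3 by blast
      moreover have "bt q c a" using bt_sym[OF 1] h bt_in3 by blast
      ultimately show ?thesis by blast
    next
      case 2
      have "bt p a b" using 2 bt_sym[OF h(1)] bt_in3 by blast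
      then show ?thesis using bt_triv by blast
    next
      case 3
      have "bt q b a" using 3 bt_sym[OF h(2)] bt_in3 by blast
      then show ?thesis using bt_triv by blast
    qed
  next
    case 3
    then show ?thesis using pasch[of a b c p q] bet_bt by blast
  qed
qed

lemma pasch_cevian:
  assumes h: "bt a a1 c" "bt b b1 c" "bt a p b"
  shows "\<exists>q. bt p q c \<and> bt a1 q b1"
proof -
  obtain x where x: "bt p x c" "bt a1 x b" using weak_pasch[OF bt_sym[OF h(3)] bt_sym[OF h(1)]] by blast
  obtain y where y: "bt x y c" "bt b1 y a1" using weak_pasch[OF x(2) bt_sym[OF h(2)]] by blast
  have "bt p y c" using bt_in2[OF x(1) y(1)] .
  then show ?thesis using bt_sym[OF y(2)] by blast
qed

lemma shorter_on_ray:
  assumes h: "bt c a1 a \<or> bt c a a1" "le c a1 c a"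
  shows "bt c a1 a"
proof -
  obtain e where e: "bt c e a" "cong c a1 c e" using h(2) unfolding le_def by blast
  show ?thesis
  proof (cases "bt c a1 a")
    case False
    then have "bt c a a1" using h by blast
    then have "bt c e a1" "bt e a a1" using e bt_in4 bt_in3 by blast+
    then have "cong e a1 e e" using sub_seg2[of c e a1 c e e] cong_sym[OF e(2)] e(2)
      using sub_seg2[of c e a1 c e e] by (metis bt_triv(2) len_laws)
    then show ?thesis using e cong_null by blast
  qed
qed

lemma le_cong:
  assumes h: "le a b c d" "cong a b a' b'" "cong c d c' d'"
  shows "le a' b' c' d'"
proof -
  obtain e where e: "bt c e d" "cong a b c e" using h(1) unfolding le_def by blast
  obtain e' where e': "bt c' e' d'" "cong3 c e d c' e' d'" using between_transfer[OF e(1) h(3)] by blast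
  have "cong a' b' c' e'" using e(2) e'(2) h(2) unfolding cong3_def by (metis cong_len)
  then show ?thesis using e'(1) unfolding le_def by blast
qed

lemma le_null: "le a b c c \<Longrightarrow> a = b"
  unfolding le_def using bt_id cong_null by blast

text \<open>
  The half-turn about \<open>c\<close> carries the triangle \<open>a2 b2 c\<close> to a triangle whose legs prolong \<open>c a1\<close> and \<open>c b1\<close>.
  Its median from \<open>c\<close> meets the segment \<open>a1 b1\<close>, by \<open>pasch_cevian\<close>, and the intersection is \<open>m1\<close>, because all
  points of the median are equidistant from \<open>a1\<close> and \<open>b1\<close>.
\<close>

lemma krippen_aux:
  assumes h: "bt a1 c a2" "bt b1 c b2" "cong c a1 c b1" "cong c a2 c b2" "mid a1 m1 b1" "mid a2 m2 b2"
      "le c a1 c a2"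
  shows "bt m1 c m2"
proof -
  obtain a where a: "mid a2 c a" using mid_ex by blast
  obtain b where b: "mid b2 c b" using mid_ex by blast
  obtain m where m: "mid m2 c m" using mid_ex by blast
  have amb: "mid a m b" using half_turn_mid[OF h(6) a m b] .
  have la: "cong c a2 c a" "cong c b2 c b" using mid_cong a b by blast+
  have le: "le c a1 c a" "le c b1 c b"
    using le_cong[OF h(7)] la h(3,4) by (metis len_laws)+
  have ca: "bt c a1 a"
  proof (cases "a2 = c")
    case True
    then have "a1 = c" using h(7) le_null by blast
    then show ?thesis by simp
  next
    case False
    then show ?thesis using shorter_on_ray[OF between_total_beyond[OF False] le(1)] bt_sym[OF h(1)] a
        unfolding mid_def by blast
  qed
  have cb: "bt c b1 b"
  proof (cases "b2 = c")
    case True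
    then have "b = c" using mid_null1 b by blast
    then have "b1 = c" using le(2) le_null by blast
    then show ?thesis by simp
  next
    case False
    then show ?thesis using shorter_on_ray[OF between_total_beyond[OF False] le(2)] bt_sym[OF h(2)] b
        unfolding mid_def by blast
  qed
  obtain q where q: "bt m q c" "bt a1 q b1" using pasch_cevian[OF bt_sym[OF ca] bt_sym[OF cb]] amb
      unfolding mid_def by blast
  have "cong a c b c" using la h(4) by (metis len_laws)
  then have "cong a1 m b1 m"
    using inner_five[OF bt_sym[OF ca] bt_sym[OF cb], of m m] h(3) amb unfolding mid_def by (metis len_laws)
  then have ma: "cong m a1 m b1" by (metis len_laws)
  have "cong q a1 q b1"
  proof (cases "m = c")
    case True
    then have "m = q" using q(1) bt_id by blast
    then show ?thesis using ma by blast
  next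
    case False
    then show ?thesis using equidist_col[of m c q a1 b1] ma h(3) bt_col[OF q(1)] by (simp add: col_ac)
  qed
  then have "mid a1 q b1" using q(2) unfolding mid_def by (metis len_laws)
  then have "q = m1" using mid_unique h(5) by blast
  then show ?thesis using q(1) m bt_sym bt_in3 unfolding mid_def by blast
qed

lemma le_total: "le a b c d \<or> le c d a b"
proof (cases "a = b")
  case True then show ?thesis unfolding le_def using bt_triv cong_triv by blast
next
  case False
  obtain z where z: "bt b a z" "a \<noteq> z" using extend_proper by blast
  obtain e where e: "bt z a e" "cong a e c d" using extend_segment by blast
  have "bt a b e \<or> bt a e b" using between_total_beyond[of z a b e] z e bt_sym by blast
  then show ?thesis
  proof
    assume 1: "bt a e b" then show ?thesis unfolding le_def using e cong_sym by blast
  next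
    assume 1: "bt a b e"
    obtain e' where "bt c e' d" "cong3 a b e c e' d" using between_transfer[OF 1 e(2)] by blast
    then show ?thesis unfolding le_def cong3_def by blast
  qed
qed

lemma krippen: "\<lbrakk>bt a1 c a2; bt b1 c b2; cong c a1 c b1; cong c a2 c b2; mid a1 m1 b1; mid a2 m2 b2\<rbrakk>
  \<Longrightarrow> bt m1 c m2"
  using krippen_aux[of a1 c a2 b1 b2 m1 m2] krippen_aux[of a2 c a1 b2 b1 m2 m1] le_total[of c a1 c a2] bt_sym[of a1 c a2] bt_sym[of b1 c b2] bt_sym[of m2 c m1] by argo

section \<open>Perpendiculars\<close>

text \<open>
  The angle \<open>abc\<close> is right: \<open>a\<close> is equidistant from \<open>c\<close> and its mirror image in \<open>b\<close>.  The degenerate cases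
  \<open>a = b\<close> and \<open>b = c\<close> are included.
\<close>

definition perp where "perp a b c \<longleftrightarrow> (\<exists>c'. mid c b c' \<and> cong a c a c')"

lemma perp_mid: "perp a b c \<Longrightarrow> mid c b c' \<Longrightarrow> cong a c a c'"
  unfolding perp_def using mid_end by blast

lemma perp_sym:
  assumes h: "perp a b c"
  shows "perp c b a"
proof -
  obtain c' where c: "mid c b c'" "cong a c a c'" using h unfolding perp_def by blast
  obtain a' where a: "mid a b a'" using mid_ex by blast
  have "cong c a c' a'" "cong c' a c a'" using half_turn a c mid_sym by blast+
  then have "cong c a c a'" using c(2) by (metis len_laws)
  then show ?thesis using a unfolding perp_def by blast
qed

lemma perp_triv[simp]: "perp a b b" "perp a a b"
proof -
  show "perp a b b" unfolding perp_def using mid_triv cong_refl by blast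
  show "perp a a b" unfolding perp_def using mid_ex mid_cong mid_sym cong_sym by blast
qed

lemma perp_extend_left:
  assumes h: "perp a b c" "a \<noteq> b" "col b a a'"
  shows "perp a' b c"
proof -
  obtain c' where c: "mid c b c'" "cong a c a c'" using h unfolding perp_def by blast
  have "cong a' c a' c'" using equidist_col[of b a a' c c'] h(2,3) mid_cong[OF c(1)] c(2) by simp
  then show ?thesis using c unfolding perp_def by blast
qed

lemma perp_cong3: "\<lbrakk>perp a b c; cong3 a b c a' b' c'\<rbrakk> \<Longrightarrow> perp a' b' c'"
proof (cases "b = c")
  case True
  assume h: "perp a b c" "cong3 a b c a' b' c'"
  then have "b' = c'" using True cong_null' unfolding cong3_def by blast
  then show ?thesis by simp
next
  case False
  assume h: "perp a b c" "cong3 a b c a' b' c'"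
  obtain d where d: "mid c b d" "cong a c a d" using h unfolding perp_def by blast
  obtain d' where d': "mid c' b' d'" using mid_ex by blast
  have "cong d a d' a'" using five[of c b d c' b' d' a a'] h(2) d d' False unfolding mid_def cong3_def
      by (metis len_laws)
  then have "cong a' c' a' d'" using d(2) h(2) unfolding cong3_def by (metis len_laws)
  then show ?thesis using d' unfolding perp_def by blast
qed

text \<open>
  Otherwise \<open>a\<close> and its mirror image \<open>a'\<close> in \<open>c\<close> would both be equidistant from \<open>c\<close> and its mirror image
  in \<open>b\<close>, hence so would the point \<open>c\<close> between them.
\<close>

lemma perp_vertex_unique: "\<lbrakk>perp a b c; perp a c b\<rbrakk> \<Longrightarrow> b = c"
proof (rule ccontr)
  assume h: "perp a b c" "perp a c b" "b \<noteq> c"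
  obtain c' where c: "mid c b c'" "cong a c a c'" using h unfolding perp_def by blast
  obtain a' where a: "mid a c a'" using mid_ex by blast
  have "perp c' c a" using perp_extend_left[OF perp_sym[OF h(2)] h(3), of c'] mid_col[OF c(1)]
      by (simp add: col_ac)
  then have 1: "cong c' a c' a'" using perp_mid a by blast
  have 2: "cong c a c a'" using mid_cong a by blast
  have 3: "cong a' c a' c'" using 1 2 c(2) by (metis len_laws)
  have "cong c c c c'"
  proof (cases "a = a'")
    case True
    then have "a = c" using a mid_null by blast
    then show ?thesis using c(2) by blast
  next
    case False
    show ?thesis using equidist_col[OF False _ c(2) 3] mid_col[OF a] by (simp add: col_ac)
  qed
  then have "c = c'" using cong_null' by blast
  then show False using c(1) mid_null h(3) by blast
qed

lemma perp_degenerate: "\<lbrakk>perp a b c; col a b c\<rbrakk> \<Longrightarrow> a = b \<or> c = b"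
proof (rule ccontr)
  assume h: "perp a b c" "col a b c" "\<not> (a = b \<or> c = b)"
  then have "perp c b c" using perp_extend_left[of a b c c] by (simp add: col_ac)
  then obtain c' where "mid c b c'" "cong c c c c'" unfolding perp_def by blast
  then show False using h(3) cong_null' mid_null by blast
qed

text \<open>
  This is where the dimension axiom enters: perpendiculars to a line at one of its points are equidistant
  from two points of the line, hence collinear.
\<close>

lemma perp_line_unique:
  assumes h: "perp x b a" "perp y b a" "a \<noteq> b"
  shows "col b x y"
proof -
  obtain a' where a: "mid a b a'" using mid_ex by blast
  then have "a \<noteq> a'" using mid_null h(3) by blast
  then show ?thesis using upper_dim[of a a' b x y] perp_mid[OF h(1) a] perp_mid[OF h(2) a] mid_cong[OF a]
      by blast
qed

text \<open>
  Since \<open>perp\<close> admits degenerate angles, a point of the line is its own foot.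
\<close>

definition foot where "foot a b c x \<longleftrightarrow> col a b x \<and> (\<forall>y. col a b y
    \<longrightarrow> perp c x y)"

lemma footI:
  assumes h: "a \<noteq> b" "col a b x" "col a b u" "u \<noteq> x" "perp c x u"
  shows "foot a b c x"
proof -
  show ?thesis unfolding foot_def
  proof (intro conjI allI impI)
    fix y assume y: "col a b y"
    have "col x u y" using col_line[OF h(1,2,3) y] .
    then show "perp c x y" using perp_extend_left[OF perp_sym[OF h(5)] h(4)] perp_sym by blast
  qed (use h in blast)
qed

lemma foot_mid:
  assumes h: "a \<noteq> b" "col a b u" "col a b v" "u \<noteq> v" "cong c u c v" "mid u m v"
  shows "foot a b c m"
proof -
  have "col u v m" using mid_col[OF h(6)] by (simp add: col_ac)
  then have 1: "col a b m" using col_line[OF h(1)] h(2,3,4) by (metis col_ac col_trans)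
  have 2: "u \<noteq> m" using h(4,6) mid_null1 by blast
  have "perp c m u" unfolding perp_def using h(5,6) by blast
  then show ?thesis using footI[OF h(1) 1 h(2) 2] by blast
qed

text \<open>
  Gupta's construction of the foot.  That the foot is on the line \<open>ab\<close> is an instance of \<open>krippen\<close>.
\<close>

lemma foot_exists_off: "\<not> col a b c \<Longrightarrow> \<exists>x. foot a b c x"
proof -
  assume nc: "\<not> col a b c"
  have ne: "a \<noteq> b" "a \<noteq> c" "b \<noteq> c" using nc by auto
  (* The triangle c a y is isosceles, so a p is perpendicular to p y; the triangle q z y is a congruent copy
     of a p y, so the isosceles triangle with base q q' has its axis on the line ab.  The opposite isosceles
     triangle with base c c' then has the same axis, and x is the foot. *)
  obtain y where y: "bt b a y" "cong a y a c" using extend_segment by blast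
  have ay: "a \<noteq> y" using y ne cong_null' by blast
  have aby: "col a b y" using bt_col[OF y(1)] by (simp add: col_ac)
  have yc: "y \<noteq> c" using aby nc by blast
  obtain p where p: "mid c p y" using mid_exists by blast
  have py: "p \<noteq> y" using p yc mid_null2 by blast
  obtain z where z: "bt a y z" "cong y z y p" using extend_segment by blast
  have yz: "y \<noteq> z" using z py cong_null' by blast
  obtain q where q: "bt p y q" "cong y q y a" using extend_segment by blast
  obtain q' where q': "mid q z q'" using mid_ex by blast
  obtain c' where c': "bt q' y c'" "cong y c' y c" using extend_segment by blast
  have qy: "cong a y q y" using cong_lr[OF cong_sym[OF q(2)]] .
  have zq: "cong z q p a" using five[OF z(1) bt_sym[OF q(1)] qy z(2) cong_rev q(2) ay] .
  have apy: "perp a p y" using mid_sym[OF p] y(2) unfolding perp_def by blast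
  have c3: "cong3 a p y q z y" unfolding cong3_def
    using qy cong_lr[OF cong_sym[OF zq]] cong_lr[OF cong_sym[OF z(2)]] by blast
  have "perp y z q" using perp_sym[OF perp_cong3[OF apy c3]] .
  then have yq: "cong y q y q'" using perp_mid q' by blast
  have qyc: "bt q y c" using bt_out2[OF bt_sym[OF q(1)]] p py bt_sym unfolding mid_def by blast
  obtain x where x: "mid c x c'" using mid_exists by blast
  have zyx: "bt z y x" using krippen[OF qyc c'(1) yq _ q' x] c'(2) cong_sym by blast
  have xy: "x \<noteq> y"
  proof
    assume "x = y"
    then have m: "mid c y c'" using x by blast
    then have c'y: "c' \<noteq> y" using yc mid_null2 by blast
    have "bt c' y c" "bt c' y q'" using m c' bt_sym unfolding mid_def by blast+
    then have "bt y c q' \<or> bt y q' c" using between_total_beyond c'y by blast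
    then have "bt q y q'" using bt_out2[OF qyc] yc bt_in1[OF qyc] by blast
    then have "mid q y q'" using yq unfolding mid_def by (metis len_laws)
    then show False using mid_unique q' yz by blast
  qed
  have "perp y x c" unfolding perp_def using x c'(2) cong_sym by blast
  then have "perp c x y" using perp_sym by blast
  moreover have "col a b x"
  proof -
    have "col y z a" "col y z x" using bt_col[OF z(1)] bt_col[OF zyx] by (simp_all add: col_ac)
    then have "col y a x" using col_trans[OF yz] by blast
    then have "col a y x" by (simp add: col_ac)
    moreover have "col a y b" using aby by (simp add: col_ac)
    ultimately show ?thesis using col_trans[OF ay] by blast
  qed
  ultimately show ?thesis using footI[OF ne(1) _ aby] xy by blast
qed

lemma foot_exists: "a \<noteq> b \<Longrightarrow> \<exists>x. foot a b c x"
proof (cases "col a b c")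
  case True then show ?thesis unfolding foot_def using perp_triv by blast
qed (use foot_exists_off in blast)

section \<open>Sides of a line\<close>

lemma same_line:
  assumes h: "a \<noteq> b" "c \<noteq> d" "col a b c" "col a b d"
  shows "col a b x \<longleftrightarrow> col c d x"
proof -
  have "col c d a" "col c d b" using col_line[OF h(1,3,4)] by simp_all
  then show ?thesis using col_line[OF h(1,3,4)] col_line[OF h(2)] by blast
qed

lemma bet_strict: "bet a b c \<Longrightarrow> bt a b c \<and> a \<noteq> b \<and> b \<noteq> c
    \<and> a \<noteq> c"
  by (simp add: bet_bt bet_neq1 bet_neq2 bet_neq3)

text \<open>
  Two applications of Pasch's axiom produce a point \<open>w\<close> strictly between \<open>X\<close> and \<open>Y\<close> that lies on the line
  \<open>BZ\<close>.  By \<open>bet X Y Z\<close> it is not \<open>Z\<close>, so \<open>B\<close> is on the line \<open>XY\<close>, and the triangle is degenerate.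
\<close>

lemma no_line_through_sides:
  assumes nc: "\<not> col A B C" and h: "bet A X B" "bet B Y C" "bet A Z C"
  shows "\<not> bet X Y Z"
proof
  assume m: "bet X Y Z"
  obtain x where x: "bet Z x B" "bet Y x A" using pasch[OF nc h(3,2)] by blast
  have BC: "B \<noteq> C" "B \<noteq> Y" using h(2) bet_strict by blast+
  have cB: "col B Y C" using bt_col[OF bet_bt[OF h(2)]] .
  have nc2: "\<not> col B Y A"
  proof
    assume "col B Y A"
    then have "col B A C" using col_trans[OF BC(2) _ cB] by blast
    then show False using nc by (simp add: col_ac)
  qed
  obtain w where w: "bet X w Y" "bet x w B" using pasch[OF nc2 bet_sym[OF h(1)] x(2)] by blast
  have XY: "X \<noteq> Y" using m bet_strict by blast
  have l1: "col X Y w" "col X Y Z" using bt_col[OF bet_bt[OF w(1)]] bt_col[OF bet_bt[OF m]]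
      by (simp_all add: col_ac)
  have wZ: "w \<noteq> Z"
  proof
    assume "w = Z"
    then have "bt X Z Y" "bt X Y Z" using w m bet_bt by blast+
    then have "Z = Y" using bt_antisym bt_sym by blast
    then show False using m bet_strict by blast
  qed
  have "bt Z w B" using bt_in2[OF bet_bt[OF x(1)] bet_bt[OF w(2)]] .
  then have "col Z w B" using bt_col by blast
  moreover have "col Z w X" "col Z w Y" using col_line[OF XY l1(2,1)] by (simp_all)
  ultimately have XYB: "col X Y B" using col_line wZ by metis
  have XB: "X \<noteq> B" "Y \<noteq> B" using h bet_strict by blast+
  have c: "col X B A" "col X B Y" using bt_col[OF bet_bt[OF h(1)]] XYB by (simp_all add: col_ac)
  have "col B Y A" using col_line[OF XB(1) _ c(2,1)] by simp
  then show False using nc2 by blast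
qed

definition meets where "meets a b x y \<longleftrightarrow> (\<exists>z. col a b z \<and> bet x z y)"

lemma not_all_sides:
  assumes nc: "\<not> col A B C" and ab: "a \<noteq> b"
      and off: "\<not> col a b A" "\<not> col a b B" "\<not> col a b C"
    and m: "meets a b A B" "meets a b B C" "meets a b A C"
  shows False
proof -
  obtain X Y Z where X: "col a b X" "bet A X B" and Y: "col a b Y" "bet B Y C" and Z: "col a b Z" "bet A Z C"
    using m unfolding meets_def by blast
  have "X \<noteq> Y"
  proof
    assume "X = Y"
    then have "col B X A" "col B X C" "B \<noteq> X"
      using bt_col[OF bet_bt[OF X(2)]] bt_col[OF bet_bt[OF Y(2)]] bet_strict[OF X(2)] by (auto simp: col_ac)
    then have "col B A C" using col_trans by blast
    then show False using nc by (simp add: col_ac)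
  qed
  moreover have "X \<noteq> Z"
  proof
    assume "X = Z"
    then have "col A X B" "col A X C" "A \<noteq> X"
      using bt_col[OF bet_bt[OF X(2)]] bt_col[OF bet_bt[OF Z(2)]] bet_strict[OF X(2)] by (auto simp: col_ac)
    then have "col A B C" using col_trans by blast
    then show False using nc by (simp add: col_ac)
  qed
  moreover have "Y \<noteq> Z"
  proof
    assume "Y = Z"
    then have "col C Y A" "col C Y B" "C \<noteq> Y"
      using bt_col[OF bet_bt[OF Z(2)]] bt_col[OF bet_bt[OF Y(2)]] bet_strict[OF Y(2)] by (auto simp: col_ac)
    then have "col C A B" using col_trans by blast
    then show False using nc by (simp add: col_ac)
  qed
  moreover have "col X Y Z" using col_line[OF ab] X Y Z by blast
  ultimately consider "bet X Y Z" | "bet Y Z X" | "bet Z X Y" unfolding col_def bt_def by argo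
  then show False
  proof cases
    case 1 then show False using no_line_through_sides[OF nc X(2) Y(2) Z(2)] by blast
  next
    case 2
    have "\<not> col B C A" using nc by (simp add: col_ac)
    then show False using 2 no_line_through_sides[of B C A Y Z X] X Y Z bet_sym by blast
  next
    case 3
    have "\<not> col C A B" using nc by (simp add: col_ac)
    then show False using 3 no_line_through_sides[of C A B Z X Y] X Y Z bet_sym by blast
  qed
qed

text \<open>
  Suppose that the half-turn about a point \<open>n\<close> of the line carries \<open>A\<close> into the ray from \<open>d\<close> through \<open>C\<close>,
  where \<open>d\<close> is on the line.  Then \<open>A\<close> and \<open>C\<close> are on opposite sides; Pasch's axiom yields the crossing, in
  the triangle \<open>A A' d\<close> or, if \<open>C\<close> is the farther point, in its image under the half-turn.
\<close>

lemma cross: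
  assumes ab: "a \<noteq> b" and off: "\<not> col a b A" "\<not> col a b C" and on: "col a b n" "col a b d"
    and m: "mid A n A'" and ray: "bt d C A' \<or> bt d A' C"
  shows "meets a b A C"
proof -
  have dC: "d \<noteq> C" using on off by blast
  have A'n: "A' \<noteq> n" using m off(1) on(1) mid_null2 by blast
  have fin: "meets a b A C" if x: "bt A x C" "col a b x" for x
  proof -
    have "A \<noteq> x" "x \<noteq> C" using x(2) off by blast+
    then have "bet A x C" using x(1) by (simp add: bet_iff)
    then show ?thesis using x(2) unfolding meets_def by blast
  qed
  have conv: "col a b x" if "bt n x e" "col a b e" for x e
  proof (cases "n = e")
    case True then show ?thesis using that bt_id on by blast
  next
    case False
    then show ?thesis using same_line[OF ab False on(1) that(2), of x] col_perm(2)[OF bt_col[OF that(1)]]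
        by blast
  qed
  show ?thesis using ray
  proof
    assume r: "bt d C A'"
    obtain x where x: "bt n x d" "bt C x A" using weak_pasch[of A n A' d C] m r unfolding mid_def by blast
    then show ?thesis using fin conv on(2) bt_sym by blast
  next
    assume r: "bt d A' C"
    obtain C' where C': "mid C n C'" using mid_ex by blast
    obtain d' where d': "mid d n d'" using mid_ex by blast
    have r': "bt d' A C'" using half_turn_bt[OF r d' mid_sym[OF m] C'] .
    have cd: "col a b d'"
    proof (cases "d = n")
      case True then show ?thesis using d' mid_null1 on by blast
    next
      case False
      then show ?thesis using same_line[OF ab False on(2,1)] mid_col[OF d'] by simp
    qed
    obtain x where x: "bt n x d'" "bt A x C" using weak_pasch[of C n C' d' A] C' r' unfolding mid_def by blast
    then show ?thesis using fin conv cd by blast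
  qed
qed

lemma exists_other: "a \<noteq> b \<Longrightarrow> \<exists>y. col a b y \<and> y \<noteq> x"
  using col_triv(2)[of a b] col_triv(3)[of a b] by blast

lemma half_turn_on_line: "\<lbrakk>a \<noteq> b; col a b n; col a b y; mid y n y'\<rbrakk>
    \<Longrightarrow> col a b y'"
proof (cases "y = n")
  assume h: "a \<noteq> b" "col a b n" "col a b y" "mid y n y'"
  case True then show ?thesis using h mid_null1 by blast
next
  assume h: "a \<noteq> b" "col a b n" "col a b y" "mid y n y'"
  case False
  show ?thesis using same_line[OF h(1) False h(3,2)] mid_col[OF h(4)] by simp
qed

text \<open>
  The half-turn about the midpoint of the two feet carries \<open>A\<close> onto the perpendicular at \<open>C0\<close>.  By the
  uniqueness of that perpendicular the image is on the line \<open>C C0\<close>.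
\<close>

lemma half_turn_to_perp:
  assumes ab: "a \<noteq> b" and A: "foot a b A A0" and C: "foot a b C C0" and offA: "\<not> col a b A"
  shows "\<exists>n A'. col a b n \<and> mid A n A' \<and> col C0 C A' \<and> A' \<noteq> C0"
proof -
  obtain n where n: "mid A0 n C0" using mid_exists by blast
  obtain A' where A': "mid A n A'" using mid_ex by blast
  have on: "col a b A0" "col a b C0" using A C unfolding foot_def by blast+
  have nl: "col a b n"
  proof (cases "A0 = C0")
    case True then show ?thesis using n on mid_null by blast
  next
    case False
    then show ?thesis using same_line[OF ab False on, of n] col_perm(2)[OF mid_col[OF n]] by blast
  qed
  obtain y where y: "col a b y" "y \<noteq> C0" using exists_other ab by blast
  obtain y' where y': "mid y n y'" using mid_ex by blast
  have y'l: "col a b y'" using half_turn_on_line[OF ab nl y(1) y'] .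
  have "perp A A0 y'" using A y'l unfolding foot_def by blast
  moreover have "cong3 A A0 y' A' C0 y" unfolding cong3_def
    using half_turn[OF A' n] half_turn[OF A' mid_sym[OF y']] half_turn[OF n mid_sym[OF y']] by blast
  ultimately have "perp A' C0 y" using perp_cong3 by blast
  moreover have "perp C C0 y" using C y(1) unfolding foot_def by blast
  ultimately have "col C0 C A'" using perp_line_unique y(2) by blast
  moreover have "A' \<noteq> C0" using A' mid_end2[OF n] on(1) offA by blast
  ultimately show ?thesis using nl A' by blast
qed

text \<open>
  Pasch's axiom for an arbitrary line in the plane.  Half-turns move \<open>A\<close> and \<open>B\<close> onto the perpendicular
  through \<open>C\<close>.  If an image is on the ray of \<open>C\<close>, the corresponding side is met, by \<open>cross\<close>.  If
  both are on the opposite ray, then the line meets the segments from \<open>A\<close> and from \<open>B\<close> to the mirror image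
  \<open>D\<close> of \<open>C\<close>; it would meet all three sides of the triangle \<open>ABD\<close>.
\<close>

lemma plane_pasch:
  assumes ab: "a \<noteq> b" and off: "\<not> col a b A" "\<not> col a b B" "\<not> col a b C"
      and m: "meets a b A B"
  shows "meets a b A C \<or> meets a b B C"
proof (rule ccontr)
  assume no: "\<not> ?thesis"
  obtain A0 where A0: "foot a b A A0" using foot_exists ab by blast
  obtain B0 where B0: "foot a b B B0" using foot_exists ab by blast
  obtain C0 where C0: "foot a b C C0" using foot_exists ab by blast
  obtain n A' where A': "col a b n" "mid A n A'" "col C0 C A'" "A' \<noteq> C0"
    using half_turn_to_perp[OF ab A0 C0 off(1)] by blast
  obtain k B' where B': "col a b k" "mid B k B'" "col C0 C B'" "B' \<noteq> C0"
    using half_turn_to_perp[OF ab B0 C0 off(2)] by blast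
  have c0: "col a b C0" using C0 unfolding foot_def by blast
  have CC0: "C \<noteq> C0" using c0 off by blast
  obtain D where D: "mid C C0 D" using mid_ex by blast
  have 1: "bt C C0 A'" using cross[OF ab off(1,3) A'(1) c0 A'(2)] no A'(3) bt_sym unfolding col_def by blast
  have 2: "bt C C0 B'" using cross[OF ab off(2,3) B'(1) c0 B'(2)] no B'(3) bt_sym unfolding col_def by blast
  have bD: "bt C C0 D" using D unfolding mid_def by blast
  have oD: "\<not> col a b D" using half_turn_on_line[OF ab c0 _ mid_sym[OF D]] off(3) by blast
  have mA: "meets a b A D" using cross[OF ab off(1) oD A'(1) c0 A'(2)] between_total_beyond[OF CC0 1 bD]
      by blast
  have mB: "meets a b B D" using cross[OF ab off(2) oD B'(1) c0 B'(2)] between_total_beyond[OF CC0 2 bD]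
      by blast
  show False
  proof (cases "col A B D")
    case False then show ?thesis using not_all_sides[OF _ ab off(1,2) oD m mB mA] by blast
  next
    case True
    obtain X Y Z where X: "col a b X" "bet A X B" and Y: "col a b Y" "bet B Y D" and Z: "col a b Z" "bet A Z D"
      using m mA mB unfolding meets_def by blast
    have AB: "A \<noteq> B" using X bet_strict by blast
    have nAB: "\<not> col a b A" using off by blast
    have cX: "col A B X" "col B D Y" "col A D Z" using bt_col[OF bet_bt] X Y Z col_perm by blast+
    have d: "A \<noteq> D" "B \<noteq> D" using Y Z bet_strict by blast+
    have Zl: "col A B Z" using col_trans[OF d(1), of B Z] True cX(3) col_perm by blast
    have Yl: "col A B Y" using col_trans[OF d(2), of A Y] True cX(2) col_perm by blast
    have u: "P = Q" if "col a b P" "col a b Q" "col A B P" "col A B Q" for P Q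
      using line_unique[of a b A B P Q] that off(1) AB by blast
    have "Y = X" "Z = X" using u X Y Z cX Zl Yl by blast+
    then have b: "bt A X B" "bt A X D" "bt B X D" "A \<noteq> X" "X \<noteq> B" "X \<noteq> D"
        using X Y Z bet_strict by blast+
    then have "bt X B D \<or> bt X D B" using between_total_beyond by blast
    then show False using b bt_antisym bt_sym by blast
  qed
qed

section \<open>Comparison of distances\<close>

lemma erect:
  assumes h: "a \<noteq> b"
  shows "\<exists>e. e \<noteq> b \<and> perp e b a"
proof -
  obtain c where c: "mid a b c" using mid_ex by blast
  have ac: "a \<noteq> c" using c h mid_null by blast
  obtain e where e: "cong a e a c" "cong c e a c" using equilateral ac by blast
  have "\<not> col a c e" using equilateral_noncol[OF ac e] .
  then have "e \<noteq> b" using mid_col[OF c] by (auto simp: col_ac)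
  moreover have "cong e a e c" using e by (metis len_laws)
  ultimately show ?thesis using c unfolding perp_def by blast
qed

lemma le_trans:
  assumes h: "le a b c d" "le c d e f"
  shows "le a b e f"
proof -
  obtain x where x: "bt e x f" "cong c d e x" using h(2) unfolding le_def by blast
  have "le a b e x" using le_cong[OF h(1) cong_refl x(2)] .
  then obtain y where y: "bt e y x" "cong a b e y" unfolding le_def by blast
  then show ?thesis using x(1) bt_in4 unfolding le_def by blast
qed

lemma bt_le: "bt a b c \<Longrightarrow> le a b a c" unfolding le_def using cong_refl by blast
lemma le_flip_left: "le a b c d \<Longrightarrow> le b a c d" using le_cong[OF _ cong_rev cong_refl] by blast
lemma le_flip_right: "le a b c d \<Longrightarrow> le a b d c" using le_cong[OF _ cong_refl cong_rev] by blast

lemma perp_extend_right: "\<lbrakk>perp a b c; c \<noteq> b; col b c c'\<rbrakk> \<Longrightarrow> perp a b c'"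
  using perp_sym[OF perp_extend_left[OF perp_sym]] by blast

lemma perps_dont_meet: "\<lbrakk>perp e y u; e \<noteq> y; perp z n y; n \<noteq> z; col y u n; u \<noteq> y; n \<noteq> y\<rbrakk> \<Longrightarrow> \<not> meets e y n z"
proof
  assume h: "perp e y u" "e \<noteq> y" "perp z n y" "n \<noteq> z" "col y u n" "u \<noteq> y"
      "n \<noteq> y" "meets e y n z"
  obtain w where w: "col e y w" "bet n w z" using h(8) unfolding meets_def by blast
  have "perp e y n" using perp_extend_right[OF h(1,6,5)] .
  then have 1: "perp w y n" using perp_extend_left[OF _ h(2)] w(1) col_perm by blast
  have "col n z w" using col_perm(2)[OF bt_col[OF bet_bt[OF w(2)]]] .
  then have "perp w n y" using perp_extend_left[OF h(3) _] h(4) by blast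
  then show False using perp_vertex_unique[OF 1] h(7) by blast
qed

text \<open>
  A leg of a right triangle is shorter than the hypotenuse.  Otherwise there is a point \<open>y\<close> of the leg
  \<open>zm\<close> with \<open>zy = zu\<close>.  If \<open>y\<close> is not \<open>m\<close>, the base angle of the isosceles triangle \<open>zuy\<close> at \<open>y\<close> would be
  obtuse when measured by the foot \<open>m\<close> of \<open>u\<close>, but acute when measured by the foot \<open>n\<close> of \<open>z\<close>.
\<close>

lemma leg_lt: "\<lbrakk>perp z m u; z \<noteq> m; u \<noteq> m\<rbrakk> \<Longrightarrow> \<not> le z u z m"
proof
  assume h: "perp z m u" "z \<noteq> m" "u \<noteq> m" "le z u z m"
  obtain y where y: "bt z y m" "cong z u z y" using h(4) unfolding le_def by blast
  have umz: "perp u m z" using perp_sym h(1) by blast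
  show False
  proof (cases "y = m")
    case True
    obtain n where n: "mid m n u" using mid_exists by blast
    have "perp z n m" unfolding perp_def using mid_sym[OF n] y(2) True cong_sym n by blast
    moreover have "perp z m n" using perp_extend_right[OF h(1) h(3)] mid_col[OF n] by (simp add: col_ac)
    ultimately have "m = n" using perp_vertex_unique by blast
    then show False using n mid_null1 h(3) by blast
  next
    case ym: False
    have uoff: "\<not> col z m u" using perp_degenerate[OF h(1)] h by blast
    have zu: "z \<noteq> u" "u \<noteq> y" using uoff col_perm(2)[OF bt_col[OF y(1)]] by auto
    have zy: "z \<noteq> y" using y(2) zu(1) cong_null by blast
    obtain n where n: "mid u n y" using mid_exists by blast
    have nu: "n \<noteq> u" "n \<noteq> y" using n zu(2) mid_null1 mid_null2 by blast+
    have Pzny: "perp z n y" unfolding perp_def using mid_sym[OF n] cong_sym[OF y(2)] by blast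
    (* Exchanging the legs of the angle at y carries u to z' and the foot m of u to the foot n' of z'.  So the
       points z and z' of one ray from y have feet n and n' on opposite sides of y. *)
    obtain z' where z': "bt m y z'" "cong y z' y u" using extend_segment by blast
    obtain n' where n': "bt u y n'" "cong y n' y m" using extend_segment by blast
    have z'y: "z' \<noteq> y" using z'(2) zu(2) cong_null' by blast
    have n'y: "n' \<noteq> y" using n'(2) ym cong_null' by blast
    have zy1: "cong z' y u y" using cong_lr[OF z'(2)] .
    have ny1: "cong y m y n'" using cong_sym[OF n'(2)] .
    have "cong m u n' z'" using five[OF bt_sym[OF z'(1)] n'(1) zy1 ny1 cong_rev cong_sym[OF z'(2)] z'y] .
    then have c3: "cong3 u m y z' n' y" unfolding cong3_def
      using cong_lr[OF ny1] cong_sym[OF zy1] by (metis len_laws)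
    have "perp u m y" using perp_extend_right[OF umz h(2)] col_perm[OF bt_col[OF y(1)]] by blast
    then have Pz'n'y: "perp z' n' y" using perp_cong3 c3 by blast
    have uyn: "col u y n" "col u y n'" using mid_col[OF n] bt_col[OF n'(1)] col_perm by blast+
    have nyn': "bet n y n'"
    proof -
      have "bt n y n'" using n n'(1) bt_in3[of u y n' n] unfolding mid_def by blast
      then show ?thesis using nu(2) n'y by (simp add: bet_iff)
    qed
    (* The perpendicular ey separates n from n', but it is parallel to n z and n' z' and meets zz' only outside
       the segment. *)
    obtain e where e: "e \<noteq> y" "perp e y u" using erect zu(2) by blast
    have yun: "col y u n" "col y u n'" using uyn col_perm by blast+
    have Peyn: "perp e y n" "perp e y n'" using perp_extend_right[OF e(2) zu(2)] yun by blast+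
    have off: "\<not> col e y p" if "perp e y k" "perp p k y" "k \<noteq> y" for p k
    proof
      assume "col e y p"
      then have "perp p y k" using perp_extend_left[OF that(1) e(1)] col_perm by blast
      then show False using perp_vertex_unique[OF _ that(2)] that(3) by blast
    qed
    have offz: "\<not> col e y z" "\<not> col e y z'" using off Peyn Pzny Pz'n'y nu(2) n'y by blast+
    have offn: "\<not> col e y n" "\<not> col e y n'"
      using perp_degenerate[OF Peyn(1)] perp_degenerate[OF Peyn(2)] e(1) nu(2) n'y by blast+
    have cy: "col e y y" by simp
    have m: "meets e y n n'" using nyn' cy unfolding meets_def by blast
    have 1: "\<not> meets e y n z"
    proof (cases "n = z")
      case True then show ?thesis unfolding meets_def using bet_neq3 by blast
    next
      case False then show ?thesis using perps_dont_meet[OF e(2,1) Pzny _ yun(1) zu(2) nu(2)] by blast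
    qed
    have 2: "\<not> meets e y n' z'"
    proof (cases "n' = z'")
      case True then show ?thesis unfolding meets_def using bet_neq3 by blast
    next
      case False then show ?thesis using perps_dont_meet[OF e(2,1) Pz'n'y _ yun(2) zu(2) n'y] by blast
    qed
    have 3: "\<not> meets e y z z'"
    proof
      assume "meets e y z z'"
      then obtain w where w: "col e y w" "bet z w z'" unfolding meets_def by blast
      have my: "m \<noteq> y" using ym by blast
      have "col m y z" "col m y z'" using bt_col[OF y(1)] bt_col[OF z'(1)] col_perm by blast+
      then have zz': "col m y w"
        using same_line[OF my, of z z' w] bet_strict[OF w(2)] bt_col[OF bet_bt[OF w(2)]] col_perm by blast
      have l: "col y m w" using zz' col_perm(1) by blast
      have nm: "\<not> col e y m"
      proof
        assume "col e y m"
        then have "col y m e" using col_perm by blast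
        moreover have "col y m z" using \<open>col m y z\<close> col_perm by blast
        ultimately have "col y e z" using col_trans my by metis
        then show False using offz col_perm by blast
      qed
      then have "w = y" using line_unique[OF nm my w(1) _ zz'] by simp
      then have b: "bt z y z'" "z \<noteq> y" "y \<noteq> z'" using w(2) bet_strict by blast+
      have "bt y z z' \<or> bt y z' z" using between_total_beyond[OF my bt_sym[OF y(1)] z'(1)] .
      then show False using b bt_antisym bt_sym by blast
    qed
    have "meets e y n z \<or> meets e y n' z" using plane_pasch[OF e(1) offn offz(1) m] .
    then have 4: "meets e y n' z" using 1 by blast
    have "meets e y n' z' \<or> meets e y z z'" using plane_pasch[OF e(1) offn(2) offz(1) offz(2) 4] .
    then show False using 2 3 by blast
  qed
qed

lemma leg_le: "perp z m u \<Longrightarrow> le z m z u"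
proof (cases "z = m \<or> u = m")
  case True
  then show ?thesis using bt_le[of z m u] bt_triv by auto
next
  case False
  assume "perp z m u"
  then show ?thesis using leg_lt False le_total by blast
qed

text \<open>
  The point of a circle that is nearest to an outer point \<open>u\<close> is on the line through the center \<open>a\<close>.  Compare
  both distances with that of the foot of \<open>x\<close> on the line \<open>au\<close>.
\<close>

lemma triangle_le:
  assumes h: "cong a x a y" "bt a y u"
  shows "le y u x u"
proof -
  show ?thesis
  proof (cases "a = u")
    case True
    then have "y = a" using h(2) bt_id by blast
    then show ?thesis using True bt_le[of u u x] le_flip_left le_flip_right bt_triv le_def cong_triv by blast
  next
    case False
    obtain m where m: "foot a u x m" using foot_exists False by blast
    have P: "perp x m a" "perp x m u" "col a u m" using m unfolding foot_def by simp_all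
    have "le a m a x" using leg_le[OF perp_sym[OF P(1)]] .
    then have am: "le a m a y" using le_cong[OF _ cong_refl h(1)] by blast
    have um: "le u m x u" using leg_le[OF perp_sym[OF P(2)]] le_flip_right by blast
    have "le u y u m"
    proof -
      consider "bt a m u" | "bt m a u" | "bt a u m" using P(3) bt_sym unfolding col_def by blast
      then show ?thesis
      proof cases
        case 1
        have "bt a m y \<or> bt a y m" using between_total_below[OF 1 h(2)] .
        then have "bt a m y" using shorter_on_ray am by blast
        then have "bt m y u" using bt_in3 h(2) by blast
        then show ?thesis using bt_le bt_sym by blast
      next
        case 2
        then have "bt u a m" "bt u y a" using h(2) bt_sym by blast+
        then have "bt u y m" using bt_in4 by blast
        then show ?thesis using bt_le by blast
      next
        case 3
        then have 4: "bt a y m" using h(2) bt_in4 by blast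
        then have "bt a m y" using shorter_on_ray am by blast
        then have "m = y" using 4 bt_antisym bt_sym by blast
        then show ?thesis using bt_le[of u y y] by simp
      qed
    qed
    then show ?thesis using um le_trans le_flip_left by blast
  qed
qed

section \<open>Parallels\<close>

text \<open>
  The configuration of both postulates: the half-turn about \<open>t\<close> carries the line \<open>pr\<close> to the line \<open>sq\<close>.
\<close>

definition parallelogram where
  "parallelogram p q r s t \<longleftrightarrow> mid p t q \<and> mid r t s \<and> p \<noteq> r
      \<and> \<not> col s q p"

lemma parallelogram_neq: "parallelogram p q r s t \<Longrightarrow> s \<noteq> q"
  unfolding parallelogram_def using mid_end2 by blast

lemma parallelogram_swap:
  assumes h: "parallelogram p q r s t"
  shows "parallelogram q p s r t"
proof -
  from h have m: "mid q t p" "mid s t r" "s \<noteq> q" "\<not> col s q p" using mid_sym parallelogram_neq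
      unfolding parallelogram_def by blast+
  have "\<not> col r p q" using half_turn_col[OF _ mid_sym[OF m(2)] mid_sym[OF m(1)] m(1)] m(4) by blast
  then show ?thesis using m unfolding parallelogram_def by blast
qed

lemma parallelogram_bet:
  assumes h: "parallelogram p q r s t"
  shows "bet p t q \<and> bet s t r"
proof -
  have "p \<noteq> q" using h unfolding parallelogram_def by auto
  moreover have "s \<noteq> r"
  proof
    assume "s = r"
    then have "s = t" using h mid_null unfolding parallelogram_def by blast
    then have "col s q p" using h mid_col[of p t q] col_perm unfolding parallelogram_def by blast
    then show False using h unfolding parallelogram_def by blast
  qed
  ultimately show ?thesis using h mid_bet bet_sym unfolding parallelogram_def by blast
qed

lemma parallelogram_disjoint: "parallelogram p q r s t \<Longrightarrow> col s q x
    \<Longrightarrow> \<not> col p r x"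
proof
  assume h: "parallelogram p q r s t" "col s q x" "col p r x"
  have m: "mid p t q" "mid r t s" "p \<noteq> r" "\<not> col s q p" using h(1) unfolding parallelogram_def
      by blast+
  obtain x' where x': "mid x t x'" using mid_ex by blast
  have sq: "s \<noteq> q" using parallelogram_neq h(1) by blast
  have 1: "col p r x'" using half_turn_col[OF h(2) mid_sym[OF m(2)] mid_sym[OF m(1)] x'] col_perm by blast
  have 2: "col s q x'" using half_turn_col[OF h(3) m(1,2) x'] col_perm by blast
  show False
  proof (cases "x = x'")
    case True
    then have "t = x" using x' mid_null by blast
    then have "col s q t" using h(2) by blast
    then have "col s q p" using half_turn_on_line[OF sq _ _ mid_sym[OF m(1)]] by simp
    then show False using m by blast
  next
    case False
    have "col x x' p" using same_line[OF m(3) False h(3) 1, of p] by simp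
    then have "col s q p" using same_line[OF sq False h(2) 2, of p] by simp
    then show False using m by blast
  qed
qed

lemma euclid5_line:
  assumes h: "parallelogram p q r s t" and a: "bet s a p"
  shows "\<exists>z. col p r z \<and> col q a z \<and> q \<noteq> a"
proof -
  have sw: "parallelogram q p s r t" using parallelogram_swap h by blast
  have m: "mid p t q" "mid r t s" "\<not> col s q p" "\<not> col r p q" "q \<noteq> s" using h sw
      unfolding parallelogram_def by blast+
  have b: "bet q t p" "bet r t s" using parallelogram_bet[OF sw] by blast+
  have c: "cong q t p t" "cong s t r t" using m(1,2) cong_sym cong_r unfolding mid_def by blast+
  have no: "\<not> onl r p q" using m(4) onl_imp_col by blast
  have nq: "q \<noteq> a" using m(3) bt_col[OF bet_bt[OF a]] by blast
  obtain x where "onl r p x" "onl q a x" using euclid5[OF bet_sym[OF a] b c m(5) no] by blast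
  then show ?thesis using onl_imp_col col_perm(1) nq by blast
qed

text \<open>
  A line through \<open>q\<close> other than \<open>sq\<close> separates \<open>s\<close> from its mirror image \<open>k\<close> in \<open>q\<close>, so by \<open>plane_pasch\<close> it
  meets the segment \<open>sp\<close> or the segment \<open>kp\<close>.  In each case Euclid 5 applies to the parallelogram
  with that diagonal, and the line meets \<open>pr\<close>.
\<close>

lemma playfair:
  assumes h: "parallelogram p q r s t" and x: "\<not> col s q x"
  shows "\<exists>z. col p r z \<and> col q x z"
proof (cases "col q x p")
  case True then show ?thesis by (intro exI[of _ p]) simp
next
  case False
  have m: "mid p t q" "mid r t s" "p \<noteq> r" "\<not> col s q p" using h unfolding parallelogram_def
      by blast+
  have sq: "s \<noteq> q" using parallelogram_neq h by blast
  have qx: "q \<noteq> x" using x by auto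
  obtain k where k: "mid s q k" using mid_ex by blast
  have sk: "bet s q k" using k mid_bet sq mid_null by blast
  have kq: "k \<noteq> q" using sk bet_strict by blast
  have kl: "col s q k" using mid_col k by blast
  have off1: "\<not> col q x s" using x col_perm by blast
  have off2: "\<not> col q x k"
  proof
    assume "col q x k"
    then have "col q k x" "col q k s" using kl col_perm by blast+
    then have "col q x s" using col_trans kq by metis
    then show False using off1 by blast
  qed
  have mt: "meets q x s k" using sk col_triv(3) unfolding meets_def by blast
  have fin: "\<exists>z. col p r z \<and> col q x z"
      if c: "col q x c" "q \<noteq> c" "col p r z" "col q c z" for c z
  proof -
    have "col q c x" using c(1) col_perm by blast
    then have "col q x z" using col_trans[OF c(2)] c(4) by blast
    then show ?thesis using c by blast
  qed
  have "meets q x s p \<or> meets q x k p" using plane_pasch[OF qx off1 off2 False mt] .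
  then show ?thesis
  proof
    assume "meets q x s p"
    then obtain c where c: "col q x c" "bet s c p" unfolding meets_def by blast
    then show ?thesis using euclid5_line[OF h c(2)] fin by blast
  next
    assume "meets q x k p"
    then obtain c where c: "col q x c" "bet k c p" unfolding meets_def by blast
    obtain k' where k': "mid k t k'" using mid_ex by blast
    have k'l: "col r p k'" using half_turn_col[OF kl mid_sym[OF m(2)] mid_sym[OF m(1)] k'] .
    have k'p: "p \<noteq> k'" using m(1) k' kq mid_end2 mid_sym by blast
    have nk: "\<not> col k q p"
    proof
      assume "col k q p"
      then have "col q k p" "col q k s" using kl col_perm by blast+
      then have "col s q p" using col_trans[of q k s p] kq col_perm by blast
      then show False using m by blast
    qed
    have "parallelogram p q k' k t" using m(1) k' mid_sym k'p nk unfolding parallelogram_def by blast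
    then obtain z where z: "col p k' z" "col q c z" "q \<noteq> c" using euclid5_line c(2) by blast
    have "col p k' r" using k'l col_perm by blast
    then have "col p r z" using col_trans[OF k'p] z(1) by blast
    then show ?thesis using fin c(1) z by blast
  qed
qed

text \<open>
  A half-turn that carries a point of \<open>pr\<close> to a point of \<open>sq\<close> carries the whole line \<open>pr\<close> to \<open>sq\<close>: otherwise
  \<open>sq\<close> would meet \<open>pr\<close>, by Playfair.
\<close>

lemma reflect_on_parallel:
  assumes h: "parallelogram p q r s t" and y: "col s q y" and w: "col p r w" "col p r w'" "w \<noteq> w'"
    and m: "mid w t' y" "mid w' t' s'"
  shows "col s q s'"
proof (rule ccontr)
  assume no: "\<not> col s q s'"
  have sq: "s \<noteq> q" and pr: "p \<noteq> r" using parallelogram_neq h unfolding parallelogram_def by blast+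
  have "\<not> col s' y w"
  proof
    assume "col s' y w"
    then have "col w' w y" using half_turn_col[OF _ mid_sym[OF m(2)] mid_sym[OF m(1)] m(1)] by blast
    then have "col w w' y" using col_perm by blast
    then have "col p r y" using same_line[OF pr w(3,1,2), of y] by blast
    then show False using parallelogram_disjoint h y by blast
  qed
  then have P: "parallelogram w y w' s' t'" using m w(3) unfolding parallelogram_def by blast
  obtain x where x: "col s q x" "x \<noteq> y" using exists_other sq by blast
  show False
  proof (cases "col s' y x")
    case True
    then have "col x y s'" using col_perm by blast
    then show False using same_line[OF sq x(2,1) y, of s'] no by blast
  next
    case False
    obtain z where z: "col w w' z" "col y x z" using playfair[OF P False] by blast
    have "col p r z" using same_line[OF pr w(3,1,2), of z] z(1) by blast
    moreover have "col s q z" using same_line[OF sq _ y x(1), of z] z(2) x(2) by blast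
    ultimately show False using parallelogram_disjoint h by blast
  qed
qed

text \<open>
  The half-turn about the midpoint of \<open>cm\<close> exchanges the two parallels and carries the right angle at \<open>c\<close> to
  one at \<open>m\<close>.
\<close>

lemma common_perp:
  assumes h: "parallelogram p q r s t" and m: "col p r m" and c: "foot s q m c" and y: "col p r y"
  shows "perp c m y"
proof -
  have sw: "parallelogram q p s r t" using parallelogram_swap h by blast
  have sq: "s \<noteq> q" and pr: "p \<noteq> r" using parallelogram_neq h unfolding parallelogram_def by blast+
  have c_on: "col s q c" using c unfolding foot_def by blast
  obtain t' where t': "mid c t' m" using mid_exists by blast
  obtain w where w: "col s q w" "w \<noteq> c" using exists_other sq by blast
  obtain s' where s': "mid w t' s'" using mid_ex by blast
  have "col r p s'" using reflect_on_parallel[OF sw _ _ _ _ t' s'] m w c_on col_perm(1) by blast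
  then have s'l: "col p r s'" using col_perm(1) by blast
  have s'm: "s' \<noteq> m" using t' s' w(2) mid_end2 by blast
  have "perp m c w" using c w(1) unfolding foot_def by blast
  moreover have "cong3 m c w c m s'" unfolding cong3_def
    using half_turn[OF mid_sym[OF t'] t'] half_turn[OF mid_sym[OF t'] s'] half_turn[OF t' s'] by blast
  ultimately have "perp c m s'" using perp_cong3 by blast
  moreover have "col m s' y" using col_line[OF pr m s'l y] .
  ultimately show ?thesis using perp_extend_right s'm by blast
qed

lemma bet_not_le: "bet a b c \<Longrightarrow> \<not> le a c a b"
proof
  assume h: "bet a b c" "le a c a b"
  then have "bt a b c" "bt a c b" "b \<noteq> c" using shorter_on_ray bet_strict by blast+
  then show False using bt_antisym bt_sym by blast
qed

text \<open>
  The point \<open>f\<close> is on the circle with diameter \<open>p c0\<close>.  If it were beyond \<open>pr\<close>, then the segment from \<open>f\<close> to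
  \<open>c0\<close> would meet \<open>pr\<close> in a point \<open>z\<close>, and \<open>c0 p\<close> would be shorter than \<open>c0 z\<close>, hence than \<open>c0 f\<close>, though
  \<open>c0 f\<close> is a leg and \<open>c0 p\<close> the hypotenuse of a right triangle.  If it were on or beyond \<open>sq\<close>, then
  \<open>pf\<close> would be at least as long as \<open>pc\<close>, though it is at most \<open>p c0\<close>.  The points \<open>m1, f, m2\<close> are collinear
  because \<open>m1 m2\<close> is perpendicular to both parallels.
\<close>

lemma crossing_point_in_strip:
  assumes h: "parallelogram p q r s t" and a: "\<not> col p r a"
    and c: "foot s q p c" and c0: "mid p c0 c" and f: "foot p a c0 f" and m1: "foot p r f m1"
    and m2: "foot s q m1 m2"
  shows "f \<noteq> p" "bet m2 f m1"
proof -
  have sq: "s \<noteq> q" and pr: "p \<noteq> r" using parallelogram_neq h unfolding parallelogram_def by blast+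
  have pa: "p \<noteq> a" using a by auto
  have c_on: "col s q c" and fl: "col p a f" and m1l: "col p r m1" and m2l: "col s q m2"
    using c f m1 m2 unfolding foot_def by blast+
  have disj: "\<not> col p r x" if "col s q x" for x using parallelogram_disjoint h that by blast
  have pl: "col p r p" by simp
  have pc: "p \<noteq> c" using disj[OF c_on] pl by blast
  have b0: "bet p c0 c" using mid_bet c0 pc by blast
  have n0: "p \<noteq> c0" "c0 \<noteq> c" using b0 bet_strict by blast+
  have Pc: "perp c p y" if "col p r y" for y using common_perp[OF h pl c that] .
  have Pc0: "perp c0 p y" if "col p r y" for y
    using perp_extend_left[OF Pc[OF that], of c0] pc bt_col[OF bet_bt[OF b0]] col_perm(2) by blast
  show fp: "f \<noteq> p"
  proof
    assume "f = p"
    then have "perp c0 p a" using f unfolding foot_def by simp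
    then have "perp a p c0" "perp r p c0" using Pc0[of r] perp_sym by simp_all
    then have "col p a r" using perp_line_unique n0(1) by blast
    then show False using a col_perm by blast
  qed
  have foff: "\<not> col p r f"
  proof
    assume "col p r f"
    then have "col p f r" "col p f a" using fl col_perm by blast+
    then have "col p r a" using col_trans[of p f r a] fp by blast
    then show False using a by blast
  qed
  have m12: "m1 \<noteq> m2" using disj m1l m2l by blast
  have fm1: "f \<noteq> m1" using foff m1l by blast
  obtain y where y: "col p r y" "y \<noteq> m1" using exists_other pr by blast
  have "perp f m1 y" using m1 y(1) unfolding foot_def by blast
  moreover have "perp m2 m1 y" using common_perp[OF h m1l m2 y(1)] .
  ultimately have cl3: "col m1 f m2" using perp_line_unique y(2) by blast
  have Pf: "perp c0 f p" using f unfolding foot_def by simp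
  have short: "le p f p c0" using leg_le[OF perp_sym[OF Pf]] .
  have far: False if z: "col s q z" "le p z p f" for z
  proof -
    have "perp p c z" using c z(1) unfolding foot_def by blast
    then have "le p c p c0" using leg_le le_trans z(2) short by blast
    then show False using bet_not_le b0 by blast
  qed
  have foffL: "\<not> col s q f" using far[of f] bt_le[of p f f] by auto
  have fm2: "f \<noteq> m2" using foffL m2l by blast
  have n1: "\<not> bet m1 m2 f"
  proof
    assume b: "bet m1 m2 f"
    have "meets s q m1 f" using b m2l unfolding meets_def by blast
    then have "meets s q m1 p \<or> meets s q f p"
      using plane_pasch[OF sq] foffL disj m1l pl by blast
    then show False
    proof
      assume "meets s q m1 p"
      then obtain z where z: "col s q z" "bet m1 z p" unfolding meets_def by blast
      have "m1 \<noteq> p" "col m1 p z" using bet_strict[OF z(2)] bt_col[of m1 z p] col_perm(2) by blast+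
      then have "col p r z" using same_line[OF pr _ m1l pl, of z] by blast
      then show False using disj z by blast
    next
      assume "meets s q f p"
      then obtain z where z: "col s q z" "bet f z p" unfolding meets_def by blast
      then have "le p z p f" using bt_le bt_sym bet_bt by blast
      then show False using far z(1) by blast
    qed
  qed
  have c0off: "\<not> col p r c0"
  proof
    assume "col p r c0"
    then have "perp c0 p c0" using Pc0 by blast
    then show False using perp_degenerate[of c0 p c0] n0 by simp
  qed
  have n2: "\<not> bet f m1 m2"
  proof
    assume b: "bet f m1 m2"
    have "meets p r f m2" using b m1l unfolding meets_def by blast
    then have "meets p r f c0 \<or> meets p r m2 c0"
      using plane_pasch[OF pr foff disj[OF m2l] c0off] by blast
    then show False
    proof
      assume "meets p r m2 c0"
      then have "meets p r m2 c \<or> meets p r c0 c"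
        using plane_pasch[OF pr disj[OF m2l] c0off disj[OF c_on]] by blast
      then show False
      proof
        assume "meets p r m2 c"
        then obtain z where z: "col p r z" "bet m2 z c" unfolding meets_def by blast
        have "m2 \<noteq> c" "col m2 c z" using bet_strict[OF z(2)] bt_col[of m2 z c] col_perm(2) by blast+
        then have "col s q z" using same_line[OF sq _ m2l c_on, of z] by blast
        then show False using disj z by blast
      next
        assume "meets p r c0 c"
        then obtain z where z: "col p r z" "bet c0 z c" unfolding meets_def by blast
        have "bet p z c"
        proof -
          have "bt p z c" using bt_in2[OF bet_bt[OF b0] bet_bt[OF z(2)]] .
          moreover have "p \<noteq> z"
          proof
            assume "p = z"
            then have "bt c0 p c" "bt p c0 c" using z(2) b0 bet_bt by blast+
            then show False using bt_antisym n0(1) by blast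
          qed
          moreover have "z \<noteq> c" using z disj[OF c_on] by blast
          ultimately show ?thesis by (simp add: bet_iff)
        qed
        then have pz: "p \<noteq> z" "col p z c" using bet_strict bt_col by blast+
        have "col p r c" using same_line[OF pr pz(1) pl z(1), of c] pz(2) by blast
        then show False using disj[OF c_on] by blast
      qed
    next
      assume "meets p r f c0"
      then obtain z where z: "col p r z" "bet f z c0" unfolding meets_def by blast
      show False
      proof (cases "z = p")
        case True
        have b: "bet f p c0" using z(2) True by simp
        have "col c0 f p" "c0 \<noteq> f"
          using col_perm(5)[OF bt_col[OF bet_bt[OF b]]] bet_neq3[OF b] by auto
        then show False using perp_degenerate[OF Pf] fp by blast
      next
        case False
        have "le c0 z c0 f" using bt_le[of c0 z f] bt_sym[OF bet_bt[OF z(2)]] by blast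
        moreover have "le c0 f c0 p" using leg_le[OF Pf] .
        ultimately have "le c0 z c0 p" using le_trans by blast
        then show False using leg_lt[OF Pc0[OF z(1)]] n0(1) False by blast
      qed
    qed
  qed
  have "\<not> bet f m2 m1" "\<not> bet m2 m1 f" using n1 n2 bet_sym by blast+
  then have "bet m1 f m2" using cl3 fm1 fm2 m12 by (auto simp: col_def bt_def)
  then show "bet m2 f m1" using bet_sym by blast
qed

text \<open>
  The distance of \<open>y\<close> from \<open>p\<close> is the sum of the lengths of \<open>pm\<close> and \<open>pr\<close>, so \<open>y\<close> differs from \<open>p\<close> and \<open>m\<close>,
  wherever \<open>m\<close> is; in particular \<open>m\<close> may be \<open>p\<close>.
\<close>

lemma base_point_off_feet:
  assumes pr: "p \<noteq> r" and x: "bt r p x" "cong p x p m" and y: "bt r x y" "cong x y p r"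
  shows "col p r y" "y \<noteq> p" "y \<noteq> m"
proof -
  have rx: "r \<noteq> x" using x(1) pr bt_id by blast
  have xy: "x \<noteq> y" using y(2) pr cong_null' by blast
  have b: "bt p x y" using bt_in3[OF y(1) x(1)] .
  show "col p r y" using bt_in4[OF y(1) x(1)] bt_col col_perm(1) by blast
  show "y \<noteq> p" using b xy bt_id by blast
  show "y \<noteq> m"
  proof
    assume "y = m"
    then have "le p y p x" using x(2) cong_sym unfolding le_def by (metis bt_triv(2))
    then have "bt p y x" using shorter_on_ray b by blast
    then show False using b xy bt_antisym bt_sym by blast
  qed
qed

lemma on_parallel_line:
  assumes h: "parallelogram p q r s t" and y: "col s q y" and w: "col p r w" "col p r w'" "w \<noteq> w'"
    and m: "mid w t' y" "mid w' t' s'"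
  shows "bet w t' y" "bet s' t' w'" "\<not> col s' y w" "\<And>x. col s' y x \<Longrightarrow> col s q x"
proof -
  have sq: "s \<noteq> q" and pr: "p \<noteq> r" using parallelogram_neq h unfolding parallelogram_def by blast+
  have s': "col s q s'" using reflect_on_parallel[OF h y w m] .
  have s'y: "s' \<noteq> y" using m w(3) mid_end2 by blast
  show e: "col s q x" if "col s' y x" for x using same_line[OF sq s'y s' y, of x] that by blast
  have wl: "\<not> col s q w" using parallelogram_disjoint[OF h] w(1) by blast
  show n: "\<not> col s' y w" using e wl by blast
  have P: "parallelogram w y w' s' t'" using m w(3) n unfolding parallelogram_def by blast
  show "bet w t' y" "bet s' t' w'" using parallelogram_bet[OF P] by blast+
qed

lemma not_collinear: "\<not> col a b c \<Longrightarrow> \<nexists>x y. x \<noteq> y \<and> onl x y a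
    \<and> onl x y b \<and> onl x y c"
  using onl_imp_col col_line by blast

text \<open>
  The circle around \<open>x\<close> with radius \<open>az\<close> meets the ray from \<open>a\<close> opposite to \<open>g\<close>.  Its radius exceeds \<open>ax\<close>, so
  \<open>a\<close> is inside; \<open>u0\<close> is outside, because it is on the ray at distance \<open>ax + az\<close> from \<open>a\<close>.
  The point \<open>e\<close>, which is laid off from \<open>x\<close> towards \<open>u0\<close>, witnesses the latter.
\<close>

lemma ray_circle:
  assumes ga: "g \<noteq> a" and y1: "bt a y1 z" "cong a y1 a x" "y1 \<noteq> z"
    and y: "bt g a y" "cong a y a x" and u0: "bt g y u0" "cong y u0 a z"
  shows "g \<noteq> y" "a \<noteq> u0" "u0 \<noteq> x"
    "\<lbrakk>bt u0 x k; cong x k a z\<rbrakk> \<Longrightarrow> k \<noteq> x"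
    "\<lbrakk>bt u0 x k; cong x k a z; bt k x e; cong x e a z\<rbrakk> \<Longrightarrow> bt x e u0"
    "bt a u u0 \<Longrightarrow> bt g a u"
proof -
  have az: "a \<noteq> z" using y1 bt_id by blast
  show gy: "g \<noteq> y" using ga y(1) bt_id by blast
  have yu: "y \<noteq> u0" using u0(2) az cong_null' by blast
  have ayu: "bt a y u0" using bt_in3[OF u0(1) y(1)] .
  show "a \<noteq> u0" using ayu yu bt_id by blast
  have le: "le y u0 x u0" using triangle_le[OF cong_sym[OF y(2)] ayu] .
  show ux: "u0 \<noteq> x" using le le_null yu by blast
  show kx: "k \<noteq> x" if "cong x k a z" for k using that az cong_null' by blast
  show "bt x e u0" if k: "bt u0 x k" "cong x k a z" and e: "bt k x e" "cong x e a z"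
  proof -
    have "cong y u0 x e" using u0(2) e(2) by (metis cong_len)
    then have "le x e x u0" using le_cong[OF le _ cong_refl] by blast
    then show ?thesis using shorter_on_ray[of x e u0] between_total_beyond[OF kx[OF k(2)] e(1) bt_sym[OF k(1)]] by blast
  qed
  show "bt g a u" if "bt a u u0"
    using bt_in1[OF bt_in4[OF u0(1) y(1)] that] .
qed

lemma opposite_rays:
  assumes "a \<noteq> b" "bt b a z" "a \<noteq> z" "bt b a u" "bt z a v" "u \<noteq> a"
  shows "u \<noteq> v"
proof
  assume uv: "u = v"
  have "bt a u z \<or> bt a z u" using between_total_beyond[of b a u z] assms by blast
  then show False
  proof
    assume "bt a u z"
    then have "bt z u a" "bt a u z" using bt_sym by blast+
    moreover have "bt u a z" using uv assms(5) bt_sym by blast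
    ultimately show False using bt_antisym[of a u z] assms(6) by blast
  next
    assume "bt a z u"
    moreover have "bt z a u" using uv assms(5) by blast
    ultimately show False using bt_antisym assms(3) by blast
  qed
qed

text \<open>
  The radius \<open>az\<close> is the sum of \<open>ax\<close> and \<open>ab\<close>.  The circle meets the two rays from \<open>a\<close> in points \<open>u\<close> and
  \<open>v\<close> that are distinct because neither is \<open>a\<close>.
\<close>

lemma foot_config:
  assumes ab: "a \<noteq> b" and y: "bt b a y" "cong a y a x" and z: "bt b y z" "cong y z a b"
  shows "b \<noteq> y" "bt a y z" "y \<noteq> z" "a \<noteq> z"
    "\<lbrakk>bt b a u; cong x u a z; bt z a v; cong x v a z\<rbrakk> \<Longrightarrow> col a b u
        \<and> col a b v \<and> u \<noteq> v \<and> cong x u x v"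
proof -
  show "b \<noteq> y" using ab y(1) bt_id by blast
  show ayz: "bt a y z" using bt_in3[OF z(1) y(1)] .
  show yz: "y \<noteq> z" using z(2) ab cong_null' by blast
  show az: "a \<noteq> z" using ayz yz bt_id by blast
  have baz: "bt b a z" using bt_in4[OF z(1) y(1)] .
  show "col a b u \<and> col a b v \<and> u \<noteq> v \<and> cong x u x v"
    if u: "bt b a u" "cong x u a z" and v: "bt z a v" "cong x v a z"
  proof -
    have ua: "u \<noteq> a"
    proof
      assume "u = a"
      then have "cong a z a y" using u(2) y(2) by (metis len_laws)
      then have "le a z a y" unfolding le_def using bt_triv(2) by blast
      then have "bt a z y" using shorter_on_ray ayz by blast
      then show False using ayz yz bt_antisym bt_sym by blast
    qed
    have "col a b u" using bt_col[OF u(1)] col_perm(1) by blast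
    moreover have "col a b v"
    proof -
      have "col a z b" "col a z v" using bt_col[OF baz] bt_col[OF v(1)] col_perm by blast+
      then show ?thesis using col_trans[OF az] by blast
    qed
    moreover have "u \<noteq> v" using opposite_rays[OF ab baz az u(1) v(1) ua] .
    moreover have "cong x u x v" using u(2) v(2) by (metis cong_len)
    ultimately show ?thesis by blast
  qed
qed

end

section \<open>Renaming and derivations\<close>

text \<open>
  The renaming that \<open>f\<close> induces under a binder.
\<close>

abbreviation up :: "(nat \<Rightarrow> nat) \<Rightarrow> nat \<Rightarrow> nat" where
  "up f \<equiv> case_nat 0 (\<lambda>n. Suc (f n))"

primrec fv :: "fm \<Rightarrow> nat set" where
  "fv (x \<^bold>= y) = {x, y}"
| "fv (Bet x y z) = {x, y, z}"
| "fv (Cong x y z w) = {x, y, z, w}"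
| "fv \<^bold>\<bottom> = {}"
| "fv (A \<^bold>\<and> B) = fv A \<union> fv B"
| "fv (A \<^bold>\<or> B) = fv A \<union> fv B"
| "fv (A \<^bold>\<longrightarrow> B) = fv A \<union> fv B"
| "fv (Forall A) = Suc -` fv A"
| "fv (Exists A) = Suc -` fv A"

lemma finite_fv: "finite (fv A)"
  by (induction A) (auto intro: finite_vimageI)

lemma up_cong: "(\<And>n. Suc n \<in> S \<Longrightarrow> f n = g n) \<Longrightarrow> n \<in> S
    \<Longrightarrow> up f n = up g n"
  by (cases n) auto

lemma ren_cong: "(\<And>n. n \<in> fv A \<Longrightarrow> f n = g n) \<Longrightarrow> ren f A = ren g A"
proof (induction A arbitrary: f g)
  case (Forall A)
  have "ren (up f) A = ren (up g) A"
    using Forall.prems by (intro Forall.IH) (rule up_cong[of "fv A"], auto)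
  then show ?case by simp
next
  case (Exists A)
  have "ren (up f) A = ren (up g) A"
    using Exists.prems by (intro Exists.IH) (rule up_cong[of "fv A"], auto)
  then show ?case by simp
next
  case (Con A B)
  then show ?case by (metis (no_types, lifting) UnCI fv.simps(5) ren.simps(5))
next
  case (Dis A B)
  then show ?case by (metis (no_types, lifting) UnCI fv.simps(6) ren.simps(6))
next
  case (Imp A B)
  then show ?case by (metis (no_types, lifting) UnCI fv.simps(7) ren.simps(7))
qed auto

lemma up_comp: "up f (up g n) = up (\<lambda>n. f (g n)) n"
  by (cases n) auto

lemma ren_ren: "ren f (ren g A) = ren (\<lambda>n. f (g n)) A"
  by (induction A arbitrary: f g) (simp_all add: up_comp)

lemma up_id: "up (\<lambda>n. n) = (\<lambda>n. n)"
  by (rule ext) (simp split: nat.split)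

lemma ren_id: "ren (\<lambda>n. n) A = A"
  by (induction A) (simp_all add: up_id)

lemma ren_inst: "ren f (inst x A) = ren (case_nat (f x) f) A"
  by (simp add: ren_ren) (rule ren_cong, simp split: nat.split)

lemma inst_ren_up: "inst x (ren (up f) A) = ren (case_nat x f) A"
  by (simp add: ren_ren) (rule ren_cong, simp split: nat.split)

lemma ren_up_shift: "ren (up f) (shift A) = shift (ren f A)"
  by (simp add: ren_ren)

lemma deriv_weaken: "\<Gamma> \<turnstile> A \<Longrightarrow> \<Gamma> \<subseteq> \<Delta>
    \<Longrightarrow> \<Delta> \<turnstile> A"
proof (induction arbitrary: \<Delta> rule: deriv.induct)
  case (DisE \<Gamma> A B C)
  then show ?case by (meson deriv.DisE insert_mono)
next
  case (ImpI A \<Gamma> B)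
  then show ?case by (meson deriv.ImpI insert_mono)
next
  case (ForallI \<Gamma> A)
  then show ?case by (meson deriv.ForallI image_mono)
next
  case (ExistsE \<Gamma> A C)
  then show ?case by (meson deriv.ExistsE image_mono insert_mono)
qed (blast intro: deriv.intros)+

lemma deriv_ren: "\<Gamma> \<turnstile> A \<Longrightarrow> ren f ` \<Gamma> \<turnstile> ren f A"
proof (induction arbitrary: f rule: deriv.induct)
  case (Assm A \<Gamma>)
  then show ?case by (blast intro: deriv.Assm)
next
  case (DisE \<Gamma> A B C)
  then show ?case by (metis deriv.DisE image_insert ren.simps(6))
next
  case (ImpI A \<Gamma> B)
  then show ?case by (simp add: deriv.ImpI)
next
  case (ForallI \<Gamma> A)
  have "ren (up f) ` shift ` \<Gamma> = shift ` ren f ` \<Gamma>"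
    by (simp add: image_image ren_up_shift)
  then show ?case using ForallI.IH[of "up f"] by (simp add: deriv.ForallI)
next
  case (ForallE \<Gamma> A x)
  then show ?case using deriv.ForallE[of _ "ren (up f) A" "f x"] by (simp add: ren_inst inst_ren_up)
next
  case (ExistsI \<Gamma> x A)
  then show ?case using deriv.ExistsI[of _ "f x" "ren (up f) A"] by (simp add: ren_inst inst_ren_up)
next
  case (ExistsE \<Gamma> A C)
  have "ren (up f) ` shift ` \<Gamma> = shift ` ren f ` \<Gamma>"
    by (simp add: image_image ren_up_shift)
  then have "insert (ren (up f) A) (shift ` ren f ` \<Gamma>) \<turnstile> shift (ren f C)"
    using ExistsE.IH(2)[of "up f"] by (simp add: ren_up_shift)
  then show ?case using ExistsE.IH(1)[of f] deriv.ExistsE by simp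
next
  case (EqE \<Gamma> x y A)
  then show ?case using deriv.EqE[of _ "f x" "f y" "ren (up f) A"] by (simp add: ren_inst inst_ren_up)
qed (auto intro: deriv.intros)

lemma deriv_cut: "\<Gamma> \<turnstile> A \<Longrightarrow> insert A \<Gamma> \<turnstile> B
    \<Longrightarrow> \<Gamma> \<turnstile> B"
  using ImpI ImpE by blast

text \<open>
  Existence elimination with a named eigenvariable \<open>k\<close>: renaming \<open>k\<close> to \<open>0\<close> and shifting all other variables
  turns it into the rule with shifted assumptions.
\<close>

lemma ex_elim:
  assumes "\<Gamma> \<turnstile> Exists A" "insert (inst k A) \<Gamma> \<turnstile> C"
    and fresh: "\<And>B. B \<in> \<Gamma> \<Longrightarrow> k \<notin> fv B" "k \<notin> fv (Exists A)"
        "k \<notin> fv C"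
  shows "\<Gamma> \<turnstile> C"
proof -
  define f where "f n = (if n = k then 0 else Suc n)" for n
  have s: "ren f B = shift B" if "k \<notin> fv B" for B
    using that by (intro ren_cong) (auto simp: f_def)
  have "ren f (inst k A) = A"
  proof -
    have "ren f (inst k A) = ren (\<lambda>n. n) A"
      unfolding ren_inst using fresh(2) by (intro ren_cong) (auto simp: f_def split: nat.split)
    then show ?thesis by (simp add: ren_id)
  qed
  moreover have "ren f ` \<Gamma> = shift ` \<Gamma>" using s fresh(1) by force
  ultimately have "insert A (shift ` \<Gamma>) \<turnstile> shift C"
    using deriv_ren[OF assms(2), of f] s[OF fresh(3)] by simp
  then show ?thesis using ExistsE assms(1) by blast
qed

lemma deriv_finite: "\<Gamma> \<turnstile> A \<Longrightarrow> \<exists>F. finite F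
    \<and> F \<subseteq> \<Gamma> \<and> (F \<turnstile> A)"
proof (induction rule: deriv.induct)
  case (Assm A \<Gamma>)
  then show ?case by (intro exI[of _ "{A}"]) (auto intro: deriv.Assm)
next
  case (ConI \<Gamma> A B)
  then obtain F G where F: "finite F" "F \<subseteq> \<Gamma>" "F \<turnstile> A"
      and G: "finite G" "G \<subseteq> \<Gamma>" "G \<turnstile> B" by blast
  have "F \<union> G \<turnstile> A \<^bold>\<and> B"
    by (rule deriv.ConI[OF deriv_weaken[OF F(3)] deriv_weaken[OF G(3)]]) auto
  then show ?case using F G by (intro exI[of _ "F \<union> G"]) simp
next
  case (DisE \<Gamma> A B C)
  then obtain F G H where F: "finite F" "F \<subseteq> \<Gamma>" "F \<turnstile> A \<^bold>\<or> B"
    and G: "finite G" "G \<subseteq> insert A \<Gamma>" "G \<turnstile> C"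
        and H: "finite H" "H \<subseteq> insert B \<Gamma>" "H \<turnstile> C" by blast
  have "F \<union> (G - {A}) \<union> (H - {B}) \<turnstile> C"
    by (rule deriv.DisE[OF deriv_weaken[OF F(3)] deriv_weaken[OF G(3)] deriv_weaken[OF H(3)]]) auto
  then show ?case using F G H by (intro exI[of _ "F \<union> (G - {A}) \<union> (H - {B})"]) auto
next
  case (ImpI A \<Gamma> B)
  then obtain F where F: "finite F" "F \<subseteq> insert A \<Gamma>" "F \<turnstile> B" by blast
  have "F - {A} \<turnstile> A \<^bold>\<longrightarrow> B" by (rule deriv.ImpI[OF deriv_weaken[OF F(3)]]) auto
  then show ?case using F by (intro exI[of _ "F - {A}"]) auto
next
  case (ImpE \<Gamma> A B)
  then obtain F G where F: "finite F" "F \<subseteq> \<Gamma>"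
      "F \<turnstile> A \<^bold>\<longrightarrow> B"
          and G: "finite G" "G \<subseteq> \<Gamma>" "G \<turnstile> A" by blast
  have "F \<union> G \<turnstile> B"
    by (rule deriv.ImpE[OF deriv_weaken[OF F(3)] deriv_weaken[OF G(3)]]) auto
  then show ?case using F G by (intro exI[of _ "F \<union> G"]) simp
next
  case (ForallI \<Gamma> A)
  then obtain F where F: "finite F" "F \<subseteq> shift ` \<Gamma>" "F \<turnstile> A" by blast
  then obtain F0 where "F0 \<subseteq> \<Gamma>" "finite F0" "F = shift ` F0" using finite_subset_image by meson
  then show ?case using F deriv.ForallI by blast
next
  case (ExistsE \<Gamma> A C)
  then obtain F G where F: "finite F" "F \<subseteq> \<Gamma>" "F \<turnstile> Exists A"
      and G: "finite G" "G \<subseteq> insert A (shift ` \<Gamma>)" "G \<turnstile> shift C"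
    by blast
  have "G - {A} \<subseteq> shift ` \<Gamma>" "finite (G - {A})" using G by auto
  then obtain G0 where G0: "G0 \<subseteq> \<Gamma>" "finite G0" "G - {A} = shift ` G0"
      using finite_subset_image by meson
  have "G \<subseteq> insert A (shift ` (F \<union> G0))" using G0(3) by auto
  then have "insert A (shift ` (F \<union> G0)) \<turnstile> shift C" using G(3) deriv_weaken by blast
  moreover have "F \<union> G0 \<turnstile> Exists A" using F(3) deriv_weaken by blast
  ultimately have "F \<union> G0 \<turnstile> C" using deriv.ExistsE by blast
  then show ?case using F G0 by (intro exI[of _ "F \<union> G0"]) auto
next
  case (EqE \<Gamma> x y A)
  then obtain F G where F: "finite F" "F \<subseteq> \<Gamma>" "F \<turnstile> x \<^bold>= y"
      and G: "finite G" "G \<subseteq> \<Gamma>" "G \<turnstile> inst x A" by blast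
  have "F \<union> G \<turnstile> inst y A"
    by (rule deriv.EqE[OF deriv_weaken[OF F(3)] deriv_weaken[OF G(3)]]) auto
  then show ?case using F G by (intro exI[of _ "F \<union> G"]) simp
next
  case (EqI \<Gamma> x)
  then show ?case by (intro exI[of _ "{}"]) (auto intro: deriv.EqI)
qed (blast intro: deriv.intros)+

section \<open>Saturated sets of formulas\<close>

instance fm :: countable
  by countable_datatype

text \<open>
  Maximal consistent sets with witnesses, for the intuitionistic calculus.  As there are no witnesses for
  refuted universal formulas, membership decides truth only for formulas without \<open>Forall\<close>; of a universal
  member one has the instances.  This suffices, because the axioms are universal closures of
  such formulas.
\<close>

definition saturated :: "fm set \<Rightarrow> bool" where
  "saturated \<Delta> \<longleftrightarrow> \<not> (\<Delta> \<turnstile> \<^bold>\<bottom>)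
      \<and> (\<forall>A. A \<notin> \<Delta> \<longrightarrow> (insert A \<Delta> \<turnstile> \<^bold>\<bottom>))
     \<and> (\<forall>B. Exists B \<in> \<Delta> \<longrightarrow> (\<exists>k. inst k B \<in> \<Delta>))"

definition witness :: "nat \<Rightarrow> fm \<Rightarrow> fm set" where
  "witness k A = (case A of Exists B \<Rightarrow> {inst k B} | _ \<Rightarrow> {})"

definition fvs :: "fm set \<Rightarrow> nat set" where
  "fvs \<Gamma> = \<Union> (fv ` \<Gamma>)"

text \<open>
  When an existential formula is added, a witness for it is added as well, with a variable that is fresh for
  the finitely many variables used so far.
\<close>

primrec stage :: "fm set \<Rightarrow> nat \<Rightarrow> fm set" where
  "stage \<Gamma> 0 = \<Gamma>"
| "stage \<Gamma> (Suc n) =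
     (let S = insert (from_nat n) (stage \<Gamma> n) in
      if S \<turnstile> \<^bold>\<bottom> then stage \<Gamma> n else S \<union> witness (SOME k. k \<notin> fvs S) (from_nat n))"

lemma finite_fvs_stage: "finite (fvs \<Gamma>) \<Longrightarrow> finite (fvs (stage \<Gamma> n))"
proof (induction n)
  case (Suc n)
  have "finite (fvs (witness k A))" for k A
    by (cases A) (auto simp: witness_def fvs_def finite_fv)
  then show ?case using Suc by (simp add: Let_def fvs_def finite_fv)
qed simp

lemma stage_consistent:
  assumes "finite (fvs \<Gamma>)" "\<not> (\<Gamma> \<turnstile> \<^bold>\<bottom>)"
  shows "\<not> (stage \<Gamma> n \<turnstile> \<^bold>\<bottom>)"
proof (induction n)
  case (Suc n)
  define S where "S = insert (from_nat n) (stage \<Gamma> n)"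
  define k where "k = (SOME k. k \<notin> fvs S)"
  show ?case
  proof (cases "S \<turnstile> \<^bold>\<bottom>")
    case True
    then show ?thesis using Suc by (simp add: S_def)
  next
    case False
    have "finite (fvs S)" using finite_fvs_stage[OF assms(1), of n] by (simp add: S_def fvs_def finite_fv)
    then have k: "k \<notin> fvs S" unfolding k_def by (metis ex_new_if_finite infinite_UNIV_nat someI_ex)
    have "\<not> (S \<union> witness k (from_nat n) \<turnstile> \<^bold>\<bottom>)"
    proof (cases "from_nat n :: fm")
      case (Exists B)
      have e: "S \<turnstile> Exists B" using Exists by (auto simp: S_def intro: Assm)
      show ?thesis
      proof
        assume "S \<union> witness k (from_nat n) \<turnstile> \<^bold>\<bottom>"
        then have i: "insert (inst k B) S \<turnstile> \<^bold>\<bottom>" using Exists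
            by (simp add: witness_def)
        have "S \<turnstile> \<^bold>\<bottom>"
        proof (rule ex_elim[OF e i])
          show "k \<notin> fv C" if "C \<in> S" for C using k that by (auto simp: fvs_def)
          show "k \<notin> fv (Exists B)" using k Exists by (auto simp: fvs_def S_def)
        qed simp
        then show False using False by blast
      qed
    qed (use False in \<open>simp_all add: witness_def\<close>)
    then show ?thesis using False unfolding k_def S_def by (simp add: Let_def)
  qed
qed (use assms in simp)

lemma stage_mono: "m \<le> n \<Longrightarrow> stage \<Gamma> m \<subseteq> stage \<Gamma> n"
proof (induction rule: dec_induct)
  case (step n)
  have "stage \<Gamma> n \<subseteq> stage \<Gamma> (Suc n)" by (auto simp: Let_def)
  then show ?case using step by blast
qed simp

lemma saturated_extension:
  assumes "finite (fvs \<Gamma>)" "\<not> (\<Gamma> \<turnstile> \<^bold>\<bottom>)"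
  shows "\<exists>\<Delta>. \<Gamma> \<subseteq> \<Delta> \<and> saturated \<Delta>"
proof (intro exI conjI)
  define \<Delta> where "\<Delta> = (\<Union>n. stage \<Gamma> n)"
  have sub: "stage \<Gamma> n \<subseteq> \<Delta>" for n unfolding \<Delta>_def by blast
  show "\<Gamma> \<subseteq> \<Delta>" using sub[of 0] by simp
  show "saturated \<Delta>" unfolding saturated_def
  proof (intro conjI allI impI)
    show "\<not> (\<Delta> \<turnstile> \<^bold>\<bottom>)"
    proof
      assume "\<Delta> \<turnstile> \<^bold>\<bottom>"
      then obtain F where F: "finite F" "F \<subseteq> \<Delta>" "F \<turnstile> \<^bold>\<bottom>"
          using deriv_finite by blast
      have "\<exists>n. F \<subseteq> stage \<Gamma> n" using F(1,2)
      proof (induction F)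
        case (insert A F)
        then obtain m n where "F \<subseteq> stage \<Gamma> n" "A \<in> stage \<Gamma> m"
            unfolding \<Delta>_def by blast
        then have "insert A F \<subseteq> stage \<Gamma> (max m n)"
          using stage_mono[of m "max m n" \<Gamma>] stage_mono[of n "max m n" \<Gamma>] by auto
        then show ?case by blast
      qed simp
      then show False using F(3) deriv_weaken stage_consistent[OF assms] by blast
    qed
  next
    fix A assume A: "A \<notin> \<Delta>"
    define n where "n = to_nat A"
    have n: "from_nat n = A" by (simp add: n_def)
    have "insert A (stage \<Gamma> n) \<turnstile> \<^bold>\<bottom>"
    proof (rule ccontr)
      assume "\<not> ?thesis"
      then have "A \<in> stage \<Gamma> (Suc n)" using n by (simp add: Let_def)
      then show False using A sub by blast
    qed
    then show "insert A \<Delta> \<turnstile> \<^bold>\<bottom>" by (rule deriv_weaken) (use sub in blast)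
  next
    fix B assume B: "Exists B \<in> \<Delta>"
    define n where "n = to_nat (Exists B)"
    have n: "from_nat n = Exists B" by (simp add: n_def)
    have "\<not> (insert (Exists B) (stage \<Gamma> n) \<turnstile> \<^bold>\<bottom>)"
    proof
      assume a: "insert (Exists B) (stage \<Gamma> n) \<turnstile> \<^bold>\<bottom>"
      obtain m where "Exists B \<in> stage \<Gamma> m" using B unfolding \<Delta>_def by blast
      then have "insert (Exists B) (stage \<Gamma> n) \<subseteq> stage \<Gamma> (max m n)"
        using stage_mono[of m "max m n" \<Gamma>] stage_mono[of n "max m n" \<Gamma>] by auto
      then show False using deriv_weaken[OF a] stage_consistent[OF assms] by blast
    qed
    then have "\<exists>k. inst k B \<in> stage \<Gamma> (Suc n)" using n by (auto simp: Let_def witness_def)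
    then show "\<exists>k. inst k B \<in> \<Delta>" using sub by blast
  qed
qed

primrec sat :: "'p set \<Rightarrow> ('p \<Rightarrow> 'p \<Rightarrow> 'p \<Rightarrow> bool) \<Rightarrow> ('p \<Rightarrow> 'p \<Rightarrow> 'p \<Rightarrow> 'p \<Rightarrow> bool)
    \<Rightarrow> (nat \<Rightarrow> 'p) \<Rightarrow> fm \<Rightarrow> bool" where
  "sat D bet cong e (x \<^bold>= y) \<longleftrightarrow> e x = e y"
| "sat D bet cong e (Bet x y z) \<longleftrightarrow> bet (e x) (e y) (e z)"
| "sat D bet cong e (Cong x y z w) \<longleftrightarrow> cong (e x) (e y) (e z) (e w)"
| "sat D bet cong e \<^bold>\<bottom> \<longleftrightarrow> False"
| "sat D bet cong e (A \<^bold>\<and> B) \<longleftrightarrow> sat D bet cong e A \<and> sat D bet cong e B"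
| "sat D bet cong e (A \<^bold>\<or> B) \<longleftrightarrow> sat D bet cong e A \<or> sat D bet cong e B"
| "sat D bet cong e (A \<^bold>\<longrightarrow> B) \<longleftrightarrow> (sat D bet cong e A
    \<longrightarrow> sat D bet cong e B)"
| "sat D bet cong e (Forall A) \<longleftrightarrow> (\<forall>d\<in>D. sat D bet cong (case_nat d e) A)"
| "sat D bet cong e (Exists A) \<longleftrightarrow> (\<exists>d\<in>D. sat D bet cong (case_nat d e) A)"

primrec no_forall :: "fm \<Rightarrow> bool" where
  "no_forall (x \<^bold>= y) = True"
| "no_forall (Bet x y z) = True"
| "no_forall (Cong x y z w) = True"
| "no_forall \<^bold>\<bottom> = True"
| "no_forall (A \<^bold>\<and> B) = (no_forall A \<and> no_forall B)"
| "no_forall (A \<^bold>\<or> B) = (no_forall A \<and> no_forall B)"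
| "no_forall (A \<^bold>\<longrightarrow> B) = (no_forall A \<and> no_forall B)"
| "no_forall (Forall A) = False"
| "no_forall (Exists A) = no_forall A"

context
  fixes \<Delta> :: "fm set"
  assumes sat\<Delta>: "saturated \<Delta>"
begin

lemma cons: "\<not> (\<Delta> \<turnstile> \<^bold>\<bottom>)" using sat\<Delta> saturated_def by blast

lemma memI: "\<Delta> \<turnstile> A \<Longrightarrow> A \<in> \<Delta>"
  using sat\<Delta> deriv_cut[of \<Delta> A "\<^bold>\<bottom>"] unfolding saturated_def by blast

lemma memD: "A \<in> \<Delta> \<Longrightarrow> \<Delta> \<turnstile> A"
  by (rule Assm)

lemma not_mem: "A \<notin> \<Delta> \<Longrightarrow> insert A \<Delta> \<turnstile> \<^bold>\<bottom>"
  using sat\<Delta> unfolding saturated_def by blast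

lemma mem_bot: "\<^bold>\<bottom> \<notin> \<Delta>" using cons memD by blast

lemma mem_con: "(A \<^bold>\<and> B) \<in> \<Delta> \<longleftrightarrow> A \<in> \<Delta>
    \<and> B \<in> \<Delta>"
  using memI[of A] memI[of B] memI[of "A \<^bold>\<and> B"] memD[of A] memD[of B] memD[of "A \<^bold>\<and> B"]
    ConI[of \<Delta> A B] ConE1[of \<Delta> A B] ConE2[of \<Delta> A B] by argo

lemma mem_imp: "(A \<^bold>\<longrightarrow> B) \<in> \<Delta> \<longleftrightarrow> (A \<in> \<Delta>
    \<longrightarrow> B \<in> \<Delta>)"
proof
  assume "(A \<^bold>\<longrightarrow> B) \<in> \<Delta>"
  then show "A \<in> \<Delta> \<longrightarrow> B \<in> \<Delta>" using memI[OF ImpE[OF memD memD]] by simp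
next
  assume h: "A \<in> \<Delta> \<longrightarrow> B \<in> \<Delta>"
  have "insert A \<Delta> \<turnstile> B"
  proof (cases "A \<in> \<Delta>")
    case True then show ?thesis using h by (intro Assm) simp
  next
    case False then show ?thesis by (rule FalsumE[OF not_mem])
  qed
  then show "(A \<^bold>\<longrightarrow> B) \<in> \<Delta>" by (rule memI[OF ImpI])
qed

lemma mem_dis: "(A \<^bold>\<or> B) \<in> \<Delta> \<longleftrightarrow> A \<in> \<Delta>
    \<or> B \<in> \<Delta>"
proof
  assume h: "(A \<^bold>\<or> B) \<in> \<Delta>"
  show "A \<in> \<Delta> \<or> B \<in> \<Delta>"
  proof (rule ccontr)
    assume "\<not> ?thesis"
    then have "insert A \<Delta> \<turnstile> \<^bold>\<bottom>"
        "insert B \<Delta> \<turnstile> \<^bold>\<bottom>" using not_mem by blast+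
    then show False using DisE[OF memD[OF h]] cons by blast
  qed
next
  assume "A \<in> \<Delta> \<or> B \<in> \<Delta>"
  then show "(A \<^bold>\<or> B) \<in> \<Delta>" using memI[OF DisI1[OF memD]] memI[OF DisI2[OF memD]]
      by (elim disjE) simp_all
qed

lemma mem_exists: "Exists A \<in> \<Delta> \<longleftrightarrow> (\<exists>k. inst k A \<in> \<Delta>)"
proof
  assume "Exists A \<in> \<Delta>"
  then show "\<exists>k. inst k A \<in> \<Delta>" using sat\<Delta> unfolding saturated_def by simp
next
  assume "\<exists>k. inst k A \<in> \<Delta>"
  then obtain k where "inst k A \<in> \<Delta>" by (rule exE)
  then show "Exists A \<in> \<Delta>" by (rule memI[OF ExistsI[OF memD]])
qed

lemma mem_forall: "Forall A \<in> \<Delta> \<Longrightarrow> inst k A \<in> \<Delta>"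
  by (rule memI[OF ForallE[OF memD]])

lemma mem_eq_refl: "x \<^bold>= x \<in> \<Delta>" by (rule memI[OF EqI])

lemma mem_eq_subst: "x \<^bold>= y \<in> \<Delta> \<Longrightarrow> inst x A \<in> \<Delta>
    \<Longrightarrow> inst y A \<in> \<Delta>"
  by (rule memI[OF EqE[OF memD memD]])

lemma mem_eq_sym: "x \<^bold>= y \<in> \<Delta> \<Longrightarrow> y \<^bold>= x \<in> \<Delta>"
  using mem_eq_subst[of x y "0 \<^bold>= Suc x"] mem_eq_refl by simp

lemma mem_eq_trans: "x \<^bold>= y \<in> \<Delta> \<Longrightarrow> y \<^bold>= z \<in> \<Delta>
    \<Longrightarrow> x \<^bold>= z \<in> \<Delta>"
  using mem_eq_subst[of y z "Suc x \<^bold>= 0"] by simp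

lemma mem_bet_subst: "\<lbrakk>x \<^bold>= x' \<in> \<Delta>; y \<^bold>= y' \<in> \<Delta>; z \<^bold>= z' \<in> \<Delta>; Bet x y z \<in> \<Delta>\<rbrakk> \<Longrightarrow> Bet x' y' z' \<in> \<Delta>"
  using mem_eq_subst[of x x' "Bet 0 (Suc y) (Suc z)"] mem_eq_subst[of y y' "Bet (Suc x') 0 (Suc z)"]
    mem_eq_subst[of z z' "Bet (Suc x') (Suc y') 0"] by simp

lemma mem_cong_subst: "\<lbrakk>x \<^bold>= x' \<in> \<Delta>; y \<^bold>= y' \<in> \<Delta>; z \<^bold>= z' \<in> \<Delta>; w \<^bold>= w' \<in> \<Delta>; Cong x y z w \<in> \<Delta>\<rbrakk>
   \<Longrightarrow> Cong x' y' z' w' \<in> \<Delta>"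
  using mem_eq_subst[of x x' "Cong 0 (Suc y) (Suc z) (Suc w)"] mem_eq_subst[of y y' "Cong (Suc x') 0 (Suc z) (Suc w)"]
    mem_eq_subst[of z z' "Cong (Suc x') (Suc y') 0 (Suc w)"] mem_eq_subst[of w w' "Cong (Suc x') (Suc y') (Suc z') 0"] by simp

context
  fixes v :: "nat \<Rightarrow> 'p"
  assumes v: "\<And>x y. v x = v y \<longleftrightarrow> x \<^bold>= y \<in> \<Delta>"
begin

definition "bet_of p q r \<longleftrightarrow> (\<exists>x y z. p = v x \<and> q = v y \<and> r = v z
    \<and> Bet x y z \<in> \<Delta>)"
definition "cong_of p q r s \<longleftrightarrow> (\<exists>x y z w. p = v x \<and> q = v y \<and> r = v z
    \<and> s = v w \<and> Cong x y z w \<in> \<Delta>)"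

lemma bet_of: "bet_of (v x) (v y) (v z) \<longleftrightarrow> Bet x y z \<in> \<Delta>"
proof
  assume "bet_of (v x) (v y) (v z)"
  then obtain x' y' z' where h: "v x = v x'" "v y = v y'" "v z = v z'" "Bet x' y' z' \<in> \<Delta>"
    unfolding bet_of_def by (elim exE conjE)
  then show "Bet x y z \<in> \<Delta>" using mem_bet_subst[of x' x y' y z' z] v by metis
qed (unfold bet_of_def, intro exI conjI, (rule refl)+)

lemma cong_of: "cong_of (v x) (v y) (v z) (v w) \<longleftrightarrow> Cong x y z w \<in> \<Delta>"
proof
  assume "cong_of (v x) (v y) (v z) (v w)"
  then obtain x' y' z' w' where h: "v x = v x'" "v y = v y'" "v z = v z'" "v w = v w'"
      "Cong x' y' z' w' \<in> \<Delta>"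
    unfolding cong_of_def by (elim exE conjE)
  then show "Cong x y z w \<in> \<Delta>" using mem_cong_subst[of x' x y' y z' z w' w] v by metis
qed (unfold cong_of_def, intro exI conjI, (rule refl)+)

text \<open>
  The map \<open>v\<close> identifies variables that are equal in the set; the points of the model are its values.
\<close>

lemma truth: "no_forall A
    \<Longrightarrow> sat (range v) bet_of cong_of (\<lambda>n. v (f n)) A \<longleftrightarrow> ren f A \<in> \<Delta>"
proof (induction A arbitrary: f)
  case (Exists A)
  have c: "case_nat (v k) (\<lambda>n. v (f n)) = (\<lambda>n. v (case_nat k f n))" for k
    by (rule ext) (simp split: nat.split)
  have "ren f (Exists A) \<in> \<Delta> \<longleftrightarrow> (\<exists>k. ren (case_nat k f) A \<in> \<Delta>)"
    by (simp add: mem_exists inst_ren_up)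
  then show ?case using Exists by (simp add: c)
qed (simp_all add: v bet_of cong_of mem_bot mem_con mem_dis mem_imp)

lemma truth_universal:
  "no_forall A \<Longrightarrow> ren f ((Forall ^^ n) A) \<in> \<Delta>
      \<Longrightarrow> sat (range v) bet_of cong_of (\<lambda>n. v (f n)) ((Forall ^^ n) A)"
proof (induction n arbitrary: f)
  case 0 then show ?case using truth[of A f] by simp
next
  case (Suc n)
  have c: "case_nat (v k) (\<lambda>n. v (f n)) = (\<lambda>n. v (case_nat k f n))" for k
    by (rule ext) (simp split: nat.split)
  have "ren (case_nat k f) ((Forall ^^ n) A) \<in> \<Delta>" for k
    using mem_forall[of "ren (up f) ((Forall ^^ n) A)" k] Suc.prems by (simp add: inst_ren_up)
  then show ?case using Suc by (simp add: c)
qed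

lemma truth_axiom: "no_forall A \<Longrightarrow> univ_closure n A \<in> \<Delta>
    \<Longrightarrow> sat (range v) bet_of cong_of v (univ_closure n A)"
  using truth_universal[of A "\<lambda>n. n" n] unfolding univ_closure_def by (simp add: ren_id)

end
end

section \<open>Models of the axioms\<close>

lemma sat_T[simp]: "sat D bet cong e (T a b c) \<longleftrightarrow> geometry.bt bet (e a) (e b) (e c)"
  unfolding T_def geometry.bt_def by auto

lemma sat_on_line[simp]: "sat D bet cong e (on_line a b x) \<longleftrightarrow> geometry.onl bet (e a) (e b) (e x)"
  unfolding on_line_def geometry.onl_def by auto

lemma sat_collinear[simp]: "sat D bet cong e (collinear a b c) \<longleftrightarrow>
   (\<exists>x\<in>D. \<exists>y\<in>D. x \<noteq> y \<and> geometry.onl bet x y (e a) \<and> geometry.onl bet x y (e b) \<and> geometry.onl bet x y (e c))"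
  unfolding collinear_def by (simp add: eval_nat_numeral)

lemma sat_seg_le[simp]: "sat D bet cong e (seg_le a b c d) \<longleftrightarrow>
   (\<exists>z\<in>D. geometry.bt bet (e c) z (e d) \<and> cong (e a) (e b) (e c) z)"
  unfolding seg_le_def by simp

lemma no_forall_T[simp]: "no_forall (T a b c)" by (simp add: T_def)
lemma no_forall_on_line[simp]: "no_forall (on_line a b c)" by (simp add: on_line_def)
lemma no_forall_collinear[simp]: "no_forall (collinear a b c)" by (simp add: collinear_def)
lemma no_forall_seg_le[simp]: "no_forall (seg_le a b c d)" by (simp add: seg_le_def)

definition universal :: "fm \<Rightarrow> bool" where
  "universal A \<longleftrightarrow> (\<exists>n B. A = univ_closure n B \<and> no_forall B)"

lemma universal_no_forall: "no_forall B \<Longrightarrow> universal B"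
  unfolding universal_def using exI[of "\<lambda>n. \<exists>C. B = univ_closure n C \<and> no_forall C" 0]
  by (simp add: univ_closure_def)

lemma fv_T: "fv (T a b c) = {a, b, c}" by (auto simp: T_def)
lemma fv_on_line: "fv (on_line a b c) = {a, b, c}" by (auto simp: on_line_def)
lemma fv_collinear: "fv (collinear a b c) = {a, b, c}" by (auto simp: collinear_def fv_on_line)
lemma fv_seg_le: "fv (seg_le a b c d) = {a, b, c, d}" by (auto simp: seg_le_def fv_T)

lemma fv_univ_closure: "fv A \<subseteq> {..<n} \<Longrightarrow> fv (univ_closure n A) = {}"
proof -
  have "fv A \<subseteq> {..<n + m} \<Longrightarrow> fv ((Forall ^^ n) A) \<subseteq> {..<m}" for m
  proof (induction n arbitrary: m)
    case (Suc n)
    then have "fv ((Forall ^^ n) A) \<subseteq> {..<Suc m}" by (intro Suc.IH) simp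
    then show ?case by auto
  qed simp
  from this[of 0] show "fv A \<subseteq> {..<n} \<Longrightarrow> fv (univ_closure n A) = {}"
      unfolding univ_closure_def by simp
qed

definition universal_sentence :: "fm \<Rightarrow> bool" where
  "universal_sentence A \<longleftrightarrow> universal A \<and> fv A = {}"

lemma universal_sentenceI: "no_forall B \<Longrightarrow> fv B \<subseteq> {..<n}
    \<Longrightarrow> universal_sentence (univ_closure n B)"
  unfolding universal_sentence_def universal_def using fv_univ_closure by blast

lemma universal_sentenceI0: "no_forall B \<Longrightarrow> fv B = {} \<Longrightarrow> universal_sentence B"
  unfolding universal_sentence_def using universal_no_forall by blast

lemma universal_sentence_axioms: "A \<in> insert euclid5 neutral_geometry
    \<Longrightarrow> universal_sentence A"
proof -
  note defs = extension_def five_segment_def inner_pasch_def upper_dim_def line_circle_def circle_circle_def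
  note fvs = fv_T fv_on_line fv_collinear fv_seg_le
  have lower: "universal_sentence (Exists (Exists (Exists (\<^bold>\<not> collinear 2 1 0))))"
    by (rule universal_sentenceI0) (auto simp: fvs)
  have "\<forall>A\<in>stability_axioms. universal_sentence A" unfolding stability_axioms_def
      by (auto intro!: universal_sentenceI simp: defs fvs)
  moreover have "\<forall>A\<in>congruence_axioms. universal_sentence A"
    unfolding congruence_axioms_def by (auto intro!: universal_sentenceI simp: defs fvs)
  moreover have "\<forall>A\<in>betweenness_axioms. universal_sentence A"
    unfolding betweenness_axioms_def by (auto intro!: universal_sentenceI simp: defs fvs)
  moreover have "\<forall>A\<in>dimension_axioms. universal_sentence A"

    unfolding dimension_axioms_def
    using universal_sentenceI[of "upper_dim 4 3 2 1 0" 5] lower by (auto simp: defs fvs)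
  moreover have "\<forall>A\<in>continuity_axioms. universal_sentence A"
    unfolding continuity_axioms_def by (auto intro!: universal_sentenceI simp: defs fvs)
  moreover have "universal_sentence euclid5"
    unfolding euclid5_def by (auto intro!: universal_sentenceI simp: fvs)
  ultimately show "A \<in> insert euclid5 neutral_geometry \<Longrightarrow> universal_sentence A"
      unfolding neutral_geometry_def by blast
qed

lemma sat_univ_closure: "sat D bet cong e (univ_closure 0 A) = sat D bet cong e A"
  "sat D bet cong e (univ_closure (Suc n) A) = (\<forall>d\<in>D. sat D bet cong (case_nat d e) (univ_closure n A))"
  unfolding univ_closure_def by simp_all

lemmas sat_unfold = eval_nat_numeral BitM.simps numeral_One One_nat_def sat_univ_closure sat.simps nat.case sat_T sat_on_line
  sat_collinear sat_seg_le simp_thms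

context
  fixes D :: "'p set" and bet cong e
  assumes model: "\<And>A. A \<in> neutral_geometry \<Longrightarrow> sat D bet cong e A"
begin

abbreviation "bt' \<equiv> geometry.bt bet"
abbreviation "onl' \<equiv> geometry.onl bet"

lemma model_cong_rev: "\<forall>a\<in>D. \<forall>b\<in>D. cong a b b a"
proof -
  have "sat D bet cong e (univ_closure 2 (Cong 1 0 0 1))"
    by (rule model) (simp add: neutral_geometry_def congruence_axioms_def)
  then show ?thesis by (simp only:  sat_unfold)
qed

lemma model_cong_inner: "\<forall>a\<in>D. \<forall>b\<in>D. \<forall>p\<in>D. \<forall>q\<in>D. \<forall>r\<in>D. \<forall>s\<in>D. cong a b p q \<and> cong a b r s \<longrightarrow> cong p q r s"
proof -
  have "sat D bet cong e (univ_closure 6 (Cong 5 4 3 2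
      \<^bold>\<and> Cong 5 4 1 0 \<^bold>\<longrightarrow> Cong 3 2 1 0))"
    by (rule model) (simp add: neutral_geometry_def congruence_axioms_def)
  then show ?thesis by (simp only:  sat_unfold)
qed

lemma model_cong_null: "\<forall>a\<in>D. \<forall>b\<in>D. \<forall>c\<in>D. cong a b c c
    \<longrightarrow> a = b"
proof -
  have "sat D bet cong e (univ_closure 3 (Cong 2 1 0 0 \<^bold>\<longrightarrow> 2 \<^bold>= 1))"
    by (rule model) (simp add: neutral_geometry_def congruence_axioms_def)
  then show ?thesis by (simp only:  sat_unfold)
qed

lemma model_extend: "\<forall>a\<in>D. \<forall>b\<in>D. \<forall>c\<in>D. \<forall>d\<in>D. a \<noteq> b
    \<longrightarrow> (\<exists>x\<in>D. bt' a b x \<and> cong b x c d)"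
proof -
  have "sat D bet cong e (univ_closure 4 (extension 3 2 1 0))"
    by (rule model) (simp add: neutral_geometry_def congruence_axioms_def)
  then show ?thesis by (simp only: extension_def sat_unfold)
qed

lemma model_five_seg: "\<forall>a\<in>D. \<forall>b\<in>D. \<forall>c\<in>D. \<forall>d\<in>D. \<forall>a'\<in>D. \<forall>b'\<in>D. \<forall>c'\<in>D. \<forall>d'\<in>D. a \<noteq> b \<and> bt' a b c \<and> bt' a' b' c' \<and> cong a b a' b' \<and> cong b c b' c' \<and> cong a d a' d' \<and> cong b d b' d' \<longrightarrow> cong c d c' d'"
proof -
  have "sat D bet cong e (univ_closure 8 (five_segment 7 6 5 4 3 2 1 0))"
    by (rule model) (simp add: neutral_geometry_def congruence_axioms_def)
  then show ?thesis by (simp only: five_segment_def sat_unfold)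
qed

lemma model_bet_sym: "\<forall>a\<in>D. \<forall>b\<in>D. \<forall>c\<in>D. bet a b c
    \<longrightarrow> bet c b a \<and> a \<noteq> b \<and> b \<noteq> c"
proof -
  have "sat D bet cong e (univ_closure 3 (Bet 2 1 0 \<^bold>\<longrightarrow> Bet 0 1 2
      \<^bold>\<and> 2 \<^bold>\<noteq> 1 \<^bold>\<and> 1 \<^bold>\<noteq> 0))"
    by (rule model) (simp add: neutral_geometry_def betweenness_axioms_def)
  then show ?thesis by (simp only:  sat_unfold)
qed

lemma model_bet_irrefl: "\<forall>a\<in>D. \<forall>b\<in>D. \<not> bet a b a"
proof -
  have "sat D bet cong e (univ_closure 2 (\<^bold>\<not> Bet 1 0 1))"
    by (rule model) (simp add: neutral_geometry_def betweenness_axioms_def)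
  then show ?thesis by (simp only:  sat_unfold)
qed

lemma model_bt_inner: "\<forall>a\<in>D. \<forall>b\<in>D. \<forall>c\<in>D. \<forall>d\<in>D. bt' a b d
    \<and> bt' b c d \<longrightarrow> bt' a b c \<and> bt' a c d"
proof -
  have "sat D bet cong e (univ_closure 4 (T 3 2 0 \<^bold>\<and> T 2 1 0 \<^bold>\<longrightarrow> T 3 2 1
      \<^bold>\<and> T 3 1 0))"
    by (rule model) (simp add: neutral_geometry_def betweenness_axioms_def)
  then show ?thesis by (simp only:  sat_unfold)
qed

lemma model_bt_outer: "\<forall>a\<in>D. \<forall>b\<in>D. \<forall>c\<in>D. \<forall>d\<in>D. bt' a b c
    \<and> bt' b c d \<and> b \<noteq> c \<longrightarrow> bt' a c d \<and> bt' a b d"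
proof -
  have "sat D bet cong e (univ_closure 4 (T 3 2 1 \<^bold>\<and> T 2 1 0
      \<^bold>\<and> 2 \<^bold>\<noteq> 1 \<^bold>\<longrightarrow> T 3 1 0 \<^bold>\<and> T 3 2 0))"
    by (rule model) (simp add: neutral_geometry_def betweenness_axioms_def)
  then show ?thesis by (simp only:  sat_unfold)
qed

lemma model_bet_conn: "\<forall>a\<in>D. \<forall>b\<in>D. \<forall>c\<in>D. \<forall>d\<in>D. bet a b c
    \<and> bet a b d \<and> \<not> bt' a c d \<longrightarrow> bt' a d c"
proof -
  have "sat D bet cong e (univ_closure 4 (Bet 3 2 1 \<^bold>\<and> Bet 3 2 0
      \<^bold>\<and> \<^bold>\<not> T 3 1 0 \<^bold>\<longrightarrow> T 3 0 1))"
    by (rule model) (simp add: neutral_geometry_def betweenness_axioms_def)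
  then show ?thesis by (simp only:  sat_unfold)
qed

lemma model_pasch: "\<forall>a\<in>D. \<forall>b\<in>D. \<forall>c\<in>D. \<forall>p\<in>D. \<forall>q\<in>D. \<not> (\<exists>x\<in>D. \<exists>y\<in>D. x \<noteq> y \<and> onl' x y a \<and> onl' x y b \<and> onl' x y c) \<and> bet a p c \<and> bet b q c \<longrightarrow> (\<exists>x\<in>D. bet p x b \<and> bet q x a)"
proof -
  have "sat D bet cong e (univ_closure 5 (inner_pasch 4 3 2 1 0))"
    by (rule model) (simp add: neutral_geometry_def betweenness_axioms_def)
  then show ?thesis by (simp only: inner_pasch_def sat_unfold)
qed

lemma model_upper_dim: "\<forall>p\<in>D. \<forall>q\<in>D. \<forall>a\<in>D. \<forall>b\<in>D. \<forall>c\<in>D. p \<noteq> q \<and> cong a p a q \<and> cong b p b q \<and> cong c p c q \<longrightarrow> (\<exists>x\<in>D. \<exists>y\<in>D. x \<noteq> y \<and> onl' x y a \<and> onl' x y b \<and> onl' x y c)"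
proof -
  have "sat D bet cong e (univ_closure 5 (upper_dim 4 3 2 1 0))"
    by (rule model) (simp add: neutral_geometry_def dimension_axioms_def)
  then show ?thesis by (simp only: upper_dim_def sat_unfold)
qed

lemma model_line_circle: "\<forall>a\<in>D. \<forall>b\<in>D. \<forall>c\<in>D. \<forall>u\<in>D. \<forall>v\<in>D. a \<noteq> b \<and> (\<exists>z\<in>D. bt' u z v \<and> cong c a u z) \<and> (\<exists>z\<in>D. bt' c z b \<and> cong u v c z) \<longrightarrow> (\<exists>x\<in>D. cong c x u v \<and> bt' a x b)"
proof -
  have "sat D bet cong e (univ_closure 5 (line_circle 4 3 2 1 0))"
    by (rule model) (simp add: neutral_geometry_def continuity_axioms_def)
  then show ?thesis by (simp only: line_circle_def sat_unfold)
qed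

lemma model_circle_circle: "\<forall>c\<in>D. \<forall>u\<in>D. \<forall>v\<in>D. \<forall>d\<in>D. \<forall>w\<in>D. \<forall>z\<in>D. \<forall>i\<in>D. \<forall>x\<in>D. c \<noteq> d \<and> cong c i u v \<and> (\<exists>y\<in>D. bt' w y z \<and> cong d i w y) \<and> cong c x u v \<and> (\<exists>y\<in>D. bt' d y x \<and> cong w z d y) \<longrightarrow> (\<exists>y\<in>D. cong c y u v \<and> cong d y w z)"
proof -
  have "sat D bet cong e (univ_closure 8 (circle_circle 7 6 5 4 3 2 1 0))"
    by (rule model) (simp add: neutral_geometry_def continuity_axioms_def)
  then show ?thesis by (simp only: circle_circle_def sat_unfold)
qed

end

text \<open>
  Models whose points are the natural numbers require an infinite domain.  The relation \<open>bet a c d\<close> between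
  \<open>c\<close> and \<open>d\<close> is a strict order, and by the extension axiom it has no maximal element other than \<open>a\<close>.
\<close>

lemma infinite_domain:
  assumes "\<And>A. A \<in> neutral_geometry \<Longrightarrow> sat D bet cong e A"
      and two: "a \<in> D" "b \<in> D" "a \<noteq> b"
  shows "infinite D"
proof
  assume fin: "finite D"
  let ?bt = "geometry.bt bet"
  note ext = model_extend[OF assms(1), rule_format]
    and rev = model_cong_rev[OF assms(1), rule_format]
    and inner = model_cong_inner[OF assms(1), rule_format]
    and null = model_cong_null[OF assms(1), rule_format]
    and bsym = model_bet_sym[OF assms(1), rule_format]
    and birr = model_bet_irrefl[OF assms(1), rule_format]
    and btr = model_bt_inner[OF assms(1), rule_format]
  have btI: "bet p q r \<Longrightarrow> ?bt p q r" for p q r by (simp add: geometry.bt_def)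
  define R where "R = {(c, d) \<in> D \<times> D. bet a c d}"
  have "trans R"
  proof (rule transI)
    fix c d f assume "(c, d) \<in> R" "(d, f) \<in> R"
    then have h: "c \<in> D" "d \<in> D" "f \<in> D" "bet a c d" "bet a d f" by (auto simp: R_def)
    have h': "bet d c a" "bet f d a" "a \<noteq> c" "c \<noteq> d" "d \<noteq> f" using bsym two h by blast+
    have 1: "?bt f d c \<and> ?bt f c a" using btr[of f d c a] h h' btI two by blast
    have "f \<noteq> c"
    proof
      assume "f = c"
      then have "?bt c d a" using h' btI by blast
      then have "?bt c d c" using btr[of c d c a] h h' btI two by blast
      then show False using birr h h' by (auto simp: geometry.bt_def)
    qed
    then have "bet f c a" using 1 h' by (auto simp: geometry.bt_def)
    then have "bet a c f" using bsym h two by blast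
    then show "(c, f) \<in> R" using h by (simp add: R_def)
  qed
  moreover have "irrefl R"
    using bsym two by (auto simp: irrefl_def R_def)
  ultimately have "acyclic R" by (simp add: acyclic_irrefl)
  moreover have "finite R" unfolding R_def using fin by (auto intro: finite_subset[of _ "D \<times> D"])
  ultimately have "wf (R\<inverse>)" using finite_acyclic_wf_converse by blast
  moreover have "b \<in> D - {a}" using two by blast
  ultimately obtain c where c: "c \<in> D - {a}"
      and max: "\<And>d. (d, c) \<in> R\<inverse> \<Longrightarrow> d \<notin> D - {a}"
    using wfE_min by metis
  obtain d where d: "d \<in> D" "?bt a c d" "cong c d a b" using ext[of a c a b] c two by auto
  have "c \<noteq> d"
  proof
    assume "c = d"
    then have "cong a b c c" using inner[of c c a b c c] rev[of c c] d c two by blast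
    then show False using null two c by blast
  qed
  then have "bet a c d" using d(2) c by (auto simp: geometry.bt_def)
  then have "(c, d) \<in> R" "d \<noteq> a" using c d birr two by (auto simp: R_def)
  then show False using max d(1) by blast
qed

text \<open>
  The quotient of the variables by provable equality, represented by least elements, is infinite, and its
  enumeration makes the natural numbers the domain.  So equality is interpreted by identity on a type, and the
  model is a model of the locale.
\<close>

lemma model_exists:
  assumes sub: "insert euclid5 neutral_geometry \<subseteq> \<Gamma>"
      and univ: "\<And>A. A \<in> \<Gamma> \<Longrightarrow> universal A"
    and fin: "finite (fvs \<Gamma>)" and two: "(i \<^bold>\<noteq> j) \<in> \<Gamma>"
        and cons: "\<not> (\<Gamma> \<turnstile> \<^bold>\<bottom>)"
  shows "\<exists>bet cong (e :: nat \<Rightarrow> nat). \<forall>A\<in>\<Gamma>. sat UNIV bet cong e A"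
proof -
  obtain \<Delta> where \<Delta>: "\<Gamma> \<subseteq> \<Delta>" "saturated \<Delta>"
      using saturated_extension fin cons by blast
  define rep where "rep x = (LEAST y. (x \<^bold>= y) \<in> \<Delta>)" for x
  note eqs = mem_eq_refl[OF \<Delta>(2)] mem_eq_sym[OF \<Delta>(2)] mem_eq_trans[OF \<Delta>(2)]
  have r1: "(x \<^bold>= rep x) \<in> \<Delta>" for x unfolding rep_def using eqs(1) by (rule LeastI)
  have r: "rep x = rep y \<longleftrightarrow> (x \<^bold>= y) \<in> \<Delta>" for x y
  proof
    assume "rep x = rep y" then show "(x \<^bold>= y) \<in> \<Delta>" using r1 eqs by metis
  next
    assume "(x \<^bold>= y) \<in> \<Delta>"
    then have "(x \<^bold>= z) \<in> \<Delta> \<longleftrightarrow> (y \<^bold>= z) \<in> \<Delta>" for z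
        using eqs by metis
    then show "rep x = rep y" unfolding rep_def by simp
  qed
  have truth: "sat (range v) (bet_of \<Delta> v) (cong_of \<Delta> v) v A" if mA: "A \<in> \<Gamma>"
      and mv: "\<And>x y. v x = v y \<longleftrightarrow> (x \<^bold>= y) \<in> \<Delta>" for A v
  proof -
    obtain n B where B: "A = univ_closure n B" "no_forall B" using univ[OF mA] unfolding universal_def by blast
    show ?thesis using truth_axiom[OF \<Delta>(2) mv B(2), of n] \<Delta>(1) mA B(1) by blast
  qed
  have ne: "rep i \<noteq> rep j" using truth[OF two r] by simp
  have sm: "sat (range rep) (bet_of \<Delta> rep) (cong_of \<Delta> rep) rep A"
      if "A \<in> neutral_geometry" for A
    using truth[OF _ r] that sub by blast
  have inf: "infinite (range rep)" by (rule infinite_domain[OF sm rangeI rangeI ne])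
  then have bij: "bij_betw (enumerate (range rep)) UNIV (range rep)" by (rule bij_enumerate)
  define v where "v x = the_inv (enumerate (range rep)) (rep x)" for x
  have inj: "inj (enumerate (range rep))" using bij by (rule bij_betw_imp_inj_on)
  have rg: "rep x \<in> range (enumerate (range rep))" for x using bij by (simp add: bij_betw_def)
  have ev: "enumerate (range rep) (v x) = rep x" for x
    unfolding v_def using f_the_inv_into_f[OF inj rg] .
  have vv: "v x = v y \<longleftrightarrow> (x \<^bold>= y) \<in> \<Delta>" for x y using ev r inj
      by (metis injD)
  have "range v = UNIV"
  proof -
    have "n \<in> range v" for n
    proof -
      have "enumerate (range rep) n \<in> range rep" using bij by (auto simp: bij_betw_def)
      then obtain x where "rep x = enumerate (range rep) n" by (metis rangeE)
      then have "v x = n" using ev inj by (metis injD)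
      then show ?thesis by blast
    qed
    then show ?thesis by blast
  qed
  then show ?thesis using truth[OF _ vv] by metis
qed

lemma model_plane:
  fixes bet :: "'p \<Rightarrow> 'p \<Rightarrow> 'p \<Rightarrow> bool"
  assumes model: "\<And>A. A \<in> insert euclid5 neutral_geometry \<Longrightarrow> sat UNIV bet cong e A"
    and two: "(a::'p) \<noteq> b"
  shows "euclidean_plane bet cong"
proof -
  have m: "\<And>A. A \<in> neutral_geometry \<Longrightarrow> sat UNIV bet cong e A" using model by blast
  have e5: "sat UNIV bet cong e euclid5" using model by blast
  interpret g: geometry bet cong .
  have e5': "\<forall>p\<in>UNIV. \<forall>q\<in>UNIV. \<forall>r\<in>UNIV. \<forall>s\<in>UNIV. \<forall>t\<in>UNIV. \<forall>a\<in>UNIV. bet q a r \<and> bet p t q \<and> bet s t r \<and> cong p t q t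
      \<and> cong r t s t \<and> p \<noteq> r \<and> \<not> g.onl s q p
      \<longrightarrow> (\<exists>x\<in>UNIV. g.onl s q x \<and> g.onl p a x \<and> bet p a x \<and> bet s q x)"
    using e5 by (simp only: euclid5_def sat_unfold)
  show ?thesis
  proof (rule euclidean_plane.intro, goal_cases)
    case 1 show ?case using model_cong_rev[OF m, simplified] by meson
  next
    case 2 then show ?case using model_cong_inner[OF m, simplified] by meson
  next
    case 3 then show ?case using model_cong_null[OF m, simplified] by meson
  next
    case 4 then show ?case using model_extend[OF m, simplified] by meson
  next
    case 5 then show ?case using model_five_seg[OF m, simplified] by meson
  next
    case 6 then show ?case using model_bet_sym[OF m, simplified] by meson
  next
    case 7 then show ?case using model_bet_sym[OF m, simplified] by blast
  next
    case 8 show ?case using model_bet_irrefl[OF m, simplified] by meson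
  next
    case 9 then show ?case using model_bt_inner[OF m, simplified] by meson
  next
    case 10 then show ?case using model_bt_outer[OF m, simplified] by meson
  next
    case 11 then show ?case using model_bet_conn[OF m, simplified] by meson
  next
    case 12 then show ?case using model_pasch[OF m, simplified] by meson
  next
    case 13 show ?case using two by blast
  next
    case 14 then show ?case using model_upper_dim[OF m, simplified] by meson
  next
    case 15 then show ?case using model_line_circle[OF m, simplified] unfolding g.le_def by meson
  next
    case 16 then show ?case using model_circle_circle[OF m, simplified] unfolding g.le_def by meson
  next
    case 17 then show ?case using e5'[simplified] by meson
  qed
qed

section \<open>From classical truth to intuitionistic derivability\<close>

definition E5 :: "fm set" where "E5 = insert euclid5 neutral_geometry"

text \<open>
  The inequality excludes the model with a single point.
\<close>

definition admissible :: "fm set \<Rightarrow> bool" where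
  "admissible H \<longleftrightarrow> finite H \<and> (\<forall>B\<in>H. no_forall B)
      \<and> (\<exists>i j. (i \<^bold>\<noteq> j) \<in> H)"

lemma admissible_finite: "admissible H \<Longrightarrow> finite H" unfolding admissible_def by (rule conjunct1)

definition models :: "(nat \<Rightarrow> nat \<Rightarrow> nat \<Rightarrow> bool) \<Rightarrow> (nat \<Rightarrow> nat \<Rightarrow> nat \<Rightarrow> nat \<Rightarrow> bool) \<Rightarrow> (nat \<Rightarrow> nat)
    \<Rightarrow> fm set \<Rightarrow> bool" where
  "models bet cong e H \<longleftrightarrow> euclidean_plane bet cong
      \<and> (\<forall>B\<in>H. sat UNIV bet cong e B)"

lemma models_insert[simp]: "models bet cong e (insert A H) \<longleftrightarrow> sat UNIV bet cong e A
    \<and> models bet cong e H"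
  unfolding models_def by auto

lemma models_plane: "models bet cong e H \<Longrightarrow> euclidean_plane bet cong"
  unfolding models_def by blast

lemma admissible_insert: "admissible H \<Longrightarrow> no_forall A \<Longrightarrow> admissible (insert A H)"
  unfolding admissible_def by auto

lemma fvs_finite: "finite H \<Longrightarrow> finite (fvs (E5 \<union> H))"
proof -
  assume "finite H"
  then have "finite (fvs H)" by (simp add: fvs_def finite_fv)
  moreover have "fvs E5 = {}" using universal_sentence_axioms
    unfolding E5_def fvs_def universal_sentence_def by auto
  ultimately show ?thesis by (simp add: fvs_def)
qed

text \<open>
  If the double negation were not derivable, the negation of \<open>A\<close> would be consistent with the assumptions and
  would have a classical model.
\<close>

lemma double_negation:
  assumes H: "admissible H" and A: "no_forall A"
    and e: "\<And>bet cong e. models bet cong e H \<Longrightarrow> sat UNIV bet cong e A"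
  shows "E5 \<union> H \<turnstile> \<^bold>\<not> \<^bold>\<not> A"
proof (rule ccontr)
  assume n: "\<not> ?thesis"
  let ?G = "E5 \<union> insert (\<^bold>\<not> A) H"
  obtain i j where ij: "(i \<^bold>\<noteq> j) \<in> H" using H unfolding admissible_def by blast
  have "\<not> (?G \<turnstile> \<^bold>\<bottom>)" using n ImpI by (metis Un_insert_right)
  moreover have "universal B" if "B \<in> ?G" for B
  proof (cases "B \<in> E5")
    case True
    then show ?thesis using universal_sentence_axioms unfolding E5_def universal_sentence_def by blast
  next
    case False
    then have "no_forall B" using that H A unfolding admissible_def by auto
    then show ?thesis by (rule universal_no_forall)
  qed
  moreover have "finite (fvs ?G)" using H unfolding admissible_def by (intro fvs_finite) simp
  moreover have "insert euclid5 neutral_geometry \<subseteq> ?G" unfolding E5_def by blast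
  moreover have "(i \<^bold>\<noteq> j) \<in> ?G" using ij by blast
  ultimately obtain bet cong
      and v :: "nat \<Rightarrow> nat" where m: "\<forall>B\<in>?G. sat UNIV bet cong v B"
    using model_exists[of ?G i j] by blast
  have "sat UNIV bet cong v (i \<^bold>\<noteq> j)" using m ij by blast
  then have "v i \<noteq> v j" by simp
  then have "euclidean_plane bet cong"
    using model_plane[of bet cong v "v i" "v j"] m unfolding E5_def by blast
  then have "sat UNIV bet cong v A" using e m unfolding models_def by blast
  moreover have "sat UNIV bet cong v (\<^bold>\<not> A)" using m by blast
  ultimately show False by simp
qed

text \<open>
  A sufficient syntactic condition for double negation elimination over the stability axioms.
\<close>

primrec stable :: "fm \<Rightarrow> bool" where
  "stable (x \<^bold>= y) = True"
| "stable (Bet x y z) = True"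
| "stable (Cong x y z w) = True"
| "stable \<^bold>\<bottom> = True"
| "stable (A \<^bold>\<and> B) = (stable A \<and> stable B)"
| "stable (A \<^bold>\<or> B) = False"
| "stable (A \<^bold>\<longrightarrow> B) = stable B"
| "stable (Forall A) = False"
| "stable (Exists A) = False"

lemma stable_T[simp]: "stable (T a b c)" by (simp add: T_def)
lemma stable_on_line[simp]: "stable (on_line a b c)" by (simp add: on_line_def)

lemma universal_instance:
  "\<Gamma> \<turnstile> ren g ((Forall ^^ n) A)
      \<Longrightarrow> \<Gamma> \<turnstile> ren (\<lambda>i. if i < n then f i else g (i - n)) A"
proof (induction n arbitrary: g)
  case (Suc n)
  then have "\<Gamma> \<turnstile> Forall (ren (up g) ((Forall ^^ n) A))" by simp
  from ForallE[OF this, of "f n"] have "\<Gamma> \<turnstile> ren (case_nat (f n) g) ((Forall ^^ n) A)"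
    by (simp add: inst_ren_up)
  from Suc.IH[OF this] have "\<Gamma> \<turnstile> ren (\<lambda>i. if i < n then f i else case_nat (f n) g (i - n)) A" .
  moreover have "(\<lambda>i. if i < n then f i else case_nat (f n) g (i - n)) = (\<lambda>i. if i < Suc n then f i else g (i - Suc n))"
  proof
    fix i
    show "(if i < n then f i else case_nat (f n) g (i - n)) = (if i < Suc n then f i else g (i - Suc n))"
    proof (cases i n rule: linorder_cases)
      case greater
      then have "i - n = Suc (i - Suc n)" by simp
      then show ?thesis using greater by simp
    qed simp_all
  qed
  ultimately show ?case by simp
qed simp

lemma axiom_instance: "univ_closure n A \<in> \<Gamma>
    \<Longrightarrow> \<Gamma> \<turnstile> ren (\<lambda>i. if i < n then f i else i - n) A"
  using universal_instance[of \<Gamma> "\<lambda>n. n" n A f] unfolding univ_closure_def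
      by (simp add: ren_id Assm)

lemma dn_mono:
  assumes h: "\<Gamma> \<turnstile> \<^bold>\<not> \<^bold>\<not> A" "insert A \<Gamma> \<turnstile> B"
  shows "\<Gamma> \<turnstile> \<^bold>\<not> \<^bold>\<not> B"
proof -
  have "insert A (insert (\<^bold>\<not> B) \<Gamma>) \<turnstile> \<^bold>\<bottom>"
    by (rule ImpE[of _ B]) (auto intro: Assm deriv_weaken[OF h(2)])
  then have "insert (\<^bold>\<not> B) \<Gamma> \<turnstile> \<^bold>\<not> A" by (rule ImpI)
  moreover have "insert (\<^bold>\<not> B) \<Gamma> \<turnstile> \<^bold>\<not> \<^bold>\<not> A"
      by (rule deriv_weaken[OF h(1)]) blast
  ultimately show ?thesis using ImpI ImpE by blast
qed

lemma stable_dn: "stable A \<Longrightarrow> stability_axioms \<subseteq> \<Gamma>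
    \<Longrightarrow> \<Gamma> \<turnstile> \<^bold>\<not> \<^bold>\<not> A \<Longrightarrow> \<Gamma> \<turnstile> A"
proof (induction A arbitrary: \<Gamma>)
  case (Eq x y)
  have "univ_closure 2 (\<^bold>\<not> \<^bold>\<not> (1 \<^bold>= 0) \<^bold>\<longrightarrow> 1 \<^bold>= 0) \<in> \<Gamma>" using Eq.prems(2) by (auto simp: stability_axioms_def)
  from axiom_instance[OF this, of "(\<lambda>_. 0)(1 := x, 0 := y)"] have "\<Gamma> \<turnstile> \<^bold>\<not> \<^bold>\<not> (x \<^bold>= y) \<^bold>\<longrightarrow> x \<^bold>= y" by simp
  then show ?case using Eq.prems(3) ImpE by blast
next
  case (Bet x y z)
  have "univ_closure 3 (\<^bold>\<not> \<^bold>\<not> Bet 2 1 0 \<^bold>\<longrightarrow> Bet 2 1 0) \<in> \<Gamma>" using Bet.prems(2) by (auto simp: stability_axioms_def)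
  from axiom_instance[OF this, of "(\<lambda>_. 0)(2 := x, 1 := y, 0 := z)"] have "\<Gamma> \<turnstile> \<^bold>\<not> \<^bold>\<not> Bet x y z \<^bold>\<longrightarrow> Bet x y z" by simp
  then show ?case using Bet.prems(3) ImpE by blast
next
  case (Cong x y z w)
  have "univ_closure 4 (\<^bold>\<not> \<^bold>\<not> Cong 3 2 1 0 \<^bold>\<longrightarrow> Cong 3 2 1 0) \<in> \<Gamma>" using Cong.prems(2) by (auto simp: stability_axioms_def)
  from axiom_instance[OF this, of "(\<lambda>_. 0)(3 := x, 2 := y, 1 := z, 0 := w)"]
  have "\<Gamma> \<turnstile> \<^bold>\<not> \<^bold>\<not> Cong x y z w \<^bold>\<longrightarrow> Cong x y z w" by simp
  then show ?case using Cong.prems(3) ImpE by blast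
next
  case Falsum
  have "\<Gamma> \<turnstile> \<^bold>\<not> \<^bold>\<bottom>" by (rule ImpI) (simp add: Assm)
  then show ?case using Falsum.prems(3) ImpE by blast
next
  case (Con A B)
  have "\<Gamma> \<turnstile> \<^bold>\<not> \<^bold>\<not> A"
      by (rule dn_mono[OF Con.prems(3)]) (rule ConE1[of _ A B], simp add: Assm)
  moreover have "\<Gamma> \<turnstile> \<^bold>\<not> \<^bold>\<not> B"
      by (rule dn_mono[OF Con.prems(3)]) (rule ConE2[of _ A B], simp add: Assm)
  ultimately show ?case using Con by (intro ConI) auto
next
  case (Imp A B)
  have "insert (A \<^bold>\<longrightarrow> B) (insert A \<Gamma>) \<turnstile> B"
      by (rule ImpE[of _ A]) (auto intro: Assm)
  moreover have "insert A \<Gamma> \<turnstile> \<^bold>\<not> \<^bold>\<not> (A \<^bold>\<longrightarrow> B)" by (rule deriv_weaken[OF Imp.prems(3)]) blast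
  ultimately have "insert A \<Gamma> \<turnstile> \<^bold>\<not> \<^bold>\<not> B" using dn_mono by blast
  moreover have "stability_axioms \<subseteq> insert A \<Gamma>" "stable B" using Imp.prems by auto
  ultimately have "insert A \<Gamma> \<turnstile> B" using Imp.IH(2) by blast
  then show ?case by (rule ImpI)
qed simp_all

text \<open>
  The bridge between the two logics: for stable formulas, truth in all classical models gives an
  intuitionistic derivation.
\<close>

theorem provable:
  assumes H: "admissible H" and A: "no_forall A" "stable A"
    and e: "\<And>bet cong e. models bet cong e H \<Longrightarrow> sat UNIV bet cong e A"
  shows "E5 \<union> H \<turnstile> A"
proof -
  have "stability_axioms \<subseteq> E5 \<union> H" unfolding E5_def neutral_geometry_def by auto
  then show ?thesis using stable_dn[OF A(2)] double_negation[OF H A(1) e] by blast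
qed

text \<open>
  The premise ranges over all variables \<open>k\<close>, not only over fresh ones.  It is provable in this form since
  the side conditions refer to models in which \<open>k\<close> may denote any point, and it spares all freshness
  conditions below: the proof picks a fresh \<open>k\<close>.
\<close>

lemma ex_step:
  assumes H: "finite H" and e: "E5 \<union> H \<turnstile> Exists A"
      and G: "\<And>k. E5 \<union> insert (inst k A) H \<turnstile> C"
  shows "E5 \<union> H \<turnstile> C"
proof -
  have fin: "finite (fvs (E5 \<union> H) \<union> fv (Exists A) \<union> fv C)"
    by (intro finite_UnI fvs_finite[OF H] finite_fv)
  obtain k where k: "k \<notin> fvs (E5 \<union> H) \<union> fv (Exists A) \<union> fv C"
    using ex_new_if_finite[OF infinite_UNIV_nat fin] by (rule exE)
  have i: "insert (inst k A) (E5 \<union> H) \<turnstile> C" using G[of k] by simp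
  show ?thesis by (rule ex_elim[OF e i]) (use k in \<open>auto simp: fvs_def\<close>)
qed

lemma con_step: "E5 \<union> insert A (insert B H) \<turnstile> C \<Longrightarrow> E5 \<union> insert (A
    \<^bold>\<and> B) H \<turnstile> C"
proof -
  let ?G = "E5 \<union> insert (A \<^bold>\<and> B) H"
  assume h: "E5 \<union> insert A (insert B H) \<turnstile> C"
  have 0: "?G \<turnstile> A \<^bold>\<and> B" by (rule Assm) simp
  have "insert A ?G \<turnstile> B" using ConE2[OF 0] by (rule deriv_weaken) blast
  moreover have "insert B (insert A ?G) \<turnstile> C" by (rule deriv_weaken[OF h]) blast
  ultimately show ?thesis using ConE1[OF 0] deriv_cut by blast
qed

lemma cut_step: "E5 \<union> H \<turnstile> A \<Longrightarrow> E5 \<union> insert A H \<turnstile> C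
    \<Longrightarrow> E5 \<union> H \<turnstile> C"
  using deriv_cut[of "E5 \<union> H" A C] by simp

section \<open>Construction steps\<close>

lemma ren_T[simp]: "ren f (T a b c) = T (f a) (f b) (f c)" by (simp add: T_def)
lemma ren_on_line[simp]: "ren f (on_line a b c) = on_line (f a) (f b) (f c)" by (simp add: on_line_def)
lemma ren_collinear[simp]: "ren f (collinear a b c) = collinear (f a) (f b) (f c)" by (simp add: collinear_def)
lemma ren_seg_le[simp]: "ren f (seg_le a b c d) = seg_le (f a) (f b) (f c) (f d)" by (simp add: seg_le_def)

text \<open>
  Each of the following rules adds one point to the configuration \<open>H\<close>, at the price of a condition on the
  classical models of \<open>H\<close>.
\<close>

lemma extension_step:
  assumes H: "admissible H" and ab: "\<And>bet cong e. models bet cong e H \<Longrightarrow> e a \<noteq> e b"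
    and G: "\<And>x. E5 \<union> insert (T a b x) (insert (Cong b x c d) H) \<turnstile> G"
  shows "E5 \<union> H \<turnstile> G"
proof -
  have ax: "univ_closure 4 (extension 3 2 1 0) \<in> E5 \<union> H"
    by (simp add: E5_def neutral_geometry_def congruence_axioms_def)
  have "E5 \<union> H \<turnstile> extension a b c d"
    using axiom_instance[OF ax, of "(\<lambda>_. 0)(3 := a, 2 := b, 1 := c, 0 := d)"]
        by (simp add: extension_def)
  moreover have "E5 \<union> H \<turnstile> a \<^bold>\<noteq> b" by (rule provable[OF H]) (use ab in auto)
  ultimately have ex: "E5 \<union> H \<turnstile> Exists (T (Suc a) (Suc b) 0
      \<^bold>\<and> Cong (Suc b) 0 (Suc c) (Suc d))"
    unfolding extension_def by (rule ImpE)
  show ?thesis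
  proof (rule ex_step[OF _ ex])
    show "finite H" by (rule admissible_finite[OF H])
    show "E5 \<union> insert (inst x (T (Suc a) (Suc b) 0
        \<^bold>\<and> Cong (Suc b) 0 (Suc c) (Suc d))) H \<turnstile> G" for x
      using con_step[OF G[of x]] by simp
  qed
qed

lemma pasch_step:
  assumes H: "admissible H" and h: "\<And>bet cong e. models bet cong e H \<Longrightarrow>
       \<not> euclidean_plane.col bet (e a) (e b) (e c) \<and> bet (e a) (e p) (e c) \<and> bet (e b) (e q) (e c)"
    and G: "\<And>x. E5 \<union> insert (Bet p x b) (insert (Bet q x a) H) \<turnstile> G"
  shows "E5 \<union> H \<turnstile> G"
proof -
  have ax: "univ_closure 5 (inner_pasch 4 3 2 1 0) \<in> E5 \<union> H"
    by (simp add: E5_def neutral_geometry_def betweenness_axioms_def)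
  have "E5 \<union> H \<turnstile> inner_pasch a b c p q"
    using axiom_instance[OF ax, of "(\<lambda>_. 0)(4 := a, 3 := b, 2 := c, 1 := p, 0 := q)"]
        by (simp add: inner_pasch_def)
  moreover have "E5 \<union> H \<turnstile> \<^bold>\<not> collinear a b c \<^bold>\<and> Bet a p c
      \<^bold>\<and> Bet b q c"
  proof (rule provable[OF H])
    fix bet cong e assume m: "models bet cong e H"
    interpret euclidean_plane bet cong by (rule models_plane[OF m])
    show "sat UNIV bet cong e (\<^bold>\<not> collinear a b c \<^bold>\<and> Bet a p c
        \<^bold>\<and> Bet b q c)"
      using h[OF m] not_collinear[of "e a" "e b" "e c"] by auto
  qed simp_all
  ultimately have ex: "E5 \<union> H \<turnstile> Exists (Bet (Suc p) 0 (Suc b)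
      \<^bold>\<and> Bet (Suc q) 0 (Suc a))"
    unfolding inner_pasch_def by (rule ImpE)
  show ?thesis
  proof (rule ex_step[OF _ ex])
    show "finite H" by (rule admissible_finite[OF H])
    show "E5 \<union> insert (inst x (Bet (Suc p) 0 (Suc b)
        \<^bold>\<and> Bet (Suc q) 0 (Suc a))) H \<turnstile> G" for x
      using con_step[OF G[of x]] by simp
  qed
qed

lemma seg_leI: "E5 \<union> H \<turnstile> T c y d \<^bold>\<and> Cong a b c y
    \<Longrightarrow> E5 \<union> H \<turnstile> seg_le a b c d"
  unfolding seg_le_def by (rule ExistsI[of _ y]) simp

text \<open>
  The comparisons of segments in the axiom are existential, so they are not stable.  Hence their witnesses
  have to be constructed beforehand: \<open>y\<close> shows that \<open>a\<close> is inside the circle and \<open>z\<close> that \<open>b\<close> is outside.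
\<close>

lemma line_circle_step:
  assumes H: "admissible H"
      and h: "\<And>bet cong e. models bet cong e H \<Longrightarrow> e a \<noteq> e b \<and>
      sat UNIV bet cong e (T u y v \<^bold>\<and> Cong c a u y) \<and> sat UNIV bet cong e (T c z b \<^bold>\<and> Cong u v c z)"
    and G: "\<And>x. E5 \<union> insert (Cong c x u v) (insert (T a x b) H) \<turnstile> G"
  shows "E5 \<union> H \<turnstile> G"
proof -
  have ax: "univ_closure 5 (line_circle 4 3 2 1 0) \<in> E5 \<union> H"
    by (simp add: E5_def neutral_geometry_def continuity_axioms_def)
  have lc: "E5 \<union> H \<turnstile> line_circle a b c u v"
    using axiom_instance[OF ax, of "(\<lambda>_. 0)(4 := a, 3 := b, 2 := c, 1 := u, 0 := v)"]
        by (simp add: line_circle_def)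
  have ne: "E5 \<union> H \<turnstile> a \<^bold>\<noteq> b" by (rule provable[OF H]) (use h in auto)
  have inside: "E5 \<union> H \<turnstile> T u y v \<^bold>\<and> Cong c a u y"
      by (rule provable[OF H]) (simp_all only: h, simp_all)
  have outside: "E5 \<union> H \<turnstile> T c z b \<^bold>\<and> Cong u v c z"
      by (rule provable[OF H]) (simp_all only: h, simp_all)
  have ex: "E5 \<union> H \<turnstile> Exists (Cong (Suc c) 0 (Suc u) (Suc v)
      \<^bold>\<and> T (Suc a) 0 (Suc b))"
    using ImpE[OF lc[unfolded line_circle_def] ConI[OF ne ConI[OF seg_leI[OF inside] seg_leI[OF outside]]]] .
  show ?thesis
  proof (rule ex_step[OF _ ex])
    show "finite H" by (rule admissible_finite[OF H])
    show "E5 \<union> insert (inst x (Cong (Suc c) 0 (Suc u) (Suc v)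
        \<^bold>\<and> T (Suc a) 0 (Suc b))) H \<turnstile> G" for x
      using con_step[OF G[of x]] by simp
  qed
qed

text \<open>
  The circles with radius \<open>uv\<close> around \<open>u\<close> and \<open>v\<close> meet: \<open>v\<close> is on the first one and the center of the second
  one, and the mirror image \<open>k\<close> of \<open>v\<close> in \<open>u\<close> is on the first one and outside the second one.
\<close>

lemma equilateral_step:
  assumes H: "admissible H" and uv: "\<And>bet cong e. models bet cong e H \<Longrightarrow> e u \<noteq> e v"
    and G: "\<And>w. E5 \<union> insert (Cong u w u v) (insert (Cong v w u v) H) \<turnstile> G"
  shows "E5 \<union> H \<turnstile> G"
proof (rule extension_step[OF H, of v u u v])
  fix k
  let ?K = "insert (T v u k) (insert (Cong u k u v) H)"
  have K: "admissible ?K" using H by (simp add: admissible_insert)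
  have ax: "univ_closure 8 (circle_circle 7 6 5 4 3 2 1 0) \<in> E5 \<union> ?K"
    by (simp add: E5_def neutral_geometry_def continuity_axioms_def)
  have cc: "E5 \<union> ?K \<turnstile> circle_circle u u v v u v v k"
    using axiom_instance[OF ax, of "(\<lambda>_. 0)(7 := u, 6 := u, 5 := v, 4 := v, 3 := u, 2 := v, 1 := v, 0 := k)"]
    by (simp add: circle_circle_def)
  have triv: "geometry.bt bet (e u) (e u) (e v) \<and> cong (e v) (e v) (e u) (e u)
      \<and> cong (e u) (e v) (e u) (e v)
      \<and> cong (e u) (e v) (e v) (e u)" if m: "models bet cong e ?K" for bet cong e
  proof -
    interpret euclidean_plane bet cong by (rule models_plane[OF m])
    show ?thesis by simp
  qed
  have 1: "E5 \<union> ?K \<turnstile> u \<^bold>\<noteq> v" by (rule provable[OF K]) (use uv in auto)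
  have 2: "E5 \<union> ?K \<turnstile> Cong u v u v" by (rule provable[OF K]) (use triv in auto)
  have 3: "E5 \<union> ?K \<turnstile> T u u v \<^bold>\<and> Cong v v u u"
      by (rule provable[OF K]) (use triv in auto)
  have 4: "E5 \<union> ?K \<turnstile> Cong u k u v" by (rule Assm) simp
  have 5: "E5 \<union> ?K \<turnstile> T v u k \<^bold>\<and> Cong u v v u"
      by (rule provable[OF K]) (use triv in auto)
  have ex: "E5 \<union> ?K \<turnstile> Exists (Cong (Suc u) 0 (Suc u) (Suc v)
      \<^bold>\<and> Cong (Suc v) 0 (Suc u) (Suc v))"
    using ImpE[OF cc[unfolded circle_circle_def] ConI[OF 1 ConI[OF 2 ConI[OF seg_leI[OF 3] ConI[OF 4 seg_leI[OF 5]]]]]] .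
  show "E5 \<union> ?K \<turnstile> G"
  proof (rule ex_step[OF _ ex])
    show "finite ?K" by (rule admissible_finite[OF K])
    have "E5 \<union> insert (Cong u w u v) (insert (Cong v w u v) ?K) \<turnstile> G" for w
      by (rule deriv_weaken[OF G[of w]]) blast
    then show "E5 \<union> insert (inst w (Cong (Suc u) 0 (Suc u) (Suc v)
        \<^bold>\<and> Cong (Suc v) 0 (Suc u) (Suc v))) ?K \<turnstile> G" for w
      using con_step[of "Cong u w u v" "Cong v w u v" ?K G] by simp
  qed
qed (use uv in metis)

definition Mid :: "nat \<Rightarrow> nat \<Rightarrow> nat \<Rightarrow> fm" where
  "Mid a m b = (T a m b \<^bold>\<and> Cong a m m b)"

lemma sat_Mid: "sat D bet cong e (Mid a m b) \<longleftrightarrow> euclidean_plane.mid bet cong (e a) (e m) (e b)" if "euclidean_plane bet cong"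
  by (simp add: Mid_def euclidean_plane.mid_def[OF that])

lemma Mid_props[simp]: "no_forall (Mid a m b)" "stable (Mid a m b)" "ren f (Mid a m b) = Mid (f a) (f m) (f b)"
  by (simp_all add: Mid_def)

lemma midpoint_step:
  assumes H: "admissible H" and uv: "\<And>bet cong e. models bet cong e H \<Longrightarrow> e u \<noteq> e v"
    and G: "\<And>m. E5 \<union> insert (Mid u m v) H \<turnstile> G"
  shows "E5 \<union> H \<turnstile> G"
proof (rule equilateral_step[OF H uv])
  fix w
  let ?H1 = "insert (Cong u w u v) (insert (Cong v w u v) H)"
  have H1: "admissible ?H1" using H by (simp add: admissible_insert)
  have wu: "e w \<noteq> e u \<and> e w \<noteq> e v" if m: "models bet cong e ?H1" for bet cong e
  proof -
    interpret euclidean_plane bet cong by (rule models_plane[OF m])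
    show ?thesis using m uv[of bet cong e] equilateral_noncol[of "e u" "e v" "e w"] by auto
  qed
  show "E5 \<union> ?H1 \<turnstile> G"
  proof (rule extension_step[OF H1, of w u u v])
    fix u'
    let ?H2 = "insert (T w u u') (insert (Cong u u' u v) ?H1)"
    have H2: "admissible ?H2" using H1 by (simp add: admissible_insert)
    show "E5 \<union> ?H2 \<turnstile> G"
    proof (rule extension_step[OF H2, of w v u v])
      fix v'
      let ?H3 = "insert (T w v v') (insert (Cong v v' u v) ?H2)"
      have H3: "admissible ?H3" using H2 by (simp add: admissible_insert)
      have c: "e u \<noteq> e v" "cong (e u) (e w) (e u) (e v)" "cong (e v) (e w) (e u) (e v)"
        "geometry.bt bet (e w) (e u) (e u')" "cong (e u) (e u') (e u) (e v)"
        "geometry.bt bet (e w) (e v) (e v')" "cong (e v) (e v') (e u) (e v)"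
        if m: "models bet cong e ?H3" for bet cong e
        using m uv[of bet cong e] by simp_all
      show "E5 \<union> ?H3 \<turnstile> G"
      proof (rule pasch_step[OF H3, of u' v' w u v])
        fix i
        let ?H4 = "insert (Bet u i v') (insert (Bet v i u') ?H3)"
        have H4: "admissible ?H4" using H3 by (simp add: admissible_insert)
        show "E5 \<union> ?H4 \<turnstile> G"
        proof (rule pasch_step[OF H4, of u w v' i v])
          fix x
          let ?H5 = "insert (Bet i x w) (insert (Bet v x u) ?H4)"
          have H5: "admissible ?H5" using H4 by (simp add: admissible_insert)
          have "E5 \<union> ?H5 \<turnstile> Mid u x v"
          proof (rule provable[OF H5])
            fix bet cong e assume m: "models bet cong e ?H5"
            then have m3: "models bet cong e ?H3" by simp
            have b: "bet (e u) (e i) (e v')" "bet (e v) (e i) (e u')" "bet (e i) (e x) (e w)"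
                "bet (e v) (e x) (e u)"
              using m by simp_all
            interpret euclidean_plane bet cong by (rule models_plane[OF m])
            have "mid (e u) (e x) (e v)" by (rule midpoint_config(7)[OF c[OF m3] b])
            then show "sat UNIV bet cong e (Mid u x v)"
              using sat_Mid[OF models_plane[OF m]] by blast
          qed simp_all
          moreover have "E5 \<union> insert (Mid u x v) ?H5 \<turnstile> G"
              by (rule deriv_weaken[OF G[of x]]) blast
          ultimately show "E5 \<union> ?H5 \<turnstile> G" by (rule cut_step)
        next
          fix bet cong e assume m: "models bet cong e ?H4"
          then have m3: "models bet cong e ?H3" by simp
          interpret euclidean_plane bet cong by (rule models_plane[OF m])
          have "bet (e w) (e v) (e v')" by (rule bet_sym[OF midpoint_config(4)[OF c[OF m3]]])
          then show "\<not> col (e u) (e w) (e v') \<and> bet (e u) (e i) (e v') \<and> bet (e w) (e v) (e v')"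
            using midpoint_config(6)[OF c[OF m3]] m by simp
        qed
      next
        fix bet cong e assume m3: "models bet cong e ?H3"
        interpret euclidean_plane bet cong by (rule models_plane[OF m3])
        show "\<not> col (e u') (e v') (e w) \<and> bet (e u') (e u) (e w) \<and> bet (e v') (e v) (e w)"
          using midpoint_config(3,4,5)[OF c[OF m3]] by blast
      qed
    next
      fix bet cong e assume "models bet cong e ?H2"
      then have "models bet cong e ?H1" by simp
      then show "e w \<noteq> e v" using wu by blast
    qed
  next
    fix bet cong e assume "models bet cong e ?H1"
    then show "e w \<noteq> e u" using wu by blast
  qed
qed

lemma ray_circle_step:
  assumes H: "admissible H"
      and h: "\<And>bet cong e. models bet cong e H \<Longrightarrow> e g \<noteq> e a
          \<and> geometry.bt bet (e a) (e y1) (e z)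
      \<and> cong (e a) (e y1) (e a) (e x) \<and> e y1 \<noteq> e z"
    and G: "\<And>u. E5 \<union> insert (Cong x u a z) (insert (T g a u) H) \<turnstile> G"
  shows "E5 \<union> H \<turnstile> G"
proof (rule extension_step[OF H, of g a a x])
  fix bet cong e assume "models bet cong e H" then show "e g \<noteq> e a" using h by blast
next
  fix y
  let ?H1 = "insert (T g a y) (insert (Cong a y a x) H)"
  have H1: "admissible ?H1" using H by (simp add: admissible_insert)
  show "E5 \<union> ?H1 \<turnstile> G"
  proof (rule extension_step[OF H1, of g y a z])
    fix bet cong e assume m: "models bet cong e ?H1"
    interpret euclidean_plane bet cong by (rule models_plane[OF m])
    have "bt (e g) (e a) (e y)" "e g \<noteq> e a" using m h[of bet cong e] by simp_all
    then show "e g \<noteq> e y" using bt_id[of "e g" "e a"] by auto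
  next
    fix u0
    let ?H2 = "insert (T g y u0) (insert (Cong y u0 a z) ?H1)"
    have H2: "admissible ?H2" using H1 by (simp add: admissible_insert)
    have c: "e g \<noteq> e a" "geometry.bt bet (e a) (e y1) (e z)" "cong (e a) (e y1) (e a) (e x)"
        "e y1 \<noteq> e z"
      "geometry.bt bet (e g) (e a) (e y)" "cong (e a) (e y) (e a) (e x)"
      "geometry.bt bet (e g) (e y) (e u0)" "cong (e y) (e u0) (e a) (e z)"
      if "models bet cong e ?H2" for bet cong e
      using that h[of bet cong e] by simp_all
    show "E5 \<union> ?H2 \<turnstile> G"
    proof (rule extension_step[OF H2, of u0 x a z])
      fix bet cong e assume m: "models bet cong e ?H2"
      interpret euclidean_plane bet cong by (rule models_plane[OF m])
      show "e u0 \<noteq> e x" by (rule ray_circle(3)[OF c[OF m]])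
    next
      fix k
      let ?H3 = "insert (T u0 x k) (insert (Cong x k a z) ?H2)"
      have H3: "admissible ?H3" using H2 by (simp add: admissible_insert)
      show "E5 \<union> ?H3 \<turnstile> G"
      proof (rule extension_step[OF H3, of k x a z])
        fix bet cong e assume m: "models bet cong e ?H3"
        interpret euclidean_plane bet cong by (rule models_plane[OF m])
        have m2: "models bet cong e ?H2" and k: "bt (e u0) (e x) (e k)" "cong (e x) (e k) (e a) (e z)"
            using m by simp_all
        show "e k \<noteq> e x" by (rule ray_circle(4)[OF c[OF m2] k])
      next
        fix f
        let ?H4 = "insert (T k x f) (insert (Cong x f a z) ?H3)"
        have H4: "admissible ?H4" using H3 by (simp add: admissible_insert)
        show "E5 \<union> ?H4 \<turnstile> G"
        proof (rule line_circle_step[OF H4, of a u0 a y1 z x f])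
          fix bet cong e assume m: "models bet cong e ?H4"
          interpret euclidean_plane bet cong by (rule models_plane[OF m])
          have m2: "models bet cong e ?H2" and k: "bt (e u0) (e x) (e k)" "cong (e x) (e k) (e a) (e z)"
            "bt (e k) (e x) (e f)" "cong (e x) (e f) (e a) (e z)" using m by simp_all
          note c' = c[OF m2]
          have "e a \<noteq> e u0" by (rule ray_circle(2)[OF c'])
          moreover have "bt (e x) (e f) (e u0)" by (rule ray_circle(5)[OF c' k])
          moreover have "cong (e x) (e a) (e a) (e y1)" using cong_l[OF cong_sym[OF c'(3)]] .
          moreover have "cong (e a) (e z) (e x) (e f)" using cong_sym[OF k(4)] .
          ultimately show "e a \<noteq> e u0 \<and> sat UNIV bet cong e (T a y1 z \<^bold>\<and> Cong x a a y1)
             \<and> sat UNIV bet cong e (T x f u0 \<^bold>\<and> Cong a z x f)" using c'(2) by simp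
        next
          fix u
          let ?H5 = "insert (Cong x u a z) (insert (T a u u0) ?H4)"
          have H5: "admissible ?H5" using H4 by (simp add: admissible_insert)
          have "E5 \<union> ?H5 \<turnstile> T g a u"
          proof (rule provable[OF H5])
            fix bet cong e assume m: "models bet cong e ?H5"
            interpret euclidean_plane bet cong by (rule models_plane[OF m])
            have m2: "models bet cong e ?H2" and u: "bt (e a) (e u) (e u0)" using m by simp_all
            have "bt (e g) (e a) (e u)" by (rule ray_circle(6)[OF c[OF m2] u])
            then show "sat UNIV bet cong e (T g a u)" by simp
          qed simp_all
          moreover have "E5 \<union> insert (T g a u) ?H5 \<turnstile> G"
              by (rule deriv_weaken[OF G[of u]]) blast
          ultimately show "E5 \<union> ?H5 \<turnstile> G" by (rule cut_step)
        qed
      qed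
    qed
  qed
qed

text \<open>
  The foot \<open>m\<close> of \<open>x\<close> on the line \<open>ab\<close> is the midpoint of two distinct points of the line that are equidistant
  from \<open>x\<close>.  In contrast to \<open>foot\<close>, this needs no universal quantifier, as required by \<open>no_forall\<close>.
\<close>

definition Foot :: "nat \<Rightarrow> nat \<Rightarrow> nat \<Rightarrow> nat \<Rightarrow> fm" where
  "Foot a b x m = Exists (Exists (on_line (Suc (Suc a)) (Suc (Suc b)) (Suc 0)
      \<^bold>\<and> on_line (Suc (Suc a)) (Suc (Suc b)) 0
     \<^bold>\<and> Suc 0 \<^bold>\<noteq> 0 \<^bold>\<and> Cong (Suc (Suc x)) (Suc 0) (Suc (Suc x)) 0 \<^bold>\<and> Mid (Suc 0) (Suc (Suc m)) 0))"

lemma no_forall_Foot[simp]: "no_forall (Foot a b x m)" by (simp add: Foot_def)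

lemma sat_Foot:
  assumes "euclidean_plane bet cong" "e a \<noteq> e b" "sat UNIV bet cong e (Foot a b x m)"
  shows "euclidean_plane.foot bet cong (e a) (e b) (e x) (e m)"
proof -
  interpret euclidean_plane bet cong by (fact assms(1))
  obtain u v where "onl (e a) (e b) u" "onl (e a) (e b) v" "u \<noteq> v" "cong (e x) u (e x) v" "mid u (e m) v"
    using assms(3) unfolding Foot_def by (auto simp: sat_Mid[OF assms(1)])
  then show ?thesis using foot_mid assms(2) onl_imp_col by blast
qed

text \<open>
  The foot is constructed without knowing whether \<open>x\<close> is on the line: the circle of \<open>foot_config\<close> meets both
  rays from \<open>a\<close> in either case.
\<close>

lemma foot_step:
  assumes H: "admissible H" and ab: "\<And>bet cong e. models bet cong e H \<Longrightarrow> e a \<noteq> e b"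
    and G: "\<And>m. E5 \<union> insert (Foot a b x m) H \<turnstile> G"
  shows "E5 \<union> H \<turnstile> G"
proof (rule extension_step[OF H, of b a a x])
  fix bet cong e assume "models bet cong e H" then show "e b \<noteq> e a" using ab by metis
next
  fix y
  let ?H1 = "insert (T b a y) (insert (Cong a y a x) H)"
  have H1: "admissible ?H1" using H by (simp add: admissible_insert)
  show "E5 \<union> ?H1 \<turnstile> G"
  proof (rule extension_step[OF H1, of b y a b])
    fix bet cong e assume m: "models bet cong e ?H1"
    interpret euclidean_plane bet cong by (rule models_plane[OF m])
    have "bt (e b) (e a) (e y)" "e a \<noteq> e b" using m ab[of bet cong e] by simp_all
    then show "e b \<noteq> e y" using bt_id[of "e b" "e a"] by auto
  next
    fix z
    let ?H2 = "insert (T b y z) (insert (Cong y z a b) ?H1)"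
    have H2: "admissible ?H2" using H1 by (simp add: admissible_insert)
    have c: "e a \<noteq> e b" "geometry.bt bet (e b) (e a) (e y)" "cong (e a) (e y) (e a) (e x)"
      "geometry.bt bet (e b) (e y) (e z)" "cong (e y) (e z) (e a) (e b)"
      if "models bet cong e ?H2" for bet cong e
      using that ab[of bet cong e] by simp_all
    have r: "e a \<noteq> e b \<and> e a \<noteq> e z \<and> geometry.bt bet (e a) (e y) (e z)
      \<and> cong (e a) (e y) (e a) (e x) \<and> e y \<noteq> e z" if m: "models bet cong e ?H2" for bet cong e
    proof -
      interpret euclidean_plane bet cong by (rule models_plane[OF m])
      show ?thesis using foot_config(2,3,4)[OF c[OF m]] c[OF m] by blast
    qed
    show "E5 \<union> ?H2 \<turnstile> G"
    proof (rule ray_circle_step[OF H2, of b a y z x])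
      fix bet cong e assume "models bet cong e ?H2"
      from r[OF this] show "e b \<noteq> e a \<and> geometry.bt bet (e a) (e y) (e z)
          \<and> cong (e a) (e y) (e a) (e x) \<and> e y \<noteq> e z"
        by metis
    next
      fix u
      let ?H3 = "insert (Cong x u a z) (insert (T b a u) ?H2)"
      have H3: "admissible ?H3" using H2 by (simp add: admissible_insert)
      show "E5 \<union> ?H3 \<turnstile> G"
      proof (rule ray_circle_step[OF H3, of z a y z x])
        fix bet cong e assume "models bet cong e ?H3"
        then have "models bet cong e ?H2" by simp
        from r[OF this] show "e z \<noteq> e a \<and> geometry.bt bet (e a) (e y) (e z)
            \<and> cong (e a) (e y) (e a) (e x) \<and> e y \<noteq> e z"
          by metis
      next
        fix v
        let ?H4 = "insert (Cong x v a z) (insert (T z a v) ?H3)"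
        have H4: "admissible ?H4" using H3 by (simp add: admissible_insert)
        have uv: "geometry.onl bet (e a) (e b) (e u) \<and> geometry.onl bet (e a) (e b) (e v)
            \<and> e u \<noteq> e v \<and> cong (e x) (e u) (e x) (e v)"
          if m: "models bet cong e ?H4" for bet cong e
        proof -
          interpret euclidean_plane bet cong by (rule models_plane[OF m])
          have m2: "models bet cong e ?H2" and b: "bt (e b) (e a) (e u)" "cong (e x) (e u) (e a) (e z)"
            "bt (e z) (e a) (e v)" "cong (e x) (e v) (e a) (e z)" using m by simp_all
          show ?thesis using foot_config(5)[OF c[OF m2] b] onl_iff_col[OF c(1)[OF m2]] by blast
        qed
        show "E5 \<union> ?H4 \<turnstile> G"
        proof (rule midpoint_step[OF H4, of u v])
          fix bet cong e assume "models bet cong e ?H4" then show "e u \<noteq> e v" using uv by blast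
        next
          fix k
          let ?H5 = "insert (Mid u k v) ?H4"
          have H5: "admissible ?H5" using H4 by (simp add: admissible_insert)
          have "E5 \<union> ?H5 \<turnstile> on_line a b u \<^bold>\<and> on_line a b v
              \<^bold>\<and> u \<^bold>\<noteq> v \<^bold>\<and> Cong x u x v \<^bold>\<and> Mid u k v"
          proof (rule provable[OF H5])
            fix bet cong e assume m: "models bet cong e ?H5"
            then have "models bet cong e ?H4" by simp
            from uv[OF this] show "sat UNIV bet cong e (on_line a b u \<^bold>\<and> on_line a b v
                \<^bold>\<and> u \<^bold>\<noteq> v \<^bold>\<and> Cong x u x v \<^bold>\<and> Mid u k v)"
              using m by simp
          qed simp_all
          then have "E5 \<union> ?H5 \<turnstile> inst v (on_line (Suc a) (Suc b) (Suc u)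
              \<^bold>\<and> on_line (Suc a) (Suc b) 0
             \<^bold>\<and> Suc u \<^bold>\<noteq> 0 \<^bold>\<and> Cong (Suc x) (Suc u) (Suc x) 0 \<^bold>\<and> Mid (Suc u) (Suc k) 0)" by simp
          from ExistsI[OF this] have "E5 \<union> ?H5 \<turnstile> Foot a b x k"
            unfolding Foot_def by (intro ExistsI[of _ u]) simp
          moreover have "E5 \<union> insert (Foot a b x k) ?H5 \<turnstile> G"
              by (rule deriv_weaken[OF G[of k]]) blast
          ultimately show "E5 \<union> ?H5 \<turnstile> G" by (rule cut_step)
        qed
      qed
    qed
  qed
qed

section \<open>The intersection point\<close>

definition euclid5_matrix :: "nat \<Rightarrow> nat \<Rightarrow> nat \<Rightarrow> nat \<Rightarrow> nat \<Rightarrow> nat \<Rightarrow> fm" where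
  "euclid5_matrix p q r s t a = (Bet q a r \<^bold>\<and> Bet p t q \<^bold>\<and> Bet s t r
      \<^bold>\<and> Cong p t q t \<^bold>\<and> Cong r t s t \<^bold>\<and> p \<^bold>\<noteq> r
       \<^bold>\<and> \<^bold>\<not> on_line s q p \<^bold>\<longrightarrow>
     Exists (on_line (Suc s) (Suc q) 0 \<^bold>\<and> on_line (Suc p) (Suc a) 0
       \<^bold>\<and> Bet (Suc p) (Suc a) 0 \<^bold>\<and> Bet (Suc s) (Suc q) 0))"

lemma euclid5_step:
  assumes H: "admissible H" and h: "\<And>bet cong e. models bet cong e H \<Longrightarrow>
      bet (e q) (e a) (e r) \<and> bet (e p) (e t) (e q) \<and> bet (e s) (e t) (e r) \<and> cong (e p) (e t) (e q) (e t)
      \<and> cong (e r) (e t) (e s) (e t) \<and> e p \<noteq> e r \<and> \<not> geometry.onl bet (e s) (e q) (e p)"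
    and G: "\<And>x. E5 \<union> insert (on_line s q x) (insert (Bet p a x) H) \<turnstile> G"
  shows "E5 \<union> H \<turnstile> G"
proof -
  have ax: "univ_closure 6 (euclid5_matrix 5 4 3 2 1 0) \<in> E5 \<union> H"
    by (simp add: E5_def euclid5_def euclid5_matrix_def)
  have "E5 \<union> H \<turnstile> euclid5_matrix p q r s t a"
    using axiom_instance[OF ax, of "(\<lambda>_. 0)(5 := p, 4 := q, 3 := r, 2 := s, 1 := t, 0 := a)"]
    by (simp add: euclid5_matrix_def)
  moreover have "E5 \<union> H \<turnstile> Bet q a r \<^bold>\<and> Bet p t q \<^bold>\<and> Bet s t r
      \<^bold>\<and> Cong p t q t \<^bold>\<and> Cong r t s t \<^bold>\<and> p \<^bold>\<noteq> r
       \<^bold>\<and> \<^bold>\<not> on_line s q p"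
    by (rule provable[OF H]) (use h in auto)
  ultimately have ex: "E5 \<union> H \<turnstile> Exists (on_line (Suc s) (Suc q) 0
      \<^bold>\<and> on_line (Suc p) (Suc a) 0
       \<^bold>\<and> Bet (Suc p) (Suc a) 0 \<^bold>\<and> Bet (Suc s) (Suc q) 0)"
    unfolding euclid5_matrix_def by (rule ImpE)
  show ?thesis
  proof (rule ex_step[OF _ ex])
    show "finite H" by (rule admissible_finite[OF H])
    fix x
    let ?A = "on_line s q x \<^bold>\<and> on_line p a x \<^bold>\<and> Bet p a x \<^bold>\<and> Bet s q x"
    let ?K = "E5 \<union> insert ?A H"
    have A: "?K \<turnstile> ?A" by (rule Assm) simp
    have "?K \<turnstile> on_line s q x" by (rule ConE1[OF A])
    moreover have "insert (on_line s q x) ?K \<turnstile> Bet p a x"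
      by (rule deriv_weaken[OF ConE1[OF ConE2[OF ConE2[OF A]]]]) blast
    moreover have "insert (Bet p a x) (insert (on_line s q x) ?K) \<turnstile> G"
      by (rule deriv_weaken[OF G[of x]]) blast
    ultimately have "?K \<turnstile> G" using deriv_cut by blast
    then show "E5 \<union> insert (inst x (on_line (Suc s) (Suc q) 0 \<^bold>\<and> on_line (Suc p) (Suc a) 0
       \<^bold>\<and> Bet (Suc p) (Suc a) 0 \<^bold>\<and> Bet (Suc s) (Suc q) 0)) H \<turnstile> G" by simp
  qed
qed

text \<open>
  Euclid 5 for two parallels and an arbitrary transversal \<open>wy\<close>.  The half-turn about its midpoint \<open>k\<close> carries
  \<open>w'\<close> to a point \<open>s'\<close> of \<open>sq\<close>, by \<open>reflect_on_parallel\<close>, and Euclid 5 applies to \<open>w, y, w', s', k\<close>.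
\<close>

lemma parallel_step:
  assumes H: "admissible H" and h: "\<And>bet cong e. models bet cong e H \<Longrightarrow>
      euclidean_plane.parallelogram bet cong (e p) (e q) (e r) (e s) (e t)
      \<and> euclidean_plane.col bet (e s) (e q) (e y) \<and> euclidean_plane.col bet (e p) (e r) (e w)
      \<and> euclidean_plane.col bet (e p) (e r) (e w') \<and> e w \<noteq> e w' \<and> bet (e y) (e f) (e w')"
    and G: "\<And>x. E5 \<union> insert (on_line s q x) (insert (Bet w f x) H) \<turnstile> G"
  shows "E5 \<union> H \<turnstile> G"
proof (rule midpoint_step[OF H, of w y])
  fix bet cong e assume m: "models bet cong e H"
  interpret euclidean_plane bet cong by (rule models_plane[OF m])
  show "e w \<noteq> e y" using h[OF m] parallelogram_disjoint by metis
next
  fix k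
  let ?H1 = "insert (Mid w k y) H"
  have H1: "admissible ?H1" using H by (simp add: admissible_insert)
  show "E5 \<union> ?H1 \<turnstile> G"
  proof (rule extension_step[OF H1, of w' k w' k])
    fix bet cong e assume m: "models bet cong e ?H1"
    interpret euclidean_plane bet cong by (rule models_plane[OF m])
    have mH: "models bet cong e H" using m by simp
    have k: "mid (e w) (e k) (e y)" using m sat_Mid[OF models_plane[OF m]] by simp
    have pr: "e p \<noteq> e r" using h[OF mH] unfolding parallelogram_def by blast
    show "e w' \<noteq> e k"
    proof
      assume "e w' = e k"
      then have "col (e p) (e r) (e y)" using half_turn_on_line[OF pr _ _ k] h[OF mH] by simp
      then show False using parallelogram_disjoint h[OF mH] by blast
    qed
  next
    fix s'
    let ?H2 = "insert (T w' k s') (insert (Cong k s' w' k) ?H1)"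
    have H2: "admissible ?H2" using H1 by (simp add: admissible_insert)
    have c: "bet (e w) (e k) (e y) \<and> bet (e s') (e k) (e w')
        \<and> \<not> euclidean_plane.col bet (e s') (e y) (e w)
        \<and> (\<forall>x. euclidean_plane.col bet (e s') (e y) x \<longrightarrow> euclidean_plane.col bet (e s) (e q) x)
        \<and> cong (e w) (e k) (e y) (e k) \<and> cong (e w') (e k) (e s') (e k) \<and> e s \<noteq> e q"
      if m: "models bet cong e ?H2" for bet cong e
    proof -
      interpret euclidean_plane bet cong by (rule models_plane[OF m])
      have mH: "models bet cong e H" using m by simp
      have k: "mid (e w) (e k) (e y)" using m sat_Mid[OF models_plane[OF m]] by simp
      have s: "mid (e w') (e k) (e s')" using m cong_sym unfolding mid_def by auto
      have P: "parallelogram (e p) (e q) (e r) (e s) (e t)"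
          and l: "col (e s) (e q) (e y)" "col (e p) (e r) (e w)"
        "col (e p) (e r) (e w')" "e w \<noteq> e w'" using h[OF mH] by blast+
      have "cong (e w) (e k) (e y) (e k)" "cong (e w') (e k) (e s') (e k)"
        using k s cong_r unfolding mid_def by blast+
      then show ?thesis using on_parallel_line[OF P l k s] parallelogram_neq[OF P] by blast
    qed
    show "E5 \<union> ?H2 \<turnstile> G"
    proof (rule euclid5_step[OF H2, of y f w' w k s'])
      fix bet cong e assume m: "models bet cong e ?H2"
      interpret euclidean_plane bet cong by (rule models_plane[OF m])
      have mH: "models bet cong e H" using m by simp
      have "\<not> onl (e s') (e y) (e w)" using c[OF m] onl_imp_col by blast
      then show "bet (e y) (e f) (e w') \<and> bet (e w) (e k) (e y) \<and> bet (e s') (e k) (e w')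
          \<and> cong (e w) (e k) (e y) (e k)
        \<and> cong (e w') (e k) (e s') (e k) \<and> e w \<noteq> e w' \<and> \<not> onl (e s') (e y) (e w)"
        using c[OF m] h[OF mH] by blast
    next
      fix x
      let ?H3 = "insert (on_line s' y x) (insert (Bet w f x) ?H2)"
      have H3: "admissible ?H3" using H2 by (simp add: admissible_insert)
      have "E5 \<union> ?H3 \<turnstile> on_line s q x"
      proof (rule provable[OF H3])
        fix bet cong e assume m: "models bet cong e ?H3"
        interpret euclidean_plane bet cong by (rule models_plane[OF m])
        have m2: "models bet cong e ?H2" and x: "onl (e s') (e y) (e x)" using m by simp_all
        have "col (e s) (e q) (e x)" using c[OF m2] onl_imp_col[OF x] by blast
        then show "sat UNIV bet cong e (on_line s q x)" using onl_iff_col c[OF m2] by simp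
      qed simp_all
      moreover have "E5 \<union> insert (on_line s q x) ?H3 \<turnstile> G"
          by (rule deriv_weaken[OF G[of x]]) blast
      ultimately show "E5 \<union> ?H3 \<turnstile> G" by (rule cut_step)
    qed
  qed
qed

definition strong_parallel_hypotheses :: "nat \<Rightarrow> nat \<Rightarrow> nat \<Rightarrow> nat \<Rightarrow> nat \<Rightarrow> nat \<Rightarrow> fm" where
  "strong_parallel_hypotheses p q r s t a = (Bet p t q \<^bold>\<and> Bet s t r \<^bold>\<and> Cong p t q t
      \<^bold>\<and> Cong r t s t \<^bold>\<and> p \<^bold>\<noteq> r
       \<^bold>\<and> \<^bold>\<not> on_line s q p \<^bold>\<and> \<^bold>\<not> on_line p r a)"

lemma no_forall_hypotheses[simp]: "no_forall (strong_parallel_hypotheses p q r s t a)"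
  by (simp add: strong_parallel_hypotheses_def)

lemma sat_hypotheses:
  assumes "euclidean_plane bet cong" "sat UNIV bet cong e (strong_parallel_hypotheses p q r s t a)"
  shows "euclidean_plane.parallelogram bet cong (e p) (e q) (e r) (e s) (e t)
      \<and> \<not> euclidean_plane.col bet (e p) (e r) (e a)"
proof -
  interpret euclidean_plane bet cong by (fact assms(1))
  have h: "bet (e p) (e t) (e q)" "bet (e s) (e t) (e r)" "cong (e p) (e t) (e q) (e t)"
      "cong (e r) (e t) (e s) (e t)"
    "e p \<noteq> e r" "\<not> onl (e s) (e q) (e p)" "\<not> onl (e p) (e r) (e a)"
    using assms(2) unfolding strong_parallel_hypotheses_def by simp_all
  have m: "mid (e p) (e t) (e q)" "mid (e r) (e t) (e s)"
    unfolding mid_def using bet_bt[OF h(1)] bt_sym[OF bet_bt[OF h(2)]] cong_r[OF h(3)] cong_r[OF h(4)]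
        by simp_all
  have "e s \<noteq> e q" using m h(5) mid_end2 by metis
  then show ?thesis using m h(5,6,7) onl_iff_col unfolding parallelogram_def by blast
qed

text \<open>
  The construction described at the beginning: the feet \<open>c\<close>, \<open>f\<close>, \<open>m1\<close>, \<open>m2\<close>, the auxiliary point \<open>w\<close> of
  \<open>pr\<close> at distance \<open>p m1 + pr\<close> from \<open>p\<close>, and two steps through \<open>f\<close> from \<open>pr\<close> to \<open>sq\<close>.
\<close>

lemma intersection_constructed:
  fixes p q r s t a :: nat
  defines "G \<equiv> Exists (on_line (Suc s) (Suc q) 0 \<^bold>\<and> on_line (Suc p) (Suc a) 0)"
  shows "insert (strong_parallel_hypotheses p q r s t a) E5 \<turnstile> G"
proof -
  let ?H0 = "insert (p \<^bold>\<noteq> r) (insert (strong_parallel_hypotheses p q r s t a) {})"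
  have H0: "admissible ?H0" unfolding admissible_def by auto
  have P: "euclidean_plane.parallelogram bet cong (e p) (e q) (e r) (e s) (e t)
      \<and> \<not> euclidean_plane.col bet (e p) (e r) (e a)"
    if m: "models bet cong e ?H0" for bet cong e
    using sat_hypotheses[OF models_plane[OF m], of e p q r s t a] m by simp
  have N: "e p \<noteq> e r \<and> e s \<noteq> e q \<and> e p \<noteq> e a" if m: "models bet cong e ?H0"
      for bet cong e
  proof -
    interpret euclidean_plane bet cong by (rule models_plane[OF m])
    show ?thesis using P[OF m] parallelogram_neq parallelogram_def col_triv(3) by metis
  qed
  have "E5 \<union> ?H0 \<turnstile> G"
  proof (rule foot_step[OF H0, of s q p])
    fix bet cong e assume "models bet cong e ?H0" then show "e s \<noteq> e q" using N by blast
  next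
    fix c
    let ?H1 = "insert (Foot s q p c) ?H0"
    have H1: "admissible ?H1" using admissible_insert[OF H0] by simp
    show "E5 \<union> ?H1 \<turnstile> G"
    proof (rule midpoint_step[OF H1, of p c])
      fix bet cong e assume m: "models bet cong e ?H1"
      interpret euclidean_plane bet cong by (rule models_plane[OF m])
      have m0: "models bet cong e ?H0" using m by simp
      have "foot (e s) (e q) (e p) (e c)" using sat_Foot[OF models_plane[OF m]] N[OF m0] m by simp
      then show "e p \<noteq> e c" using P[OF m0] unfolding foot_def parallelogram_def by metis
    next
      fix c0
      let ?H2 = "insert (Mid p c0 c) ?H1"
      have H2: "admissible ?H2" using admissible_insert[OF H1] by simp
      show "E5 \<union> ?H2 \<turnstile> G"
      proof (rule foot_step[OF H2, of p a c0])
        fix bet cong e assume "models bet cong e ?H2"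
        then have "models bet cong e ?H0" by simp
        then show "e p \<noteq> e a" using N by blast
      next
        fix f
        let ?H3 = "insert (Foot p a c0 f) ?H2"
        have H3: "admissible ?H3" using admissible_insert[OF H2] by simp
        show "E5 \<union> ?H3 \<turnstile> G"
        proof (rule foot_step[OF H3, of p r f])
          fix bet cong e assume "models bet cong e ?H3"
          then have "models bet cong e ?H0" by simp
          then show "e p \<noteq> e r" using N by blast
        next
          fix m1
          let ?H4 = "insert (Foot p r f m1) ?H3"
          have H4: "admissible ?H4" using admissible_insert[OF H3] by simp
          show "E5 \<union> ?H4 \<turnstile> G"
          proof (rule foot_step[OF H4, of s q m1])
            fix bet cong e assume "models bet cong e ?H4"
            then have "models bet cong e ?H0" by simp
            then show "e s \<noteq> e q" using N by blast
          next
            fix m2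
            let ?H5 = "insert (Foot s q m1 m2) ?H4"
            have H5: "admissible ?H5" using admissible_insert[OF H4] by simp
            have F: "euclidean_plane.col bet (e p) (e r) (e m1)
                \<and> euclidean_plane.col bet (e s) (e q) (e m2)
               \<and> euclidean_plane.col bet (e p) (e a) (e f) \<and> e f \<noteq> e p \<and> bet (e m2) (e f) (e m1)"
              if m: "models bet cong e ?H5" for bet cong e
            proof -
              interpret euclidean_plane bet cong by (rule models_plane[OF m])
              have m0: "models bet cong e ?H0" using m by simp
              note sF = sat_Foot[OF models_plane[OF m]] and n = N[OF m0] and p = P[OF m0]
              have f: "foot (e s) (e q) (e p) (e c)" "foot (e p) (e a) (e c0) (e f)"
                  "foot (e p) (e r) (e f) (e m1)"
                "foot (e s) (e q) (e m1) (e m2)" using sF n m by simp_all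
              have c0: "mid (e p) (e c0) (e c)" using m sat_Mid[OF models_plane[OF m]] by simp
              have "e f \<noteq> e p" "bet (e m2) (e f) (e m1)"
                using crossing_point_in_strip[OF p[THEN conjunct1] p[THEN conjunct2] f(1) c0 f(2,3,4)] by blast+
              then show ?thesis using f unfolding foot_def by blast
            qed
            show "E5 \<union> ?H5 \<turnstile> G"
            proof (rule extension_step[OF H5, of r p p m1])
              fix bet cong e assume "models bet cong e ?H5"
              then have "models bet cong e ?H0" by simp
              then show "e r \<noteq> e p" using N by metis
            next
              fix x
              let ?H6 = "insert (T r p x) (insert (Cong p x p m1) ?H5)"
              have H6: "admissible ?H6" using admissible_insert[OF admissible_insert[OF H5]] by simp
              show "E5 \<union> ?H6 \<turnstile> G"
              proof (rule extension_step[OF H6, of r x p r])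
                fix bet cong e assume m: "models bet cong e ?H6"
                interpret euclidean_plane bet cong by (rule models_plane[OF m])
                have m0: "models bet cong e ?H0" and b: "bt (e r) (e p) (e x)" using m by simp_all
                show "e r \<noteq> e x" using bt_id[of "e r" "e p"] b N[OF m0] by auto
              next
                fix w
                let ?H7 = "insert (T r x w) (insert (Cong x w p r) ?H6)"
                have H7: "admissible ?H7" using admissible_insert[OF admissible_insert[OF H6]] by simp
                have W: "euclidean_plane.col bet (e p) (e r) (e w) \<and> e w \<noteq> e p
                    \<and> e w \<noteq> e m1"
                  if m: "models bet cong e ?H7" for bet cong e
                proof -
                  interpret euclidean_plane bet cong by (rule models_plane[OF m])
                  have m0: "models bet cong e ?H0" and b: "bt (e r) (e p) (e x)" "cong (e p) (e x) (e p) (e m1)"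
                    "bt (e r) (e x) (e w)" "cong (e x) (e w) (e p) (e r)" using m by simp_all
                  show ?thesis using base_point_off_feet[OF N[OF m0, THEN conjunct1] b] by blast
                qed
                show "E5 \<union> ?H7 \<turnstile> G"
                proof (rule parallel_step[OF H7, of p q r s t m2 w m1 f])
                  fix bet cong e assume m: "models bet cong e ?H7"
                  then have m0: "models bet cong e ?H0" and m5: "models bet cong e ?H5" by simp_all
                  show "euclidean_plane.parallelogram bet cong (e p) (e q) (e r) (e s) (e t)
                    \<and> euclidean_plane.col bet (e s) (e q) (e m2) \<and> euclidean_plane.col bet (e p) (e r) (e w)
                    \<and> euclidean_plane.col bet (e p) (e r) (e m1) \<and> e w \<noteq> e m1 \<and> bet (e m2) (e f) (e m1)"
                    using P[OF m0] F[OF m5] W[OF m] by blast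
                next
                  fix q1
                  let ?H8 = "insert (on_line s q q1) (insert (Bet w f q1) ?H7)"
                  have H8: "admissible ?H8" using admissible_insert[OF admissible_insert[OF H7]] by simp
                  show "E5 \<union> ?H8 \<turnstile> G"
                  proof (rule parallel_step[OF H8, of p q r s t q1 p w f])
                    fix bet cong e assume m: "models bet cong e ?H8"
                    interpret euclidean_plane bet cong by (rule models_plane[OF m])
                    have m0: "models bet cong e ?H0" and m7: "models bet cong e ?H7"
                      and b: "onl (e s) (e q) (e q1)" "bet (e w) (e f) (e q1)" using m by simp_all
                    show "parallelogram (e p) (e q) (e r) (e s) (e t) \<and> col (e s) (e q) (e q1)
                        \<and> col (e p) (e r) (e p)
                      \<and> col (e p) (e r) (e w) \<and> e p \<noteq> e w \<and> bet (e q1) (e f) (e w)"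
                      using P[OF m0] W[OF m7] onl_imp_col[OF b(1)] bet_sym[OF b(2)] col_triv(3) by metis
                  next
                    fix h
                    let ?H9 = "insert (on_line s q h) (insert (Bet p f h) ?H8)"
                    have H9: "admissible ?H9" using admissible_insert[OF admissible_insert[OF H8]] by simp
                    have "E5 \<union> ?H9 \<turnstile> on_line s q h \<^bold>\<and> on_line p a h"
                    proof (rule provable[OF H9])
                      fix bet cong e assume m: "models bet cong e ?H9"
                      interpret euclidean_plane bet cong by (rule models_plane[OF m])
                      have m0: "models bet cong e ?H0" and m5: "models bet cong e ?H5"
                        and b: "onl (e s) (e q) (e h)" "bet (e p) (e f) (e h)" using m by simp_all
                      have "col (e p) (e f) (e a)" "e p \<noteq> e f" using F[OF m5] col_perm(2) by metis+
                      then have "col (e p) (e a) (e h)" using col_trans bt_col[OF bet_bt[OF b(2)]] by blast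
                      then show "sat UNIV bet cong e (on_line s q h \<^bold>\<and> on_line p a h)"
                        using b(1) onl_iff_col N[OF m0] by simp
                    qed simp_all
                    then show "E5 \<union> ?H9 \<turnstile> G" unfolding G_def by (intro ExistsI[of _ h]) simp
                  qed
                qed
              qed
            qed
          qed
        qed
      qed
    qed
  qed
  moreover have "insert (strong_parallel_hypotheses p q r s t a) E5 \<turnstile> p \<^bold>\<noteq> r"
  proof -
    have "insert (strong_parallel_hypotheses p q r s t a) E5 \<turnstile> strong_parallel_hypotheses p q r s t a" by (rule Assm) simp
    then show ?thesis
      unfolding strong_parallel_hypotheses_def by (rule ConE1[OF ConE2[OF ConE2[OF ConE2[OF ConE2]]]])
  qed
  ultimately show ?thesis using deriv_cut by (metis Un_insert_right sup_bot.right_neutral)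
qed

lemma deriv_univ_closure: "(\<And>B. B \<in> \<Gamma> \<Longrightarrow> fv B = {})
    \<Longrightarrow> \<Gamma> \<turnstile> A \<Longrightarrow> \<Gamma> \<turnstile> univ_closure n A"
proof -
  assume c: "\<And>B. B \<in> \<Gamma> \<Longrightarrow> fv B = {}" and A: "\<Gamma> \<turnstile> A"
  have "shift B = B" if "B \<in> \<Gamma>" for B
    using ren_cong[of B Suc "\<lambda>n. n"] c[OF that] by (simp add: ren_id)
  then have s: "shift ` \<Gamma> = \<Gamma>" by simp
  have "\<Gamma> \<turnstile> (Forall ^^ n) A" using A
  proof (induction n)
    case (Suc n)
    then show ?case using ForallI[of \<Gamma> "(Forall ^^ n) A"] s by simp
  qed simp
  then show ?thesis unfolding univ_closure_def .
qed

theorem corollary9p5: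
  "neutral_geometry \<turnstile> euclid5 \<^bold>\<longrightarrow> strong_parallel_postulate"
proof (rule ImpI)
  have "E5 \<turnstile> strong_parallel_hypotheses 5 4 3 2 1 0 \<^bold>\<longrightarrow> Exists (on_line (Suc 2) (Suc 4) 0 \<^bold>\<and> on_line (Suc 5) (Suc 0) 0)"
    by (rule ImpI[OF intersection_constructed])
  moreover have "fv B = {}" if "B \<in> E5" for B
    using universal_sentence_axioms that unfolding E5_def universal_sentence_def by blast
  ultimately have "E5 \<turnstile> strong_parallel_postulate"
    unfolding strong_parallel_postulate_def strong_parallel_hypotheses_def
        by (intro deriv_univ_closure) simp_all
  then show "insert euclid5 neutral_geometry \<turnstile> strong_parallel_postulate"
    unfolding E5_def .
qed

end
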